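(* Let $\mathcal{A}$ be a C$^*$-algebra (not necessarily unital) and let $\mathcal{M}$ be a Banach $\mathcal{A}$-bimodule. Then every generalized Jordan derivation of the third type $F:\mathcal{A}\to\mathcal{M}$ is continuous.
   Context: For $a\in\mathcal{A}$ and $b$ in $\mathcal{A}$ or in $\mathcal{M}$ write $a\circ b=b\circ a=\frac12(ab+ba)$. A linear mapping $F:\mathcal{A}\to\mathcal{M}$ is a \emph{generalized Jordan derivation of the third type} if there exist (not necessarily linear) maps $G,H:\mathcal{A}\to\mathcal{M}$ such that $F(a\circ b)=G(a)\circ b+a\circ H(b)$ for all $a,b\in\mathcal{A}$. *)

theory Defs
  imports "HOL-Analysis.Analysis"
begin

text \<open>
  Complex structures extend the real ones of the library: \<open>scaleR\<close> is the restriction of the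
  complex scalar multiplication to the reals, so that norm, topology and completeness are those
  of \<^class>\<open>real_normed_vector\<close> and \<^class>\<open>banach\<close>. The algebras need not have a unit.
\<close>

class complex_vector = ab_group_add + scaleR +
  fixes scaleC :: "complex \<Rightarrow> 'a \<Rightarrow> 'a" (infixr "*\<^sub>C" 75)
  assumes scaleC_add_right: "c *\<^sub>C (x + y) = c *\<^sub>C x + c *\<^sub>C y"
    and scaleC_add_left: "(c + d) *\<^sub>C x = c *\<^sub>C x + d *\<^sub>C x"
    and scaleC_scaleC: "c *\<^sub>C (d *\<^sub>C x) = (c * d) *\<^sub>C x"
    and scaleC_one: "1 *\<^sub>C x = x"
    and scaleR_scaleC: "r *\<^sub>R x = complex_of_real r *\<^sub>C x"

class complex_normed_vector = complex_vector + real_normed_vector +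
  assumes norm_scaleC: "norm (c *\<^sub>C x) = cmod c * norm x"

class complex_banach = complex_normed_vector + banach

class complex_normed_algebra = complex_normed_vector + real_normed_algebra +
  assumes mult_scaleC_left: "(c *\<^sub>C x) * y = c *\<^sub>C (x * y)"
    and mult_scaleC_right: "x * (c *\<^sub>C y) = c *\<^sub>C (x * y)"

class cstar_algebra = complex_normed_algebra + complex_banach +
  fixes star :: "'a \<Rightarrow> 'a"
  assumes star_add: "star (x + y) = star x + star y"
    and star_scaleC: "star (c *\<^sub>C x) = cnj c *\<^sub>C star x"
    and star_mult: "star (x * y) = star y * star x"
    and star_star: "star (star x) = x"
    and cstar_identity: "norm (star x * x) = (norm x)\<^sup>2"

text \<open>
  The predicate \<^const>\<open>bounded_bilinear\<close> only yields real bilinearity and the estimates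
  \<open>norm (lact a m) \<le> K * norm a * norm m\<close> and \<open>norm (ract m a) \<le> K * norm m * norm a\<close> for some
  constants \<open>K\<close>, not necessarily \<open>1\<close>; complex homogeneity is required separately.
\<close>

locale banach_bimodule =
  fixes lact :: "'a::complex_normed_algebra \<Rightarrow> 'm::complex_banach \<Rightarrow> 'm"
    and ract :: "'m \<Rightarrow> 'a \<Rightarrow> 'm"
  assumes bounded_bilinear_lact: "bounded_bilinear lact"
    and bounded_bilinear_ract: "bounded_bilinear ract"
    and lact_scaleC_left: "lact (c *\<^sub>C a) m = c *\<^sub>C lact a m"
    and lact_scaleC_right: "lact a (c *\<^sub>C m) = c *\<^sub>C lact a m"
    and ract_scaleC_left: "ract (c *\<^sub>C m) a = c *\<^sub>C ract m a"
    and ract_scaleC_right: "ract m (c *\<^sub>C a) = c *\<^sub>C ract m a"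
    and lact_mult: "lact (a * b) m = lact a (lact b m)"
    and ract_mult: "ract m (a * b) = ract (ract m a) b"
    and lact_ract: "ract (lact a m) b = lact a (ract m b)"

definition jordan_mult :: "'a::complex_normed_algebra \<Rightarrow> 'a \<Rightarrow> 'a" where
  "jordan_mult a b = (1 / 2) *\<^sub>C (a * b + b * a)"

text \<open>As \<open>a \<circ> m = m \<circ> a\<close>, one function serves for both orders of the arguments.\<close>

definition jordan_act ::
  "('a \<Rightarrow> 'm \<Rightarrow> 'm) \<Rightarrow> ('m \<Rightarrow> 'a \<Rightarrow> 'm) \<Rightarrow> 'a::complex_normed_algebra \<Rightarrow> 'm::complex_banach \<Rightarrow> 'm" where
  "jordan_act lact ract a m = (1 / 2) *\<^sub>C (lact a m + ract m a)"

definition generalized_jordan_derivation_third_type ::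
  "('a \<Rightarrow> 'm \<Rightarrow> 'm) \<Rightarrow> ('m \<Rightarrow> 'a \<Rightarrow> 'm) \<Rightarrow> ('a::complex_normed_algebra \<Rightarrow> 'm::complex_banach) \<Rightarrow> bool" where
  "generalized_jordan_derivation_third_type lact ract F \<longleftrightarrow>
     Vector_Spaces.linear scaleC scaleC F \<and>
     (\<exists>G H :: 'a \<Rightarrow> 'm. \<forall>a b.
        F (jordan_mult a b) = jordan_act lact ract b (G a) + jordan_act lact ract a (H b))"

end

(*
Averaging the two maps gives F(ab + ba) = b.D(a) + a.D(b) with one map D and a.m = am + ma. As
D(a).b = F(ab + ba) - a.D(b) is linear in a and bounded linear in b, the set J0 of all b for which
a |-> F(ab + ba) is bounded is a closed subspace with a uniform bound (Banach-Steinhaus), and F is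
bounded once J0 contains every self-adjoint k, because k = k^(1/3) k^(2/3).

If F is bounded on a corner dAd, the elements for which d is a local unit (with some room) are in
J0: off-diagonal null sequences have a common right factor r, obtained from the order structure of
A, and F(rv + vr) is controlled for fixed r. By a gliding hump, F cannot be unbounded on infinitely
many orthogonal corners. So if J0 is not everything, there is a hereditary subalgebra, not inside
J0, which does not split into two orthogonal ones of this kind. There the functional calculus of
every self-adjoint k has at most one singular point t, whence k^2 - tk is in J0; this forces J0 to
have codimension at most one in the self-adjoint part. Then F is bounded on the subalgebra, which
contradicts the statement on corners.
*)

theory Submission
  imports Defs
begin

section \<open>Unitization\<close>

text \<open>The hypothesis concerns Jordan products only, so \<open>J0\<close> is a closed subspace
  with no evident ideal property, and the usual continuity ideal of a derivation is not at hand.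
  Membership in \<open>J0\<close> has to be produced from bounds for \<open>F\<close> on corners,
  with functions of a single self-adjoint element as cut-offs; each cut-off is surrounded by a wider
  one, which explains the chains of local units. The map \<open>D\<close> may be far from linear.
  Only its slices \<open>jact b (D a)\<close> are linear in \<open>a\<close>, and the boundedness
  arguments are applied to these. The estimate through \<open>k^(1/3) k^(2/3)\<close> requires both
  factors in \<open>J0\<close>, which is why all functions of \<open>k\<close>, and not just
  \<open>k\<close>, are followed. As \<open>A\<close> may lack a unit, functional calculus and
  positivity are expressed through the operators \<open>x |-> c x + f(k) x\<close> on
  \<open>A\<close>.\<close>

lemma scaleC_zero_minus:
  fixes x :: "'a::complex_normed_vector"
  shows scaleC_zero_left [simp]: "0 *\<^sub>C x = 0"
    and scaleC_zero_right [simp]: "c *\<^sub>C (0::'a) = 0"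
    and scaleC_minus_left: "(- c) *\<^sub>C x = - (c *\<^sub>C x)"
    and scaleC_minus_right: "c *\<^sub>C (- x) = - (c *\<^sub>C x)"
proof -
  show z1: "0 *\<^sub>C x = 0" using scaleC_add_left[of 0 0 x] by simp
  show z2: "c *\<^sub>C (0::'a) = 0" using scaleC_add_right[of c 0 "0::'a"] by simp
  show "(- c) *\<^sub>C x = - (c *\<^sub>C x)"
    using scaleC_add_left[of "-c" c x] z1 by (simp add: eq_neg_iff_add_eq_0)
  show "c *\<^sub>C (- x) = - (c *\<^sub>C x)"
    using scaleC_add_right[of c "-x" x] z2 by (simp add: eq_neg_iff_add_eq_0)
qed

lemma scaleC_diff_left: "(c - d) *\<^sub>C x = c *\<^sub>C x - d *\<^sub>C (x::'a::complex_normed_vector)"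
  using scaleC_add_left[of c "- d" x] by (simp add: scaleC_minus_left)

text \<open>The unitization hosts power series and polynomials with a constant term. It carries the
  l1-norm, a Banach algebra norm but in general no C*-norm; sharp estimates are made on
  \<open>A\<close> itself, through the action \<open>uact\<close>.\<close>

datatype 'a unitization = Unitization (scalar_part: complex) (vector_part: 'a)

instantiation unitization :: (complex_normed_algebra) real_normed_algebra_1
begin

definition "0 = Unitization 0 0"
definition "1 = Unitization 1 0"
definition "z + w = Unitization (scalar_part z + scalar_part w) (vector_part z + vector_part w)"
definition "z - w = Unitization (scalar_part z - scalar_part w) (vector_part z - vector_part w)"
definition "- z = Unitization (- scalar_part z) (- vector_part z)"
definition "z * w = Unitization (scalar_part z * scalar_part w)
  (scalar_part z *\<^sub>C vector_part w + scalar_part w *\<^sub>C vector_part z + vector_part z * vector_part w)"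
definition "r *\<^sub>R z = Unitization (r *\<^sub>R scalar_part z) (r *\<^sub>R vector_part z)"
definition "norm z = norm (scalar_part z) + norm (vector_part z)"
definition dist_unitization :: "'a unitization \<Rightarrow> 'a unitization \<Rightarrow> real"
  where "dist_unitization z w = norm (z - w)"
definition sgn_unitization :: "'a unitization \<Rightarrow> 'a unitization"
  where "sgn_unitization z = inverse (norm z) *\<^sub>R z"
definition "(uniformity :: ('a unitization \<times> 'a unitization) filter) = (INF e\<in>{0<..}. principal {(x, y). dist x y < e})"
definition "open (U :: 'a unitization set) \<longleftrightarrow> (\<forall>x\<in>U. eventually (\<lambda>(x', y). x' = x \<longrightarrow> y \<in> U) uniformity)"

lemmas unitization_defs = zero_unitization_def one_unitization_def plus_unitization_def
  minus_unitization_def uminus_unitization_def times_unitization_def scaleR_unitization_def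

instance
proof
  fix x y z :: "'a unitization" and r s :: real
  show "x + y + z = x + (y + z)" "x + y = y + x" "0 + x = x" "- x + x = 0" "x - y = x + - y"
    by (simp_all add: unitization_defs)
  show "r *\<^sub>R (x + y) = r *\<^sub>R x + r *\<^sub>R y" "(r + s) *\<^sub>R x = r *\<^sub>R x + s *\<^sub>R x"
    "r *\<^sub>R s *\<^sub>R x = (r * s) *\<^sub>R x" "1 *\<^sub>R x = x"
    by (simp_all add: unitization_defs algebra_simps)
  show "x * y * z = x * (y * z)"
    by (simp add: unitization_defs mult_scaleC_left mult_scaleC_right scaleC_add_right scaleC_add_left
        scaleC_scaleC algebra_simps)
  show "(x + y) * z = x * z + y * z" "x * (y + z) = x * y + x * z"
    by (simp_all add: unitization_defs scaleC_add_right scaleC_add_left algebra_simps)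
  show "r *\<^sub>R x * y = r *\<^sub>R (x * y)" "x * r *\<^sub>R y = r *\<^sub>R (x * y)"
    by (simp_all add: unitization_defs scaleC_add_right scaleC_add_left scaleR_scaleC scaleC_scaleC
        mult_scaleC_left mult_scaleC_right mult.commute[of "complex_of_real r"] scaleR_conv_of_real)
  show "1 * x = x" "x * 1 = x"
    by (simp_all add: unitization_defs scaleC_one)
  show "(0::'a unitization) \<noteq> 1" by (simp add: unitization_defs)
  show "dist x y = norm (x - y)" by (fact dist_unitization_def)
  show "sgn x = inverse (norm x) *\<^sub>R x" by (fact sgn_unitization_def)
  show "(uniformity :: ('a unitization \<times> 'a unitization) filter) = (INF e\<in>{0<..}. principal {(x, y). dist x y < e})"
    by (fact uniformity_unitization_def)
  show "open U \<longleftrightarrow> (\<forall>x\<in>U. \<forall>\<^sub>F (x', y) in uniformity. x' = x \<longrightarrow> y \<in> U)" for U :: "'a unitization set"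
    by (fact open_unitization_def)
  show "(norm x = 0) = (x = 0)"
    by (cases x) (auto simp: norm_unitization_def unitization_defs add_nonneg_eq_0_iff)
  show "norm (x + y) \<le> norm x + norm y"
    using norm_triangle_ineq[of "scalar_part x" "scalar_part y"]
      norm_triangle_ineq[of "vector_part x" "vector_part y"]
    by (simp add: norm_unitization_def unitization_defs)
  show "norm (r *\<^sub>R x) = \<bar>r\<bar> * norm x"
    by (simp add: norm_unitization_def unitization_defs algebra_simps)
  show "norm (1::'a unitization) = 1" by (simp add: norm_unitization_def unitization_defs)
  show "norm (x * y) \<le> norm x * norm y"
  proof -
    have "norm (scalar_part x *\<^sub>C vector_part y + scalar_part y *\<^sub>C vector_part x + vector_part x * vector_part y)
      \<le> cmod (scalar_part x) * norm (vector_part y) + cmod (scalar_part y) * norm (vector_part x)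
        + norm (vector_part x) * norm (vector_part y)"
      by (rule norm_triangle_le add_mono norm_mult_ineq | simp add: norm_scaleC)+
    then show ?thesis
      by (simp add: norm_unitization_def unitization_defs norm_mult algebra_simps)
  qed
qed

end

lemma scalar_part_simps [simp]:
  "scalar_part (0::'a::complex_normed_algebra unitization) = 0"
  "scalar_part (1::'a::complex_normed_algebra unitization) = 1"
  "scalar_part (x + y) = scalar_part x + scalar_part (y::'a unitization)"
  "scalar_part (x - y) = scalar_part x - scalar_part (y::'a unitization)"
  "scalar_part (- y) = - scalar_part (y::'a unitization)"
  "scalar_part (x * y) = scalar_part x * scalar_part (y::'a unitization)"
  "scalar_part (r *\<^sub>R y) = r *\<^sub>R scalar_part (y::'a unitization)"
  by (simp_all add: unitization_defs)

lemma vector_part_simps [simp]: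
  "vector_part (0::'a::complex_normed_algebra unitization) = 0"
  "vector_part (1::'a::complex_normed_algebra unitization) = 0"
  "vector_part (x + y) = vector_part x + vector_part (y::'a unitization)"
  "vector_part (x - y) = vector_part x - vector_part (y::'a unitization)"
  "vector_part (- y) = - vector_part (y::'a unitization)"
  "vector_part (r *\<^sub>R y) = r *\<^sub>R vector_part (y::'a unitization)"
  by (simp_all add: unitization_defs)

lemma norm_parts_le:
  "cmod (scalar_part z) \<le> norm z" "norm (vector_part z) \<le> norm (z::'a::complex_normed_algebra unitization)"
  by (simp_all add: norm_unitization_def)

lemma bounded_linear_parts:
  "bounded_linear (scalar_part :: 'a::complex_normed_algebra unitization \<Rightarrow> complex)"
  "bounded_linear (vector_part :: 'a::complex_normed_algebra unitization \<Rightarrow> 'a)"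
  by (rule bounded_linear_intro[of _ 1]; simp add: norm_parts_le)+

instance unitization :: ("{complex_normed_algebra, banach}") banach
proof
  fix X :: "nat \<Rightarrow> 'a unitization"
  assume X: "Cauchy X"
  obtain s where s: "(\<lambda>n. scalar_part (X n)) \<longlonglongrightarrow> s"
    using bounded_linear.Cauchy[OF bounded_linear_parts(1) X] Cauchy_convergent convergentD by blast
  obtain v where v: "(\<lambda>n. vector_part (X n)) \<longlonglongrightarrow> v"
    using bounded_linear.Cauchy[OF bounded_linear_parts(2) X] Cauchy_convergent convergentD by blast
  have "X \<longlonglongrightarrow> Unitization s v"
  proof (subst tendsto_dist_iff, unfold dist_unitization_def norm_unitization_def)
    have "(\<lambda>n. norm (scalar_part (X n) - s) + norm (vector_part (X n) - v)) \<longlonglongrightarrow> 0 + 0"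
      using s v by (intro tendsto_add tendsto_norm_zero) (simp_all add: LIM_zero)
    then show "(\<lambda>n. cmod (scalar_part (X n - Unitization s v)) + norm (vector_part (X n - Unitization s v))) \<longlonglongrightarrow> 0"
      by simp
  qed
  then show "convergent X" by (rule convergentI)
qed

text \<open>The left regular action of the unitization on \<open>A\<close>. Operator bounds for this
  action take the place of the C*-norm of the unitization.\<close>

definition uact :: "'a::complex_normed_algebra unitization \<Rightarrow> 'a \<Rightarrow> 'a"
  where "uact z x = scalar_part z *\<^sub>C x + vector_part z * x"

lemma uact_simps:
  "uact 1 x = x" "uact 0 x = 0" "uact (z + w) x = uact z x + uact w x"
  "uact (z - w) x = uact z x - uact w x" "uact (- z) x = - uact z x"
  "uact (r *\<^sub>R z) x = r *\<^sub>R uact z x"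
  "uact (z * w) x = uact z (uact w x)"
  "uact (Unitization c v) x = c *\<^sub>C x + v * x"
  by (simp_all add: uact_def scaleC_one scaleC_add_left scaleC_add_right scaleC_scaleC scaleC_diff_left
      unitization_defs scaleC_minus_left scaleR_conv_of_real
      mult_scaleC_left mult_scaleC_right algebra_simps scaleR_scaleC)

lemma norm_uact_le: "norm (uact z x) \<le> norm z * norm x"
proof -
  have "norm (uact z x) \<le> cmod (scalar_part z) * norm x + norm (vector_part z) * norm x"
    unfolding uact_def by (rule norm_triangle_le add_mono norm_mult_ineq | simp add: norm_scaleC)+
  then show ?thesis by (simp add: norm_unitization_def algebra_simps)
qed

lemma bounded_linear_uact: "bounded_linear (\<lambda>z. uact z x)"
  by (rule bounded_linear_intro[of _ "norm x"]) (simp_all add: uact_simps norm_uact_le)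

lemma uact_sum: "uact (sum f A) x = (\<Sum>i\<in>A. uact (f i) x)"
  by (rule linear_sum[OF bounded_linear.linear[OF bounded_linear_uact]])

section \<open>Involution and polynomials in the unitization\<close>

lemma star_zero [simp]: "star (0::'a::cstar_algebra) = 0"
  using star_add[of "0::'a" 0] by simp

lemma star_minus: "star (- x) = - star (x::'a::cstar_algebra)"
  using star_add[of x "- x"] by (simp add: eq_neg_iff_add_eq_0 add.commute)

lemma star_diff: "star (x - y) = star x - star (y::'a::cstar_algebra)"
  using star_add[of x "- y"] by (simp add: star_minus)

lemma star_scaleR: "star (r *\<^sub>R x) = r *\<^sub>R star (x::'a::cstar_algebra)"
  by (simp add: scaleR_scaleC star_scaleC)

lemma norm_star [simp]: "norm (star x) = norm (x::'a::cstar_algebra)"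
proof -
  have le: "norm y \<le> norm (star y)" for y :: 'a
  proof (cases "y = 0")
    case False
    have "norm y * norm y \<le> norm (star y) * norm y"
      using norm_mult_ineq[of "star y" y] by (simp add: cstar_identity power2_eq_square)
    then show ?thesis using False by simp
  qed simp
  show ?thesis using le[of x] le[of "star x"] by (simp add: star_star)
qed

lemma bounded_linear_star: "bounded_linear (star :: 'a::cstar_algebra \<Rightarrow> 'a)"
  by (rule bounded_linear_intro[of _ 1]) (simp_all add: star_add star_scaleR)

lemmas star_simps = star_add star_diff star_minus star_mult star_star star_scaleR

definition ustar :: "'a::cstar_algebra unitization \<Rightarrow> 'a unitization"
  where "ustar z = Unitization (cnj (scalar_part z)) (star (vector_part z))"

lemma ustar_simps [simp]:
  fixes z w :: "'a::cstar_algebra unitization"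
  shows "ustar 0 = (0::'a unitization)" "ustar 1 = (1::'a unitization)"
    "ustar (z + w) = ustar z + ustar w" "ustar (z - w) = ustar z - ustar w" "ustar (- z) = - ustar z"
    "ustar (r *\<^sub>R z) = r *\<^sub>R ustar z" "ustar (z * w) = ustar w * ustar z" "ustar (ustar z) = z"
    "ustar (Unitization c v) = Unitization (cnj c) (star v)"
  by (simp_all add: ustar_def unitization_defs star_simps star_scaleC algebra_simps)

lemma ustar_power: "ustar (z ^ n) = ustar z ^ n"
  by (induction n) (simp_all add: power_commutes)

lemma bounded_linear_ustar: "bounded_linear (ustar :: 'a::cstar_algebra unitization \<Rightarrow> _)"
  by (rule bounded_linear_intro[of _ 1]) (simp_all add: norm_unitization_def, simp add: ustar_def)

lemma star_uact_mult: "star (uact z x) * y = star x * uact (ustar z) y"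
  by (simp add: uact_def ustar_def star_simps star_scaleC mult_scaleC_left mult_scaleC_right algebra_simps)

text \<open>The C*-identity on \<open>A\<close>, with \<open>z\<close> moved across as its adjoint.
  Iterated for self-adjoint \<open>z\<close>, it compares \<open>z\<close> with
  \<open>z ^ (2 ^ n)\<close>.\<close>

lemma norm_uact_power2: "(norm (uact z x))\<^sup>2 \<le> norm x * norm (uact (ustar z * z) x)"
proof -
  have "(norm (uact z x))\<^sup>2 = norm (star x * uact (ustar z * z) x)"
    by (simp add: cstar_identity[symmetric] star_uact_mult uact_simps)
  also have "\<dots> \<le> norm x * norm (uact (ustar z * z) x)"
    using norm_mult_ineq[of "star x" "uact (ustar z * z) x"] by simp
  finally show ?thesis .
qed

definition upoly :: "real poly \<Rightarrow> 'b::real_normed_algebra_1 \<Rightarrow> 'b"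
  where "upoly p z = fold_coeffs (\<lambda>a w. of_real a + z * w) p 0"

lemma upoly_0 [simp]: "upoly 0 z = 0"
  by (simp add: upoly_def)

lemma upoly_pCons [simp]: "upoly (pCons a p) z = of_real a + z * upoly p z"
  by (cases "p = 0 \<and> a = 0") (auto simp: upoly_def)

lemma upoly_1 [simp]: "upoly 1 z = 1"
  by (simp add: one_pCons)

lemma upoly_add: "upoly (p + q) z = upoly p z + upoly q z"
  by (induction p q rule: poly_induct2) (simp_all add: algebra_simps)

lemma upoly_smult: "upoly (smult c p) z = c *\<^sub>R upoly p z"
proof (induction p)
  case (pCons a p)
  then show ?case by (simp add: algebra_simps) (simp add: of_real_def)
qed simp

lemma upoly_diff: "upoly (p - q) z = upoly p z - upoly q z"
  using upoly_add[of "p - q" q z] by simp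

lemma upoly_mult: "upoly (p * q) z = upoly p z * upoly q z"
  by (induction p) (simp_all add: upoly_add upoly_smult algebra_simps scaleR_conv_of_real)

lemma upoly_power: "upoly (p ^ n) z = upoly p z ^ n"
  by (induction n) (simp_all add: upoly_mult)

lemma upoly_commute: "z * w = w * z \<Longrightarrow> upoly p z * w = w * upoly p z"
proof (induction p)
  case (pCons a p)
  have "z * upoly p z * w = w * (z * upoly p z)"
    using pCons by (metis mult.assoc)
  then show ?case by (simp add: algebra_simps scaleR_conv_of_real[symmetric]) (simp add: of_real_def)
qed simp

lemma upoly_altdef: "upoly p z = (\<Sum>i\<le>degree p. coeff p i *\<^sub>R z ^ i)"
proof (induction p)
  case (pCons a p)
  show ?case
  proof (cases "p = 0")
    case False
    then show ?thesis using pCons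
      by (simp add: sum.atMost_Suc_shift sum_distrib_left scaleR_conv_of_real[of a] del: sum.atMost_Suc)
  qed (simp add: of_real_def)
qed simp

lemma ustar_upoly: "ustar (upoly p z) = upoly p (ustar z)"
proof (induction p)
  case (pCons a p)
  have "upoly p (ustar z) * ustar z = ustar z * upoly p (ustar z)"
    by (rule upoly_commute) simp
  then show ?case using pCons by (simp add: of_real_def)
qed simp

section \<open>Square roots by the binomial series, and unitaries with prescribed real part\<close>

text \<open>Consecutive coefficients have the ratio (1/2 - n) / (n + 1), of modulus at most 1. This
  suffices to compare the binomial series with a geometric one.\<close>

lemma abs_half_gchoose_le: "\<bar>(1/2::real) gchoose n\<bar> \<le> 1"
proof (induction n)
  case (Suc n)
  have "(1/2 - real n) * ((1/2::real) gchoose n) = real (Suc n) * ((1/2) gchoose Suc n)"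
    using gbinomial_mult_1[of "1/2::real" n] by (simp add: algebra_simps)
  then have "\<bar>1/2 - real n\<bar> * \<bar>(1/2::real) gchoose n\<bar> = real (Suc n) * \<bar>(1/2) gchoose Suc n\<bar>"
    by (metis abs_mult abs_of_nat)
  moreover have "\<bar>1/2 - real n\<bar> * \<bar>(1/2::real) gchoose n\<bar> \<le> real (Suc n) * 1"
    by (intro mult_mono Suc.IH) auto
  ultimately have "real (Suc n) * \<bar>(1/2) gchoose Suc n\<bar> \<le> real (Suc n) * 1" by linarith
  then show ?case by (subst (asm) mult_le_cancel_left_pos) auto
qed simp

text \<open>The binomial series of exponent 1/2 at \<open>- y\<close>. By Vandermonde's identity its
  Cauchy square is the series of exponent 1, which stops after the linear term. The conclusion
  exposes the series so that self-adjointness and commutation of \<open>s\<close> can be read off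
  term by term.\<close>

lemma sqrt_one_minus_exists:
  fixes y :: "'a::{real_normed_algebra_1, banach}"
  assumes "norm y < 1"
  obtains c :: "nat \<Rightarrow> real" and s where "(\<lambda>n. c n *\<^sub>R y ^ n) sums s" "s * s = 1 - y"
proof -
  define c where "c n = ((1/2::real) gchoose n) * (-1) ^ n" for n
  have cle: "\<bar>c n\<bar> \<le> 1" for n
    using abs_half_gchoose_le[of n] by (simp add: c_def abs_mult power_abs)
  have summ: "summable (\<lambda>n. norm (c n *\<^sub>R y ^ n))"
  proof (rule summable_comparison_test')
    show "summable (\<lambda>n. norm y ^ n)" using assms by (simp add: summable_geometric)
    show "norm (norm (c n *\<^sub>R y ^ n)) \<le> norm y ^ n" for n
      using mult_mono[OF cle[of n] norm_power_ineq[of y n]] by simp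
  qed
  define s where "s = (\<Sum>n. c n *\<^sub>R y ^ n)"
  have "(\<lambda>k. \<Sum>i\<le>k. (c i *\<^sub>R y ^ i) * (c (k - i) *\<^sub>R y ^ (k - i))) sums (s * s)"
    unfolding s_def by (rule Cauchy_product_sums[OF summ summ])
  also have "(\<lambda>k. \<Sum>i\<le>k. (c i *\<^sub>R y ^ i) * (c (k - i) *\<^sub>R y ^ (k - i)))
    = (\<lambda>k. (((1::real) gchoose k) * (-1) ^ k) *\<^sub>R y ^ k)"
  proof
    fix k
    have pow: "b ^ i * b ^ (k - i) = b ^ k" if "i \<le> k" for i and b :: "'b::monoid_mult"
      using that power_add[of b i "k - i"] by simp
    have "(\<Sum>i\<le>k. (c i *\<^sub>R y ^ i) * (c (k - i) *\<^sub>R y ^ (k - i))) = (\<Sum>i\<le>k. c i * c (k - i)) *\<^sub>R y ^ k"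
      unfolding scaleR_sum_left by (rule sum.cong) (simp_all add: pow)
    also have "(\<Sum>i\<le>k. c i * c (k - i)) = (\<Sum>i\<in>{0..k}. ((1/2) gchoose i) * ((1/2) gchoose (k - i))) * (-1) ^ k"
      unfolding sum_distrib_right
    proof (rule sum.cong)
      show "c i * c (k - i) = ((1/2) gchoose i) * ((1/2) gchoose (k - i)) * (-1) ^ k" if "i \<in> {0..k}" for i
        using pow[of i "-1::real"] that by (simp add: c_def mult.assoc mult.left_commute[of "(-1) ^ i"])
    qed auto
    finally show "(\<Sum>i\<le>k. (c i *\<^sub>R y ^ i) * (c (k - i) *\<^sub>R y ^ (k - i)))
      = (((1::real) gchoose k) * (-1) ^ k) *\<^sub>R y ^ k"
      by (simp add: gbinomial_Vandermonde)
  qed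
  finally have 1: "(\<lambda>k. (((1::real) gchoose k) * (-1) ^ k) *\<^sub>R y ^ k) sums (s * s)" .
  have "((1::real) gchoose k) = 0" if "k \<notin> {0, 1}" for k
    using that binomial_gbinomial[of 1 k, where 'a=real] by (simp add: binomial_eq_0)
  then have "(\<lambda>k. (((1::real) gchoose k) * (-1) ^ k) *\<^sub>R y ^ k) sums (\<Sum>k\<in>{0,1}. (((1::real) gchoose k) * (-1) ^ k) *\<^sub>R y ^ k)"
    by (intro sums_finite) auto
  from sums_unique2[OF 1 this] have "s * s = 1 - y" by simp
  moreover have "(\<lambda>n. c n *\<^sub>R y ^ n) sums s"
    unfolding s_def by (rule summable_sums[OF summable_norm_cancel[OF summ]])
  ultimately show thesis using that by blast
qed

definition uscal :: "complex \<Rightarrow> 'a::complex_normed_algebra unitization"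
  where "uscal c = Unitization c 0"

lemma uscal_commute: "uscal c * z = z * uscal c"
  by (simp add: uscal_def unitization_defs)

lemma uscal_simps: "uscal c * uscal d = uscal (c * d)" "uscal 1 = 1"
  "uscal 0 = 0" "uscal (c + d) = uscal c + uscal d" "uscal (- c) = - uscal c"
  "uact (uscal c) x = c *\<^sub>C x" "r *\<^sub>R uscal c = uscal (r *\<^sub>R c)"
  by (simp_all add: uscal_def unitization_defs uact_def)

lemma ustar_uscal [simp]: "ustar (uscal c) = uscal (cnj c)"
  by (simp add: uscal_def)

text \<open>With \<open>z\<close> as a cosine, \<open>w = z + i sqrt(1 - z^2)\<close>. The bound
  \<open>norm z < 1\<close> makes the series for the square root converge.\<close>

lemma unitary_exists:
  fixes z :: "'a::cstar_algebra unitization"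
  assumes sa: "ustar z = z" and nz: "norm z < 1"
  obtains w where "ustar w * w = 1" "w * ustar w = 1" "w + ustar w = 2 *\<^sub>R z"
proof -
  have "norm (z * z) \<le> norm z * norm z" by (rule norm_mult_ineq)
  also have "\<dots> < 1 * 1" using nz by (intro mult_strict_mono) auto
  also have "\<dots> = 1" by simp
  finally obtain c s where s: "(\<lambda>n. c n *\<^sub>R (z * z) ^ n) sums s" "s * s = 1 - z * z"
    by (rule sqrt_one_minus_exists)
  have us: "ustar s = s"
  proof -
    have "(\<lambda>n. ustar (c n *\<^sub>R (z * z) ^ n)) sums ustar s"
      by (rule bounded_linear.sums[OF bounded_linear_ustar s(1)])
    then have "(\<lambda>n. c n *\<^sub>R (z * z) ^ n) sums ustar s"
      by (simp add: ustar_power sa)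
    then show ?thesis using s(1) sums_unique2 by blast
  qed
  have zs: "z * s = s * z"
  proof -
    have "z * (z * z) ^ n = (z * z) ^ n * z" for n
      by (simp add: power2_eq_square[symmetric] power_mult[symmetric] power_commutes)
    then have "(\<lambda>n. z * (c n *\<^sub>R (z * z) ^ n)) = (\<lambda>n. (c n *\<^sub>R (z * z) ^ n) * z)" by auto
    moreover have "(\<lambda>n. z * (c n *\<^sub>R (z * z) ^ n)) sums (z * s)" "(\<lambda>n. (c n *\<^sub>R (z * z) ^ n) * z) sums (s * z)"
      by (rule bounded_linear.sums[OF bounded_linear_mult_right s(1)],
          rule bounded_linear.sums[OF bounded_linear_mult_left s(1)])
    ultimately show ?thesis using sums_unique2 by metis
  qed
  define I where "I = (uscal \<i> :: 'a unitization)"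
  have II: "I * I = - 1" by (simp add: I_def uscal_simps)
  have Is: "I * s = s * I" and Iz: "I * z = z * I" unfolding I_def by (rule uscal_commute)+
  have uI: "ustar I = - I" by (simp add: I_def uscal_simps)
  have "I * s * (I * s) = (I * I) * (s * s)"
    by (metis Is mult.assoc)
  then have IsIs: "I * s * (I * s) = z * z - 1" using s(2) II by simp
  have zIs: "z * (I * s) = I * s * z"
    by (metis Iz zs mult.assoc)
  have "ustar (z + I * s) = z - I * s" using sa us uI Is by simp
  moreover have "(z - I * s) * (z + I * s) = 1" "(z + I * s) * (z - I * s) = 1"
    using IsIs zIs by (simp_all add: ring_distribs)
  ultimately show thesis using that[of "z + I * s"] by (simp add: scaleR_2)
qed

section \<open>The norm of a polynomial in a self-adjoint element\<close>

text \<open>Orthogonality of the characters of the cyclic group of order \<open>M\<close>: for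
  distinct \<open>i\<close>, \<open>j\<close> below \<open>M\<close> the ratio is a root of unity
  other than 1, and its geometric sum vanishes.\<close>

lemma sum_cis_orthogonal:
  assumes "i < M" "j < M"
  shows "(\<Sum>m<M. cis (real j * (2 * pi * real m / real M)) * cis (- (real i * (2 * pi * real m / real M))))
    = (if i = j then of_nat M else 0)"
proof (cases "i = j")
  case True
  then show ?thesis by (simp add: cis_mult)
next
  case False
  define z where "z = cis (2 * pi * (real j - real i) / real M)"
  have M: "M > 0" using assms by simp
  have "z ^ M = cis (real M * (2 * pi * (real j - real i) / real M))"
    by (simp only: z_def Complex.DeMoivre)
  also have "\<dots> = cis (2 * pi * (real j - real i))"
    using M by simp
  also have "\<dots> = 1"
    by (rule cis_multiple_2pi) (metis Ints_diff Ints_of_nat)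
  finally have "z ^ M = 1" .
  moreover have "z \<noteq> 1"
  proof
    assume "z = 1"
    then have "cos (2 * pi * (real j - real i) / real M) = 1" by (simp add: z_def complex_eq_iff)
    then obtain k :: int where "2 * pi * (real j - real i) / real M = of_int k * 2 * pi"
      using cos_one_2pi_int by auto
    then have "(2 * pi) * (real j - real i) = (2 * pi) * (of_int k * real M)" using M by (simp add: field_simps)
    then have "real j - real i = of_int k * real M" by (subst (asm) mult_cancel_left) simp
    then have "real_of_int (int j - int i) = real_of_int (k * int M)" by simp
    then have eq: "int j - int i = k * int M" by linarith
    then have "int M dvd int j - int i" by simp
    moreover have "\<bar>int j - int i\<bar> < int M" using assms by auto
    ultimately have "int j - int i = 0" using zdvd_not_zless[of "\<bar>int j - int i\<bar>" "int M"] by fastforce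
    then show False using False by simp
  qed
  ultimately have "(\<Sum>m<M. z ^ m) = 0" by (simp add: geometric_sum)
  moreover have "cis (real j * (2 * pi * real m / real M)) * cis (- (real i * (2 * pi * real m / real M))) = z ^ m" for m
    by (simp add: z_def Complex.DeMoivre cis_mult algebra_simps diff_divide_distrib)
  ultimately show ?thesis using False by simp
qed

lemma uscal_mult_assoc: "uscal c * (uscal d * z) = uscal (c * d) * z"
  by (simp add: mult.assoc[symmetric] uscal_simps)

lemma uscal_sum: "uscal (\<Sum>i\<in>I. f i) = (\<Sum>i\<in>I. uscal (f i))"
  by (induction I rule: infinite_finite_induct) (simp_all add: uscal_simps)

text \<open>With \<open>k = (w + w\<^sup>*) / 2\<close> for a unitary \<open>w\<close>, discrete Fourier inversion over the
  roots of unity of order \<open>2 deg p + 1\<close> expresses \<open>p(k)\<close> by the values of \<open>p\<close> on \<open>[-1, 1]\<close>.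
  The dimension factor disappears later by applying the estimate to \<open>p ^ (2 ^ n)\<close>.\<close>

lemma norm_uact_upoly_weak:
  fixes k :: "'a::cstar_algebra unitization"
  assumes sa: "ustar k = k" and nk: "norm k < 1"
    and S: "\<And>t. \<bar>t\<bar> \<le> 1 \<Longrightarrow> \<bar>poly p t\<bar> \<le> S"
  shows "norm (uact (upoly p k) x) \<le> (2 * real (degree p) + 1) * S * norm x"
proof -
  obtain w where w: "ustar w * w = 1" "w * ustar w = 1" "w + ustar w = 2 *\<^sub>R k"
    using unitary_exists[OF sa nk] by blast
  have isom: "norm (uact w y) = norm y" for y
  proof -
    have "(norm (uact w y))\<^sup>2 = norm (star (uact w y) * uact w y)" by (rule cstar_identity[symmetric])
    also have "\<dots> = norm (star y * uact (ustar w * w) y)" by (simp only: star_uact_mult uact_simps)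
    also have "\<dots> = (norm y)\<^sup>2" by (simp add: w uact_simps cstar_identity)
    finally show ?thesis by simp
  qed
  have isom_pow: "norm (uact (w ^ n) y) = norm y" for n y
    by (induction n) (simp_all add: uact_simps isom)
  define N where "N = degree p"
  \<comment> \<open>After multiplication by \<open>w ^ N\<close> only the exponents 0 to
    \<open>2 N\<close> of \<open>w\<close> occur in \<open>p(k)\<close>, and \<open>2 N + 1\<close>
    roots of unity separate them.\<close>
  define M where "M = 2 * N + 1"
  define th where "th m = 2 * pi * real m / real M" for m
  define K where "K m = (\<Sum>i<M. uscal (cis (- (real i * th m))) * w ^ i)" for m
  have M0: "M > 0" by (simp add: M_def)
  have kw: "k * w ^ Suc j = (1/2) *\<^sub>R (w ^ Suc (Suc j) + w ^ j)" for j
  proof -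
    have "2 *\<^sub>R (k * w ^ Suc j) = (w + ustar w) * w ^ Suc j" by (simp add: w(3))
    also have "\<dots> = w ^ Suc (Suc j) + (ustar w * w) * w ^ j" by (simp add: algebra_simps)
    finally have "2 *\<^sub>R (k * w ^ Suc j) = w ^ Suc (Suc j) + w ^ j" by (simp add: w)
    from arg_cong[OF this, of "scaleR (1/2)"] show ?thesis by simp
  qed
  define g where "g j l m = cis (real j * th m) * complex_of_real (cos (th m) ^ l / real M)" for j l m
  \<comment> \<open>Since \<open>k\<close> is the mean of \<open>w\<close> and its inverse,
    \<open>k ^ l * w ^ j\<close> involves the exponents from \<open>j - l\<close> to
    \<open>j + l\<close>; the two conditions keep them within \<open>{0..<M}\<close>. Each factor
    \<open>k\<close> turns into a factor \<open>cos (th m)\<close> on the side of the roots of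
    unity.\<close>
  have mono: "k ^ l * w ^ j = (\<Sum>m<M. uscal (g j l m) * K m)"
    if "l \<le> j" "j + l \<le> 2 * N" for l j
    using that
  proof (induction l arbitrary: j)
    case 0
    have "(\<Sum>m<M. uscal (cis (real j * th m) * complex_of_real (1 / real M)) * K m)
      = (\<Sum>m<M. \<Sum>i<M. uscal (cis (real j * th m) * cis (- (real i * th m)) * complex_of_real (1 / real M)) * w ^ i)"
      unfolding K_def sum_distrib_left
      by (intro sum.cong refl) (simp only: uscal_mult_assoc mult_ac)
    also have "\<dots> = (\<Sum>i<M. uscal ((\<Sum>m<M. cis (real j * th m) * cis (- (real i * th m))) * complex_of_real (1 / real M)) * w ^ i)"
      by (subst sum.swap) (simp only: sum_distrib_right uscal_sum)
    also have "\<dots> = (\<Sum>i<M. if i = j then w ^ i else 0)"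
    proof (intro sum.cong refl)
      fix i assume i: "i \<in> {..<M}"
      have "j < M" using 0 by (simp add: M_def)
      with i show "uscal ((\<Sum>m<M. cis (real j * th m) * cis (- (real i * th m))) * complex_of_real (1 / real M)) * w ^ i
        = (if i = j then w ^ i else 0)"
        using sum_cis_orthogonal[of i M j] M0 by (simp add: th_def uscal_simps)
    qed
    also have "\<dots> = w ^ j" using 0 by (simp add: M_def)
    finally show ?case by (simp add: g_def)
  next
    case (Suc l)
    then obtain j' where j: "j = Suc j'" by (cases j) auto
    have "k ^ Suc l * w ^ j = k ^ l * (k * w ^ Suc j')"
      by (simp add: j power_commutes[symmetric] mult.assoc del: power_Suc2)
    also have "\<dots> = (1/2) *\<^sub>R (k ^ l * w ^ Suc (Suc j') + k ^ l * w ^ j')"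
      by (simp only: kw mult_scaleR_right ring_distribs)
    also have "\<dots> = (1/2) *\<^sub>R ((\<Sum>m<M. uscal (g (Suc (Suc j')) l m) * K m)
       + (\<Sum>m<M. uscal (g j' l m) * K m))"
      using Suc.IH[of "Suc (Suc j')"] Suc.IH[of "j'"] Suc.prems j by simp
    also have "\<dots> = (\<Sum>m<M. uscal (g j (Suc l) m) * K m)"
    proof -
      have c: "cis (real (Suc (Suc j')) * t) + cis (real j' * t) = cis (real j * t) * complex_of_real (2 * cos t)" for t
      proof -
        have "cis (real (Suc (Suc j')) * t) + cis (real j' * t) = cis (real j * t) * cis t + cis (real j * t) * cis (- t)"
          by (simp add: cis_mult j algebra_simps)
        also have "\<dots> = cis (real j * t) * (cis t + cis (- t))" by (simp add: algebra_simps)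
        also have "cis t + cis (- t) = complex_of_real (2 * cos t)" by (simp add: complex_eq_iff)
        finally show ?thesis .
      qed
      have "(1/2::real) *\<^sub>R (g (Suc (Suc j')) l m + g j' l m) = g j (Suc l) m" for m
      proof -
        have "g (Suc (Suc j')) l m + g j' l m = cis (real j * th m) * complex_of_real (2 * cos (th m)) *
          complex_of_real (cos (th m) ^ l / real M)"
          unfolding g_def c[symmetric] by (simp only: ring_distribs)
        then show ?thesis by (simp add: g_def scaleR_conv_of_real)
      qed
      then have "(1/2::real) *\<^sub>R (uscal (g (Suc (Suc j')) l m) * K m + uscal (g j' l m) * K m)
        = uscal (g j (Suc l) m) * K m" for m
        by (simp only: uscal_simps(4)[symmetric] ring_distribs[symmetric] mult_scaleR_left[symmetric] uscal_simps(7))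
      then show ?thesis by (simp only: sum.distrib[symmetric] scaleR_sum_right)
    qed
    finally show ?case .
  qed
  have "upoly p k * w ^ N = (\<Sum>l\<le>N. coeff p l *\<^sub>R (k ^ l * w ^ N))"
    by (simp add: upoly_altdef N_def sum_distrib_right)
  also have "\<dots> = (\<Sum>l\<le>N. \<Sum>m<M. coeff p l *\<^sub>R (uscal (g N l m) * K m))"
    by (intro sum.cong refl) (simp add: mono scaleR_sum_right)
  also have "\<dots> = (\<Sum>m<M. uscal (cis (real N * th m) * complex_of_real (poly p (cos (th m)) / real M)) * K m)"
  proof (subst sum.swap, rule sum.cong[OF refl])
    fix m
    have "poly p (cos (th m)) = (\<Sum>l\<le>N. coeff p l * cos (th m) ^ l)" by (simp add: poly_altdef N_def)
    then have "cis (real N * th m) * complex_of_real (poly p (cos (th m)) / real M)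
      = (\<Sum>l\<le>N. coeff p l *\<^sub>R (g N l m))"
      by (simp add: g_def sum_distrib_left sum_divide_distrib scaleR_conv_of_real algebra_simps)
    then show "(\<Sum>l\<le>N. coeff p l *\<^sub>R (uscal (g N l m) * K m))
      = uscal (cis (real N * th m) * complex_of_real (poly p (cos (th m)) / real M)) * K m"
      by (simp add: uscal_sum sum_distrib_right uscal_simps(7)[symmetric])
  qed
  finally have main: "upoly p k * w ^ N = (\<Sum>m<M. uscal (cis (real N * th m) * complex_of_real (poly p (cos (th m)) / real M)) * K m)" .
  \<comment> \<open>\<open>K m\<close> is a sum of \<open>M\<close> isometries with phases. This
    crude bound is the source of the factor \<open>2 deg p + 1\<close>.\<close>
  have nK: "norm (uact (K m) y) \<le> real M * norm y" for m y
  proof -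
    have "norm (uact (K m) y) \<le> (\<Sum>i<M. norm (uact (uscal (cis (- (real i * th m))) * w ^ i) y))"
      unfolding K_def uact_sum by (rule norm_sum)
    also have "\<dots> = real M * norm y"
      by (simp add: uact_simps uscal_simps norm_scaleC isom_pow)
    finally show ?thesis .
  qed
  define y where "y = uact (ustar w ^ N) x"
  have wN: "w ^ n * ustar w ^ n = 1" for n
  proof (induction n)
    case (Suc n)
    have "w ^ Suc n * ustar w ^ Suc n = w ^ n * (w * ustar w) * ustar w ^ n"
      by (simp only: power_Suc2[of w] power_Suc[of "ustar w"] mult.assoc)
    then show ?case using Suc w by simp
  qed simp
  have x: "uact (w ^ N) y = x" by (simp add: y_def wN uact_simps(7)[symmetric]) (simp add: uact_simps)
  then have ny: "norm y = norm x" using isom_pow by metis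
  have S0: "S \<ge> 0" using S[of 0] by simp
  have "norm (uact (upoly p k) x) = norm (uact (upoly p k * w ^ N) y)" by (simp add: uact_simps x)
  also have "\<dots> \<le> (\<Sum>m<M. norm (uact (uscal (cis (real N * th m) * complex_of_real (poly p (cos (th m)) / real M)) * K m) y))"
    unfolding main uact_sum by (rule norm_sum)
  also have "\<dots> = (\<Sum>m<M. (\<bar>poly p (cos (th m))\<bar> / real M) * norm (uact (K m) y))"
    by (simp add: uact_simps uscal_simps norm_scaleC norm_mult norm_divide)
  also have "\<dots> \<le> (\<Sum>m<M. (S / real M) * (real M * norm y))"
    by (intro sum_mono mult_mono divide_right_mono S nK) (auto simp: S0)
  also have "\<dots> = (2 * real (degree p) + 1) * S * norm x" using M0 by (simp add: ny M_def N_def)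
  finally show ?thesis .
qed

lemma power_exceeds_linear:
  fixes q c :: real
  assumes "q > 1"
  obtains n where "q ^ (2 ^ n) > c * 2 ^ n + 1"
proof -
  have "norm (1 / q) < 1" using assms by simp
  note lim = powser_times_n_limit_0[OF this] LIMSEQ_power_zero[OF this]
  have "(\<lambda>m. c * (of_nat m * (1 / q) ^ m) + (1 / q) ^ m) \<longlonglongrightarrow> c * 0 + 0"
    by (intro tendsto_add tendsto_mult tendsto_const lim)
  then have "eventually (\<lambda>m. c * (of_nat m * (1 / q) ^ m) + (1 / q) ^ m < 1) sequentially"
    by (simp add: order_tendsto_iff)
  then obtain m0 where m0: "\<And>m. m \<ge> m0 \<Longrightarrow> c * (of_nat m * (1 / q) ^ m) + (1 / q) ^ m < 1"
    by (auto simp: eventually_sequentially)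
  have "m0 \<le> 2 ^ m0" by (simp add: less_imp_le)
  from m0[OF this] assms have "q ^ (2 ^ m0) > c * 2 ^ m0 + 1"
    by (simp add: power_one_over field_simps)
  then show thesis by (rule that)
qed

text \<open>If the claim failed by a ratio \<open>q > 1\<close>, repeated squaring would make the
  failure for \<open>p ^ (2 ^ n)\<close> at least \<open>q ^ (2 ^ n)\<close>, whereas the weak
  estimate allows only a factor that is linear in the degree, hence in \<open>2 ^ n\<close>.\<close>

lemma norm_uact_upoly:
  fixes k :: "'a::cstar_algebra unitization"
  assumes sa: "ustar k = k" and nk: "norm k < 1"
    and S: "\<And>t. \<bar>t\<bar> \<le> 1 \<Longrightarrow> \<bar>poly p t\<bar> \<le> S"
  shows "norm (uact (upoly p k) x) \<le> S * norm x"
proof (rule ccontr)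
  assume neg: "\<not> ?thesis"
  have S0: "S \<ge> 0" using S[of 0] by simp
  have x0: "norm x > 0" using neg by (auto simp: uact_def)
  define A where "A n = norm (uact (upoly p k ^ (2 ^ n)) x)" for n
  have A0: "A 0 > S * norm x" using neg by (simp add: A_def)
  have sq: "(A n)\<^sup>2 \<le> norm x * A (Suc n)" for n
    using norm_uact_power2[of "upoly p k ^ (2 ^ n)" x]
    by (simp add: A_def ustar_power ustar_upoly sa power_add[symmetric] mult_2)
  have pow: "(A 0) ^ (2 ^ n) \<le> norm x ^ (2 ^ n - 1) * A n" for n
  proof (induction n)
    case (Suc n)
    have "(A 0) ^ (2 ^ Suc n) = ((A 0) ^ (2 ^ n))\<^sup>2" by (simp add: power_mult[symmetric] mult.commute)
    also have "\<dots> \<le> (norm x ^ (2 ^ n - 1) * A n)\<^sup>2" by (rule power_mono[OF Suc]) (simp add: A_def)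
    also have "\<dots> = norm x ^ (2 * (2 ^ n - 1)) * (A n)\<^sup>2"
      by (simp add: power_mult_distrib power_mult[symmetric] mult.commute)
    also have "\<dots> \<le> norm x ^ (2 * (2 ^ n - 1)) * (norm x * A (Suc n))"
      by (intro mult_left_mono sq) simp
    also have "\<dots> = norm x ^ (2 ^ Suc n - 1) * A (Suc n)"
    proof -
      have "2 ^ Suc n - 1 = Suc (2 * (2 ^ n - 1 :: nat))"
        using one_le_power[of "2::nat" n] unfolding power_Suc by linarith
      then show ?thesis by simp
    qed
    finally show ?case .
  qed simp
  have ub: "A n \<le> (2 * real (degree p) * 2 ^ n + 1) * S ^ (2 ^ n) * norm x" for n
  proof -
    have "A n \<le> (2 * real (degree (p ^ 2 ^ n)) + 1) * S ^ (2 ^ n) * norm x"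
      unfolding A_def upoly_power[symmetric]
      by (rule norm_uact_upoly_weak[OF sa nk]) (auto simp: poly_power power_abs intro!: power_mono S)
    also have "\<dots> \<le> (2 * real (degree p) * 2 ^ n + 1) * S ^ (2 ^ n) * norm x"
    proof (intro mult_right_mono)
      have "real (degree (p ^ 2 ^ n)) \<le> real (degree p * 2 ^ n)"
        by (rule of_nat_mono[OF degree_power_le])
      then show "2 * real (degree (p ^ 2 ^ n)) + 1 \<le> 2 * real (degree p) * 2 ^ n + 1" by simp
    qed (use S0 in auto)
    finally show ?thesis .
  qed
  have key: "(A 0) ^ (2 ^ n) \<le> (2 * real (degree p) * 2 ^ n + 1) * (S * norm x) ^ (2 ^ n)" for n
  proof -
    have "(A 0) ^ (2 ^ n) \<le> norm x ^ (2 ^ n - 1) * ((2 * real (degree p) * 2 ^ n + 1) * S ^ (2 ^ n) * norm x)"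
      by (rule order.trans[OF pow]) (intro mult_left_mono ub, simp)
    also have "\<dots> = (2 * real (degree p) * 2 ^ n + 1) * S ^ (2 ^ n) * (norm x ^ (2 ^ n - 1) * norm x)"
      by simp
    also have "norm x ^ (2 ^ n - 1) * norm x = norm x ^ (2 ^ n)"
      by (metis power_minus_mult zero_less_numeral zero_less_power)
    finally show ?thesis by (simp add: power_mult_distrib mult.assoc)
  qed
  show False
  proof (cases "S = 0")
    case True
    then show False using key[of 0] A0 by simp
  next
    case False
    with S0 x0 have Sx: "S * norm x > 0" by simp
    define q where "q = A 0 / (S * norm x)"
    have "q > 1" using A0 Sx by (simp add: q_def)
    then obtain n where "q ^ (2 ^ n) > (2 * real (degree p)) * 2 ^ n + 1" using power_exceeds_linear by blast
    moreover have "q ^ (2 ^ n) \<le> (2 * real (degree p)) * 2 ^ n + 1"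
      unfolding q_def power_divide using key[of n] Sx by (subst pos_divide_le_eq) auto
    ultimately show False by simp
  qed
qed

section \<open>Continuous functional calculus\<close>

text \<open>This is \<open>p(k) - p(0)\<close>, the part of \<open>p(k)\<close> that lies in
  \<open>A\<close>. It is multiplicative on polynomials that vanish at 0.\<close>

definition vpoly :: "real poly \<Rightarrow> 'a::cstar_algebra \<Rightarrow> 'a"
  where "vpoly p k = vector_part (upoly p (Unitization 0 k))"

lemma scalar_part_upoly: "scalar_part (upoly p (Unitization 0 k)) = complex_of_real (poly p 0)"
proof (induction p)
  case (pCons a p)
  then show ?case by (simp add: of_real_def)
qed simp

lemma upoly_eq_vpoly: "upoly p (Unitization 0 k) = Unitization (complex_of_real (poly p 0)) (vpoly p k)"
  by (rule unitization.expand) (simp add: scalar_part_upoly vpoly_def)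

lemma uact_upoly: "uact (upoly p (Unitization 0 k)) x = poly p 0 *\<^sub>R x + vpoly p k * x"
  by (simp add: upoly_eq_vpoly uact_simps scaleR_scaleC)

lemma vpoly_simps:
  "vpoly (p + q) k = vpoly p k + vpoly q k" "vpoly (p - q) k = vpoly p k - vpoly q k"
  "vpoly (smult r p) k = r *\<^sub>R vpoly p k"
  "poly p 0 = 0 \<Longrightarrow> poly q 0 = 0 \<Longrightarrow> vpoly (p * q) k = vpoly p k * vpoly q k"
  "vpoly [:0, 1:] k = k"
proof -
  show "vpoly (p * q) k = vpoly p k * vpoly q k" if "poly p 0 = 0" "poly q 0 = 0"
  proof -
    have "upoly (p * q) (Unitization 0 k) = Unitization 0 (vpoly p k) * Unitization 0 (vpoly q k)"
      using upoly_mult[of p q "Unitization 0 k"] that by (simp add: upoly_eq_vpoly)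
    then show ?thesis by (simp add: vpoly_def times_unitization_def)
  qed
qed (simp_all add: vpoly_def upoly_add upoly_diff upoly_smult times_unitization_def of_real_def scaleC_one)

lemma star_vpoly:
  assumes "star k = k"
  shows "star (vpoly p k) = vpoly p k"
proof -
  have "ustar (upoly p (Unitization 0 k)) = upoly p (Unitization 0 k)"
    by (simp add: ustar_upoly assms)
  then show ?thesis by (simp add: upoly_eq_vpoly)
qed

lemma upoly_pcompose_scale: "upoly (pcompose p [:0, r:]) z = upoly p (r *\<^sub>R z)"
proof (induction p)
  case (pCons a p)
  have "upoly ([:0, r:] * q) z = r *\<^sub>R (z * upoly q z)" for q
    by (simp only: upoly_mult) (simp add: of_real_def)
  with pCons show ?case by (simp add: pcompose_pCons upoly_add del: mult_pCons_left)
qed simp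

lemma norm_vpoly_act:
  assumes sa: "star k = k" and S: "\<And>t. \<bar>t\<bar> \<le> norm k + 1 \<Longrightarrow> \<bar>poly p t\<bar> \<le> S"
  shows "norm (poly p 0 *\<^sub>R x + vpoly p k * x) \<le> S * norm x"
proof -
  \<comment> \<open>Dividing by \<open>norm k + 1\<close> makes the norm strictly less than 1, also
    for \<open>k = 0\<close>.\<close>
  define R where "R = norm k + 1"
  have R: "R > 0" unfolding R_def using norm_ge_zero[of k] by linarith
  define z where "z = (1 / R) *\<^sub>R Unitization 0 k"
  have "norm (uact (upoly (pcompose p [:0, R:]) z) x) \<le> S * norm x"
  proof (rule norm_uact_upoly)
    show "ustar z = z" by (simp add: z_def sa)
    have "norm (Unitization 0 k) = norm k" by (simp add: norm_unitization_def)
    then show "norm z < 1" using R by (simp add: z_def) (simp add: R_def)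
    show "\<bar>poly (pcompose p [:0, R:]) t\<bar> \<le> S" if "\<bar>t\<bar> \<le> 1" for t
    proof -
      have "\<bar>R * t\<bar> \<le> norm k + 1"
        using mult_left_le[of "\<bar>t\<bar>" R] that R by (simp add: abs_mult R_def[symmetric])
      then show ?thesis using S[of "R * t"] by (simp add: poly_pcompose mult.commute)
    qed
  qed
  then show ?thesis using R by (simp add: upoly_pcompose_scale z_def uact_upoly)
qed

text \<open>Left multiplication by \<open>v\<close> is tested on \<open>star v\<close>, where the
  C*-identity returns the square of the norm.\<close>

lemma norm_le_if_left_mult:
  fixes v :: "'a::cstar_algebra"
  assumes "\<And>x. norm (v * x) \<le> S * norm x" and "S \<ge> 0"
  shows "norm v \<le> S"
proof (cases "v = 0")
  case False
  have "norm v * norm v = norm (v * star v)"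
    using cstar_identity[of "star v"] by (simp add: star_star power2_eq_square)
  also have "\<dots> \<le> S * norm v" using assms(1)[of "star v"] by simp
  finally show ?thesis using False by simp
qed (use assms(2) in simp)

lemma norm_vpoly_le:
  assumes sa: "star k = k" and p0: "poly p 0 = 0"
    and S: "\<And>t. \<bar>t\<bar> \<le> norm k + 1 \<Longrightarrow> \<bar>poly p t\<bar> \<le> S"
  shows "norm (vpoly p k) \<le> S"
proof (rule norm_le_if_left_mult)
  show "norm (vpoly p k * x) \<le> S * norm x" for x
    using norm_vpoly_act[OF sa, of p S x] S p0 by simp
  show "S \<ge> 0" using S[of 0] by (simp add: order.trans)
qed

definition cont0 :: "(real \<Rightarrow> real) \<Rightarrow> bool"
  where "cont0 f \<longleftrightarrow> continuous_on UNIV f \<and> f 0 = 0"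

definition poly_approx :: "real \<Rightarrow> (real \<Rightarrow> real) \<Rightarrow> (nat \<Rightarrow> real poly) \<Rightarrow> bool"
  where "poly_approx R f P \<longleftrightarrow> (\<forall>n. poly (P n) 0 = 0) \<and> uniform_limit {-R..R} (\<lambda>n. poly (P n)) f sequentially"

lemma poly_approx_exists:
  assumes "cont0 f" "R \<ge> 0"
  obtains P where "poly_approx R f P"
proof -
  have cont: "continuous_on {-R..R} f" using assms by (auto simp: cont0_def intro: continuous_on_subset)
  have "\<exists>p. poly p 0 = 0 \<and> (\<forall>t\<in>{-R..R}. \<bar>f t - poly p t\<bar> < e)" if e: "e > 0" for e
  proof -
    obtain g where g: "real_polynomial_function g" "\<And>t. t \<in> {-R..R} \<Longrightarrow> \<bar>f t - g t\<bar> < e / 2"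
      using Stone_Weierstrass_real_polynomial_function[OF _ cont, of "e / 2"] e by auto
    obtain a n where an: "g = (\<lambda>x. \<Sum>i\<le>n. a i * x ^ i)"
      using g(1) by (auto simp: real_polynomial_function_iff_sum)
    define p where "p = (\<Sum>i\<le>n. monom (a i) i)"
    have pg: "poly p t = g t" for t
      by (simp add: p_def an poly_sum poly_monom)
    \<comment> \<open>As \<open>f 0 = 0\<close>, removing the constant term costs at most another
      \<open>e / 2\<close>.\<close>
    define q where "q = p - [:poly p 0:]"
    have "\<bar>f t - poly q t\<bar> < e" if "t \<in> {-R..R}" for t
    proof -
      have "\<bar>f 0 - g 0\<bar> < e / 2" using g(2)[of 0] assms(2) by simp
      moreover have "f t - poly q t = (f t - g t) - (f 0 - g 0)"
        using assms(1) by (simp add: q_def pg cont0_def)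
      ultimately show ?thesis using g(2)[OF that] by linarith
    qed
    then show ?thesis by (intro exI[of _ q]) (simp add: q_def)
  qed
  then have "\<forall>n. \<exists>p. poly p 0 = 0 \<and> (\<forall>t\<in>{-R..R}. \<bar>f t - poly p t\<bar> < 1 / real (Suc n))" by simp
  then obtain P where P: "\<And>n. poly (P n) 0 = 0" "\<And>n t. t \<in> {-R..R} \<Longrightarrow> \<bar>f t - poly (P n) t\<bar> < 1 / real (Suc n)"
    by metis
  have "uniform_limit {-R..R} (\<lambda>n. poly (P n)) f sequentially"
  proof (rule uniform_limitI)
    fix e :: real assume "e > 0"
    then have "eventually (\<lambda>n. 1 / real (Suc n) < e) sequentially"
      using LIMSEQ_inverse_real_of_nat by (auto simp: order_tendsto_iff inverse_eq_divide)
    then show "\<forall>\<^sub>F n in sequentially. \<forall>x\<in>{-R..R}. dist (poly (P n) x) (f x) < e"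
    proof eventually_elim
      case (elim n)
      show ?case
      proof
        fix x assume "x \<in> {-R..R}"
        from P(2)[OF this, of n] elim show "dist (poly (P n) x) (f x) < e"
          by (simp add: dist_real_def abs_minus_commute)
      qed
    qed
  qed
  with P(1) that show thesis by (auto simp: poly_approx_def)
qed

text \<open>The limit exists only if \<open>k\<close> is self-adjoint and \<open>f\<close> is continuous with \<open>f(0) = 0\<close>.
  Approximation takes place on an interval longer than the spectrum, because the square root of
  \<open>1 - k\<^sup>2\<close> behind the norm estimate is a power series in \<open>k\<close> of radius one.\<close>

definition fc :: "(real \<Rightarrow> real) \<Rightarrow> 'a::cstar_algebra \<Rightarrow> 'a"
  where "fc f k = lim (\<lambda>n. vpoly ((SOME P. poly_approx (norm k + 1) f P) n) k)"

lemma poly_approx_norm_diff: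
  assumes sa: "star k = k" and P: "poly_approx (norm k + 1) f P" and Q: "poly_approx (norm k + 1) f Q" and e: "e > 0"
  obtains N where "\<And>m n. m \<ge> N \<Longrightarrow> n \<ge> N \<Longrightarrow> norm (vpoly (P m) k - vpoly (Q n) k) < e"
proof -
  let ?I = "{- (norm k + 1)..norm k + 1}"
  have "uniform_limit ?I (\<lambda>n. poly (P n)) f sequentially" "uniform_limit ?I (\<lambda>n. poly (Q n)) f sequentially"
    using P Q by (auto simp: poly_approx_def)
  from this[THEN uniform_limitD, of "e/4"] e
  have "\<exists>N1. \<forall>n\<ge>N1. \<forall>t\<in>?I. \<bar>poly (P n) t - f t\<bar> < e / 4" "\<exists>N2. \<forall>n\<ge>N2. \<forall>t\<in>?I. \<bar>poly (Q n) t - f t\<bar> < e / 4"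
    by (simp_all only: eventually_sequentially dist_real_def zero_less_divide_iff) simp_all
  then obtain N1 N2 where N1: "\<And>n t. n \<ge> N1 \<Longrightarrow> t \<in> ?I \<Longrightarrow> \<bar>poly (P n) t - f t\<bar> < e / 4"
    and N2: "\<And>n t. n \<ge> N2 \<Longrightarrow> t \<in> ?I \<Longrightarrow> \<bar>poly (Q n) t - f t\<bar> < e / 4"
    by metis
  show thesis
  proof (rule that[of "max N1 N2"])
    fix m n assume mn: "m \<ge> max N1 N2" "n \<ge> max N1 N2"
    have "norm (vpoly (P m - Q n) k) \<le> e / 2"
    proof (rule norm_vpoly_le[OF sa])
      show "poly (P m - Q n) 0 = 0" using P Q by (simp add: poly_approx_def)
      fix t :: real assume "\<bar>t\<bar> \<le> norm k + 1"
      then have "t \<in> ?I" by auto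
      with N1[of m t] N2[of n t] mn have "\<bar>poly (P m) t - f t\<bar> < e / 4" "\<bar>poly (Q n) t - f t\<bar> < e / 4" by simp_all
      then show "\<bar>poly (P m - Q n) t\<bar> \<le> e / 2" unfolding poly_diff by linarith
    qed
    then show "norm (vpoly (P m) k - vpoly (Q n) k) < e" using e by (simp add: vpoly_simps)
  qed
qed

lemma fc_limit:
  assumes sa: "star k = k" and P: "poly_approx (norm k + 1) f P"
  shows "(\<lambda>n. vpoly (P n) k) \<longlonglongrightarrow> fc f k"
proof -
  define Q where "Q = (SOME P. poly_approx (norm k + 1) f P)"
  have Q: "poly_approx (norm k + 1) f Q" unfolding Q_def by (rule someI[of _ P]) (rule P)
  have "Cauchy (\<lambda>n. vpoly (Q n) k)"
    by (rule CauchyI) (metis poly_approx_norm_diff[OF sa Q Q])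
  then have lim: "(\<lambda>n. vpoly (Q n) k) \<longlonglongrightarrow> fc f k"
    by (simp add: fc_def Q_def Cauchy_convergent_iff convergent_LIMSEQ_iff)
  have "(\<lambda>n. vpoly (P n) k - vpoly (Q n) k) \<longlonglongrightarrow> 0"
    by (rule LIMSEQ_I) (metis poly_approx_norm_diff[OF sa P Q] diff_zero)
  from tendsto_add[OF this lim] show ?thesis by simp
qed

lemma poly_approx_subset: "poly_approx R f P \<Longrightarrow> R' \<le> R \<Longrightarrow> poly_approx R' f P"
  by (auto simp: poly_approx_def elim!: uniform_limit_on_subset)

lemma fc_approx_exists:
  assumes "cont0 f"
  obtains P where "poly_approx (norm k + 1) f P"
  using poly_approx_exists[OF assms, of "norm k + 1"] by auto

lemma fc_id:
  assumes "star k = (k::'a::cstar_algebra)" shows "fc (\<lambda>t. t) k = k"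
proof -
  have "poly_approx (norm k + 1) (\<lambda>t. t) (\<lambda>n. [:0, 1:])"
    by (simp add: poly_approx_def) (simp add: uniform_limit_iff)
  from fc_limit[OF assms this] show ?thesis by (simp add: vpoly_simps LIMSEQ_const_iff)
qed

lemma fc_add:
  assumes sa: "star k = k" and f: "cont0 f" and g: "cont0 g"
  shows "fc (\<lambda>t. f t + g t) k = fc f k + fc g k"
proof -
  obtain P Q where P: "poly_approx (norm k + 1) f P" and Q: "poly_approx (norm k + 1) g Q"
    using f g fc_approx_exists by metis
  have "poly_approx (norm k + 1) (\<lambda>t. f t + g t) (\<lambda>n. P n + Q n)"
  proof -
    have "uniform_limit {-(norm k + 1)..norm k + 1} (\<lambda>n t. poly (P n) t + poly (Q n) t) (\<lambda>t. f t + g t) sequentially"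
      by (rule uniform_limit_add) (use P Q in \<open>simp_all add: poly_approx_def\<close>)
    moreover have "(\<lambda>t. poly (P n) t + poly (Q n) t) = poly (P n + Q n)" for n by auto
    ultimately show ?thesis using P Q by (simp add: poly_approx_def)
  qed
  from fc_limit[OF sa this] have "(\<lambda>n. vpoly (P n) k + vpoly (Q n) k) \<longlonglongrightarrow> fc (\<lambda>t. f t + g t) k"
    by (simp add: vpoly_simps)
  then show ?thesis
    using tendsto_add[OF fc_limit[OF sa P] fc_limit[OF sa Q]] LIMSEQ_unique by blast
qed

lemma fc_mult:
  assumes sa: "star k = k" and f: "cont0 f" and g: "cont0 g"
  shows "fc (\<lambda>t. f t * g t) k = fc f k * fc g k"
proof -
  obtain P Q where P: "poly_approx (norm k + 1) f P" and Q: "poly_approx (norm k + 1) g Q"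
    using f g fc_approx_exists by metis
  have b: "bounded (h ` {-(norm k + 1)..norm k + 1})" if "cont0 h" for h
    using that by (intro compact_imp_bounded compact_continuous_image)
      (auto simp: cont0_def intro: continuous_on_subset)
  have "poly_approx (norm k + 1) (\<lambda>t. f t * g t) (\<lambda>n. P n * Q n)"
  proof -
    have "uniform_limit {-(norm k + 1)..norm k + 1} (\<lambda>n t. poly (P n) t * poly (Q n) t) (\<lambda>t. f t * g t) sequentially"
      by (rule bounded_bilinear.bounded_uniform_limit[OF bounded_bilinear_mult])
        (use P Q b[OF f] b[OF g] in \<open>simp_all add: poly_approx_def\<close>)
    moreover have "(\<lambda>t. poly (P n) t * poly (Q n) t) = poly (P n * Q n)" for n by auto
    ultimately show ?thesis using P Q by (simp add: poly_approx_def)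
  qed
  from fc_limit[OF sa this] have "(\<lambda>n. vpoly (P n) k * vpoly (Q n) k) \<longlonglongrightarrow> fc (\<lambda>t. f t * g t) k"
    using P Q by (simp add: vpoly_simps poly_approx_def)
  then show ?thesis
    using tendsto_mult[OF fc_limit[OF sa P] fc_limit[OF sa Q]] LIMSEQ_unique by blast
qed

lemma fc_scaleR:
  assumes sa: "star k = k" and f: "cont0 f"
  shows "fc (\<lambda>t. r * f t) k = r *\<^sub>R fc f k"
proof -
  obtain P where P: "poly_approx (norm k + 1) f P"
    using f fc_approx_exists by metis
  have "poly_approx (norm k + 1) (\<lambda>t. r * f t) (\<lambda>n. smult r (P n))"
  proof -
    have "uniform_limit {-(norm k + 1)..norm k + 1} (\<lambda>n t. r * poly (P n) t) (\<lambda>t. r * f t) sequentially"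
      by (rule bounded_linear.uniform_limit[OF bounded_linear_mult_right])
        (use P in \<open>simp add: poly_approx_def\<close>)
    moreover have "(\<lambda>t. r * poly (P n) t) = poly (smult r (P n))" for n by auto
    ultimately show ?thesis using P by (simp add: poly_approx_def)
  qed
  from fc_limit[OF sa this] have "(\<lambda>n. r *\<^sub>R vpoly (P n) k) \<longlonglongrightarrow> fc (\<lambda>t. r * f t) k"
    by (simp add: vpoly_simps)
  then show ?thesis
    using tendsto_scaleR[OF tendsto_const fc_limit[OF sa P]] LIMSEQ_unique by blast
qed

lemma star_fc:
  assumes sa: "star k = k" and f: "cont0 f"
  shows "star (fc f k) = fc f k"
proof -
  obtain P where P: "poly_approx (norm k + 1) f P"
    using f fc_approx_exists by metis
  show ?thesis
    using bounded_linear.tendsto[OF bounded_linear_star fc_limit[OF sa P]] fc_limit[OF sa P] LIMSEQ_unique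
    by (auto simp: star_vpoly[OF sa])
qed

text \<open>A function that does not vanish at 0 has no value in \<open>A\<close>, but it acts on
  \<open>A\<close> as a constant plus a \<open>cont0\<close> function. This form of the estimate
  serves positivity and the column estimates.\<close>

lemma norm_fc_act:
  assumes sa: "star k = k" and f: "cont0 f"
    and S: "\<And>t. \<bar>t\<bar> \<le> norm k + 1 \<Longrightarrow> \<bar>c + f t\<bar> \<le> S"
  shows "norm (c *\<^sub>R x + fc f k * x) \<le> S * norm x"
proof (rule field_le_epsilon)
  fix e :: real assume e: "e > 0"
  define d where "d = e / (norm x + 1)"
  have d: "d > 0" "d * norm x \<le> e" using e by (auto simp: d_def add_nonneg_pos pos_divide_le_eq mult_left_mono)
  obtain P where P: "poly_approx (norm k + 1) f P"
    using f fc_approx_exists by metis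
  then have "uniform_limit {-(norm k + 1)..norm k + 1} (\<lambda>n. poly (P n)) f sequentially" by (simp add: poly_approx_def)
  from uniform_limitD[OF this d(1)]
  have "\<forall>\<^sub>F n in sequentially. norm (c *\<^sub>R x + vpoly (P n) k * x) \<le> (S + d) * norm x"
  proof eventually_elim
    case (elim n)
    have "norm (poly ([:c:] + P n) 0 *\<^sub>R x + vpoly ([:c:] + P n) k * x) \<le> (S + d) * norm x"
    proof (rule norm_vpoly_act[OF sa])
      fix t :: real assume t: "\<bar>t\<bar> \<le> norm k + 1"
      then have "\<bar>poly (P n) t - f t\<bar> < d" using elim by (auto simp: dist_real_def abs_le_iff)
      with S[OF t] show "\<bar>poly ([:c:] + P n) t\<bar> \<le> S + d" by simp
    qed
    moreover have "vpoly [:c:] k = 0" by (simp add: vpoly_def of_real_def)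
    ultimately show ?case using P by (simp add: vpoly_simps poly_approx_def)
  qed
  moreover have "(\<lambda>n. norm (c *\<^sub>R x + vpoly (P n) k * x)) \<longlonglongrightarrow> norm (c *\<^sub>R x + fc f k * x)"
    by (intro tendsto_intros fc_limit[OF sa P])
  ultimately have "norm (c *\<^sub>R x + fc f k * x) \<le> (S + d) * norm x"
    using tendsto_upperbound[OF _ _ sequentially_bot] by blast
  with d(2) show "norm (c *\<^sub>R x + fc f k * x) \<le> S * norm x + e" by (simp add: algebra_simps)
qed

lemma norm_fc_le:
  assumes sa: "star k = k" and f: "cont0 f"
    and S: "\<And>t. \<bar>t\<bar> \<le> norm k + 1 \<Longrightarrow> \<bar>f t\<bar> \<le> S"
  shows "norm (fc f k) \<le> S"
proof (rule norm_le_if_left_mult)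
  show "norm (fc f k * x) \<le> S * norm x" for x
    using norm_fc_act[OF sa f, of 0 S x] S by simp
  show "S \<ge> 0" using S[of 0] by (simp add: order.trans)
qed

text \<open>A polynomial that vanishes at 0 is \<open>k\<close> times a polynomial, so it stays in a
  subspace that contains \<open>k\<close> and is invariant under left multiplication by
  \<open>k\<close>; closedness takes care of the limit.\<close>

lemma fc_in_closed:
  assumes sa: "star k = k" and f: "cont0 f"
    and V: "closed V" "subspace V" "k \<in> V" "\<And>x. x \<in> V \<Longrightarrow> k * x \<in> V"
  shows "fc f k \<in> V"
proof -
  obtain P where P: "poly_approx (norm k + 1) f P"
    using f fc_approx_exists by metis
  define \<kappa> where "\<kappa> = Unitization 0 k"
  have *: "vector_part (\<kappa> * upoly q \<kappa>) \<in> V" for q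
  proof (induction q)
    case 0
    show ?case using V(2) by (simp add: subspace_0)
  next
    case (pCons a q)
    have "\<kappa> * upoly (pCons a q) \<kappa> = a *\<^sub>R \<kappa> + \<kappa> * (\<kappa> * upoly q \<kappa>)"
      by (simp add: ring_distribs of_real_def)
    then have "vector_part (\<kappa> * upoly (pCons a q) \<kappa>) = a *\<^sub>R k + k * vector_part (\<kappa> * upoly q \<kappa>)"
      by (simp add: times_unitization_def \<kappa>_def)
    then show ?case using V pCons by (simp add: subspace_add subspace_scale)
  qed
  have "vpoly p k \<in> V" if "poly p 0 = 0" for p
  proof (cases p)
    case (pCons a q)
    then show ?thesis using *[of q] that by (simp add: vpoly_def \<kappa>_def)
  qed
  then have "\<forall>n. vpoly (P n) k \<in> V" using P by (simp add: poly_approx_def)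
  then show ?thesis using closed_sequentially[OF V(1) _ fc_limit[OF sa P]] by blast
qed

text \<open>The relation passes to polynomials by induction. The approximating polynomials are
  chosen on the larger of the two intervals, so that one sequence serves \<open>k\<close> and
  \<open>l\<close> alike.\<close>

lemma fc_intertwine:
  assumes k: "star k = k" and l: "star l = l" and f: "cont0 f" and kl: "k * x = x * l"
  shows "fc f k * x = x * fc f l"
proof -
  obtain P where P: "poly_approx (max (norm k) (norm l) + 1) f P"
    using poly_approx_exists[OF f, of "max (norm k) (norm l) + 1"] by (metis add_increasing2 max.coboundedI1 norm_ge_zero zero_le_one add.commute)
  have Pk: "poly_approx (norm k + 1) f P" and Pl: "poly_approx (norm l + 1) f P"
    using poly_approx_subset[OF P] by auto
  have u: "upoly p (Unitization 0 k) * Unitization 0 x = Unitization 0 x * upoly p (Unitization 0 l)" for p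
  proof (induction p)
    case (pCons a p)
    have c: "Unitization 0 k * Unitization 0 x = Unitization 0 x * Unitization 0 l"
      by (simp add: times_unitization_def kl)
    have "upoly (pCons a p) (Unitization 0 k) * Unitization 0 x
      = a *\<^sub>R Unitization 0 x + Unitization 0 k * (upoly p (Unitization 0 k) * Unitization 0 x)"
      by (simp add: ring_distribs of_real_def mult.assoc)
    also have "\<dots> = a *\<^sub>R Unitization 0 x + Unitization 0 x * (Unitization 0 l * upoly p (Unitization 0 l))"
      unfolding pCons.IH by (simp only: mult.assoc[symmetric] c)
    finally show ?case by (simp add: ring_distribs of_real_def)
  qed simp
  have "vpoly (P n) k * x = x * vpoly (P n) l" for n
  proof -
    have "Unitization 0 (vpoly (P n) k) * Unitization 0 x = Unitization 0 x * Unitization 0 (vpoly (P n) l)"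
      using u[of "P n"] P by (simp add: upoly_eq_vpoly poly_approx_def)
    then show ?thesis by (simp add: times_unitization_def)
  qed
  then have "(\<lambda>n. vpoly (P n) k * x) \<longlonglongrightarrow> x * fc f l"
    using tendsto_mult[OF tendsto_const fc_limit[OF l Pl]] by simp
  then show ?thesis
    using tendsto_mult[OF fc_limit[OF k Pk] tendsto_const] LIMSEQ_unique by blast
qed

lemma fc_eq_0:
  assumes "star k = k" "cont0 f" "\<And>t. f t = 0"
  shows "fc f k = 0"
  using norm_fc_le[OF assms(1,2), of 0] assms(3) by simp

text \<open>Annihilation means that \<open>x\<close> intertwines \<open>k\<close> with 0, and every
  \<open>cont0\<close> function of 0 is 0.\<close>

lemma fc_mult_eq_0:
  assumes "star k = k" "cont0 f"
  shows "k * x = 0 \<Longrightarrow> fc f k * x = 0" "x * k = 0 \<Longrightarrow> x * fc f k = 0"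
proof -
  have z: "fc f (0::'a) = 0"
    using fc_in_closed[of "0::'a" f "{0}"] assms(2) by simp
  show "fc f k * x = 0" if "k * x = 0"
    using fc_intertwine[OF assms(1) _ assms(2), of 0 x] that z by simp
  show "x * fc f k = 0" if "x * k = 0"
    using fc_intertwine[OF _ assms(1,2), of 0 x] that z by simp
qed

section \<open>Positive elements\<close>

lemma cont0_intros:
  "cont0 (\<lambda>t. t)" "cont0 f \<Longrightarrow> cont0 g \<Longrightarrow> cont0 (\<lambda>t. f t + g t)" "cont0 f \<Longrightarrow> cont0 g \<Longrightarrow> cont0 (\<lambda>t. f t - g t)"
  "cont0 f \<Longrightarrow> cont0 (\<lambda>t. r * f t)" "cont0 f \<Longrightarrow> cont0 g \<Longrightarrow> cont0 (\<lambda>t. f t * g t)"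
  "cont0 f \<Longrightarrow> cont0 (\<lambda>t. - f t)"
  by (auto simp: cont0_def intro!: continuous_intros)

lemma cont0_bounded:
  assumes "cont0 f"
  obtains S where "S \<ge> 0" "\<And>t. \<bar>t\<bar> \<le> R \<Longrightarrow> \<bar>f t\<bar> \<le> S"
proof -
  have "compact (f ` {-R..R})"
    using assms by (intro compact_continuous_image) (auto simp: cont0_def intro: continuous_on_subset)
  then obtain S where S: "\<And>y. y \<in> f ` {-R..R} \<Longrightarrow> \<bar>y\<bar> \<le> S"
    using compact_imp_bounded bounded_iff by (metis real_norm_def)
  show thesis
  proof (rule that[of "max S 0"])
    show "\<bar>f t\<bar> \<le> max S 0" if "\<bar>t\<bar> \<le> R" for t
      using S[of "f t"] that by (fastforce simp: abs_le_iff)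
  qed simp
qed

text \<open>The norm characterization of positivity, \<open>norm (t - a) \<le> t\<close> for some
  \<open>t\<close>, with the norm taken of the operator on \<open>A\<close>. In this form sums of
  positive elements are positive by the triangle inequality.\<close>

definition pos :: "'a::cstar_algebra \<Rightarrow> bool"
  where "pos a \<longleftrightarrow> star a = a \<and> (\<exists>t\<ge>0. \<forall>x. norm (t *\<^sub>R x - a * x) \<le> t * norm x)"

lemma pos_fc:
  assumes sa: "star k = k" and f: "cont0 f" and nonneg: "\<And>t. f t \<ge> 0"
  shows "pos (fc f k)"
proof -
  obtain S where S: "S \<ge> 0" "\<And>t. \<bar>t\<bar> \<le> norm k + 1 \<Longrightarrow> \<bar>f t\<bar> \<le> S"
    using cont0_bounded[OF f] by blast
  have "norm (S *\<^sub>R x - fc f k * x) \<le> S * norm x" for x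
  proof -
    have "norm (S *\<^sub>R x + fc (\<lambda>t. (-1) * f t) k * x) \<le> S * norm x"
    proof (rule norm_fc_act[OF sa])
      show "cont0 (\<lambda>t. (-1) * f t)" using f by (simp add: cont0_intros)
      show "\<bar>S + (-1) * f t\<bar> \<le> S" if "\<bar>t\<bar> \<le> norm k + 1" for t
        using S(2)[OF that] nonneg[of t] by simp
    qed
    then show ?thesis using fc_scaleR[OF sa f, of "-1"] by simp
  qed
  then show ?thesis using S(1) star_fc[OF sa f] by (auto simp: pos_def)
qed

lemma pos_add:
  assumes "pos a" "pos b"
  shows "pos (a + b)"
proof -
  obtain s t where s: "s \<ge> 0" "\<And>x. norm (s *\<^sub>R x - a * x) \<le> s * norm x"
    and t: "t \<ge> 0" "\<And>x. norm (t *\<^sub>R x - b * x) \<le> t * norm x"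
    using assms by (auto simp: pos_def)
  have "norm ((s + t) *\<^sub>R x - (a + b) * x) \<le> (s + t) * norm x" for x
    using norm_triangle_mono[OF s(2)[of x] t(2)[of x]] by (simp add: algebra_simps)
  then show ?thesis using assms s(1) t(1) by (auto simp: pos_def star_add intro!: exI[of _ "s + t"])
qed

lemma pos_scaleR:
  assumes "pos a" "r \<ge> 0"
  shows "pos (r *\<^sub>R a)"
proof -
  obtain s where s: "s \<ge> 0" "\<And>x. norm (s *\<^sub>R x - a * x) \<le> s * norm x"
    using assms by (auto simp: pos_def)
  have "norm ((r * s) *\<^sub>R x - (r *\<^sub>R a) * x) \<le> (r * s) * norm x" for x
  proof -
    have "norm ((r * s) *\<^sub>R x - (r *\<^sub>R a) * x) = r * norm (s *\<^sub>R x - a * x)"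
      using assms(2) by (simp add: scaleR_right_diff_distrib[symmetric] flip: scaleR_scaleR)
    also have "\<dots> \<le> r * (s * norm x)" by (rule mult_left_mono[OF s(2) assms(2)])
    finally show ?thesis by (simp add: mult.assoc)
  qed
  then show ?thesis using assms s(1) by (auto simp: pos_def star_scaleR intro!: exI[of _ "r * s"])
qed

lemma pos_zero [simp]: "pos 0"
  by (auto simp: pos_def)

lemma pos_sum: "(\<And>i. i \<in> I \<Longrightarrow> pos (f i)) \<Longrightarrow> pos (sum f I)"
  by (induction I rule: infinite_finite_induct) (auto intro: pos_add)

text \<open>If \<open>q(s) = \<tau> + \<sigma> s\<close> then \<open>f = q\<^sup>n (f / q\<^sup>n)\<close>, and the norm of \<open>q(a)\<close> is at most \<open>t\<close>,
  whereas \<open>\<bar>q\<bar> \<ge> t + \<delta>\<close> on the support of \<open>f\<close>.\<close>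

lemma fc_eq_0_of_bound:
  assumes sa: "star a = a" and t: "t \<ge> 0" and \<delta>: "\<delta> > 0"
    and H: "\<And>x. norm (\<tau> *\<^sub>R x + \<sigma> *\<^sub>R (a * x)) \<le> t * norm x"
    and f: "cont0 f" "\<And>s. \<bar>\<tau> + \<sigma> * s\<bar> < t + \<delta> \<Longrightarrow> f s = 0"
  shows "fc f a = 0"
proof -
  define u where "u = t + \<delta>"
  have u: "u > 0" using t \<delta> by (simp add: u_def)
  obtain S where S: "S \<ge> 0" "\<And>s. \<bar>s\<bar> \<le> norm a + 1 \<Longrightarrow> \<bar>f s\<bar> \<le> S"
    using cont0_bounded[OF f(1)] by blast
  have *: "norm (fc f a) \<le> (t / u) ^ n * S"
    if "cont0 f" "\<And>s. \<bar>\<tau> + \<sigma> * s\<bar> < u \<Longrightarrow> f s = 0" "\<And>s. \<bar>s\<bar> \<le> norm a + 1 \<Longrightarrow> \<bar>f s\<bar> \<le> S" for n f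
    using that
  proof (induction n arbitrary: f)
    case 0
    then show ?case using norm_fc_le[OF sa, of f S] by simp
  next
    case (Suc n)
    \<comment> \<open>\<open>m\<close> is the modulus of \<open>q\<close>, cut off below at
      \<open>u\<close> to make division safe. On the support of \<open>f\<close> both agree, so
      there \<open>g\<close> is \<open>u f / q\<close>, which is bounded by \<open>f\<close> in
      modulus.\<close>
    define m where "m s = max \<bar>\<tau> + \<sigma> * s\<bar> u" for s
    define g where "g s = f s * (u * (\<tau> + \<sigma> * s)) / (m s)\<^sup>2" for s
    have m: "m s > 0" "m s \<ge> u" "m s \<ge> \<bar>\<tau> + \<sigma> * s\<bar>" for s using u by (auto simp: m_def)
    have "continuous_on UNIV g"
      unfolding g_def using Suc.prems(1) m(1)[THEN less_imp_neq]
      by (intro continuous_intros) (auto simp: cont0_def m_def intro!: continuous_intros)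
    then have g: "cont0 g" using Suc.prems(1) by (simp add: cont0_def g_def)
    have gle: "\<bar>g s\<bar> \<le> \<bar>f s\<bar>" for s
    proof -
      have "u * \<bar>\<tau> + \<sigma> * s\<bar> \<le> m s * m s" using m[of s] u by (intro mult_mono) auto
      then have "\<bar>f s\<bar> * (u * \<bar>\<tau> + \<sigma> * s\<bar>) \<le> \<bar>f s\<bar> * (m s * m s)" by (rule mult_left_mono) simp
      then show ?thesis using m(1)[of s] u
        by (simp add: g_def abs_mult power2_eq_square pos_divide_le_eq)
    qed
    have fg: "u * f s = \<tau> * g s + \<sigma> * (s * g s)" for s
    proof (cases "f s = 0")
      case False
      then have "m s = \<bar>\<tau> + \<sigma> * s\<bar>" using Suc.prems(2)[of s] by (fastforce simp: m_def)
      then have m2: "(m s)\<^sup>2 = (\<tau> + \<sigma> * s)\<^sup>2" by simp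
      have "\<tau> * g s + \<sigma> * (s * g s) = (\<tau> + \<sigma> * s) * g s" by (simp add: algebra_simps)
      also have "\<dots> = u * f s * (\<tau> + \<sigma> * s)\<^sup>2 / (m s)\<^sup>2" by (simp add: g_def power2_eq_square)
      also have "\<dots> = u * f s" using m(1)[of s] unfolding m2[symmetric] by simp
      finally show ?thesis by simp
    qed (simp add: g_def)
    have "u *\<^sub>R fc f a = fc (\<lambda>s. u * f s) a" by (rule fc_scaleR[OF sa Suc.prems(1), symmetric])
    also have "\<dots> = fc (\<lambda>s. \<tau> * g s) a + fc (\<lambda>s. \<sigma> * (s * g s)) a"
      unfolding fg by (rule fc_add[OF sa]) (use g in \<open>simp_all add: cont0_intros\<close>)
    also have "\<dots> = \<tau> *\<^sub>R fc g a + \<sigma> *\<^sub>R (a * fc g a)"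
    proof -
      have sg: "cont0 (\<lambda>s. s * g s)" using g by (simp add: cont0_intros)
      show ?thesis
        unfolding fc_scaleR[OF sa g] fc_scaleR[OF sa sg] fc_mult[OF sa cont0_intros(1) g] fc_id[OF sa] ..
    qed
    finally have "norm (u *\<^sub>R fc f a) \<le> t * norm (fc g a)" using H by simp
    also have "\<dots> \<le> t * ((t / u) ^ n * S)"
    proof (intro mult_left_mono Suc.IH g t)
      show "g s = 0" if "\<bar>\<tau> + \<sigma> * s\<bar> < u" for s using Suc.prems(2)[OF that] by (simp add: g_def)
      show "\<bar>g s\<bar> \<le> S" if "\<bar>s\<bar> \<le> norm a + 1" for s using gle[of s] Suc.prems(3)[OF that] by simp
    qed
    finally have "u * norm (fc f a) \<le> t * ((t / u) ^ n * S)" using u by simp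
    then have "norm (fc f a) \<le> t * ((t / u) ^ n * S) / u" using u by (simp add: pos_le_divide_eq mult.commute)
    then show ?case by simp
  qed
  have "(\<lambda>n. (t / u) ^ n * S) \<longlonglongrightarrow> 0 * S"
    by (intro tendsto_mult tendsto_const LIMSEQ_power_zero) (use t \<delta> in \<open>simp add: u_def\<close>)
  moreover have "norm (fc f a) \<le> (t / u) ^ n * S" for n
    by (rule *) (use f S(2) in \<open>simp_all add: u_def\<close>)
  ultimately have "norm (fc f a) \<le> 0 * S"
    by (intro tendsto_lowerbound[OF _ always_eventually]) auto
  then show ?thesis by simp
qed

text \<open>The substitute for a nonnegative spectrum: with \<open>q(s) = t - s\<close>, the points
  where \<open>q\<close> has modulus less than \<open>t + \<delta>\<close> all lie above
  \<open>- \<delta>\<close>.\<close>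

lemma fc_eq_0_of_pos:
  assumes "pos a" "\<delta> > 0" "cont0 f" "\<And>s. s > - \<delta> \<Longrightarrow> f s = 0"
  shows "fc f a = 0"
proof -
  obtain t where t: "star a = a" "t \<ge> 0" "\<And>x. norm (t *\<^sub>R x - a * x) \<le> t * norm x"
    using assms(1) by (auto simp: pos_def)
  show ?thesis
  proof (rule fc_eq_0_of_bound[OF t(1,2) assms(2) _ assms(3), where \<tau> = t and \<sigma> = "-1"])
    show "norm (t *\<^sub>R x + (-1) *\<^sub>R (a * x)) \<le> t * norm x" for x using t(3)[of x] by simp
    show "f s = 0" if "\<bar>t + -1 * s\<bar> < t + \<delta>" for s using that by (intro assms(4)) linarith
  qed
qed

text \<open>When both tails vanish, \<open>a\<close> equals its truncation to the interval from
  \<open>\<alpha>\<close> to \<open>\<beta>\<close>, whose norm is at most the supremum of the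
  truncated function.\<close>

lemma norm_le_of_fc_tails:
  assumes sa: "star a = a" and "\<alpha> \<le> 0" "0 \<le> \<beta>"
    and "fc (\<lambda>s. min (s - \<alpha>) 0) a = 0" "fc (\<lambda>s. max (s - \<beta>) 0) a = 0"
    and "\<bar>\<alpha>\<bar> \<le> S" "\<bar>\<beta>\<bar> \<le> S"
  shows "norm a \<le> S"
proof -
  define c where "c s = max \<alpha> (min s \<beta>)" for s
  have cont0: "cont0 c" "cont0 (\<lambda>s. min (s - \<alpha>) 0)" "cont0 (\<lambda>s. max (s - \<beta>) 0)"
    using assms(2,3) by (auto simp: cont0_def c_def[abs_def] intro!: continuous_intros)
  have "a = fc (\<lambda>s. s) a" by (rule fc_id[OF sa, symmetric])
  also have "(\<lambda>s. s) = (\<lambda>s. c s + (min (s - \<alpha>) 0 + max (s - \<beta>) 0))"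
    using assms(2,3) by (auto simp: c_def)
  also have "fc \<dots> a = fc c a"
    unfolding fc_add[OF sa cont0(1) cont0_intros(2)[OF cont0(2,3)]] fc_add[OF sa cont0(2,3)] assms(4,5) by simp
  finally have "norm a = norm (fc c a)" by simp
  also have "\<dots> \<le> S"
  proof (rule norm_fc_le[OF sa cont0(1)])
    fix s
    have "\<alpha> \<le> c s" "c s \<le> \<beta>" using assms(2,3) by (simp_all add: c_def)
    then show "\<bar>c s\<bar> \<le> S" using assms(6,7) by linarith
  qed
  finally show ?thesis .
qed

text \<open>From \<open>t + a = (a + b) + (t - b)\<close> the operator \<open>t + a\<close> has norm
  at most \<open>t + norm (a + b)\<close>, so the part of \<open>a\<close> above
  \<open>norm (a + b)\<close> vanishes. The part below 0 vanishes by positivity.\<close>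

lemma norm_mono_pos:
  assumes a: "pos a" and b: "pos b"
  shows "norm a \<le> norm (a + b)"
proof (rule field_le_epsilon)
  fix \<delta> :: real assume \<delta>: "\<delta> > 0"
  define T where "T = norm (a + b)"
  have T: "T \<ge> 0" by (simp add: T_def)
  have sa: "star a = a" using a by (simp add: pos_def)
  obtain t where t: "t \<ge> 0" "\<And>x. norm (t *\<^sub>R x - b * x) \<le> t * norm x"
    using b by (auto simp: pos_def)
  show "norm a \<le> norm (a + b) + \<delta>"
    unfolding T_def[symmetric]
  proof (rule norm_le_of_fc_tails[OF sa, of "- \<delta>" "T + \<delta>"])
    show "fc (\<lambda>s. min (s - - \<delta>) 0) a = 0"
      by (rule fc_eq_0_of_pos[OF a \<delta>]) (use \<delta> in \<open>auto simp: cont0_def intro!: continuous_intros\<close>)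
    show "fc (\<lambda>s. max (s - (T + \<delta>)) 0) a = 0"
    proof (rule fc_eq_0_of_bound[OF sa _ \<delta>, where \<tau> = t and \<sigma> = 1])
      show "norm (t *\<^sub>R x + 1 *\<^sub>R (a * x)) \<le> (T + t) * norm x" for x
      proof -
        have "norm ((a + b) * x + (t *\<^sub>R x - b * x)) \<le> T * norm x + t * norm x"
          by (intro norm_triangle_mono t) (simp add: T_def norm_mult_ineq)
        then show ?thesis by (simp add: algebra_simps)
      qed
    qed (use T \<delta> t in \<open>auto simp: cont0_def intro!: continuous_intros\<close>)
  qed (use T \<delta> in auto)
qed

lemma square_eq_0: "star a = a \<Longrightarrow> a * a = 0 \<Longrightarrow> a = (0::'a::cstar_algebra)"
  using cstar_identity[of a] by simp

lemma pos_square: "star a = a \<Longrightarrow> pos (a * a)"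
  using pos_fc[of a "\<lambda>t. t * t"] fc_mult[OF _ cont0_intros(1) cont0_intros(1), of a] cont0_intros(5)[OF cont0_intros(1) cont0_intros(1)]
  by (simp add: fc_id)

text \<open>A classical argument. With \<open>p = z + star z\<close> and
  \<open>q = i (z - star z)\<close> one has
  \<open>z * star z = (p^2 + q^2) / 2 - star z * z\<close>, a sum of positive elements. As
  \<open>star z\<close> intertwines \<open>star z * z\<close> with \<open>z * star z\<close>, the
  former has no negative part; by hypothesis it has no positive part either.\<close>

lemma eq_0_of_neg_star_mult:
  assumes neg: "pos (- (star z * z))"
  shows "z = 0"
proof -
  define u where "u = star z * z"
  have sau: "star u = u" by (simp add: u_def star_simps)
  define p where "p = z + star z"
  define q where "q = \<i> *\<^sub>C (z - star z)"
  have "star p = p" by (simp add: p_def star_simps)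
  moreover have saq: "star q = q"
  proof -
    have "star q = (- \<i>) *\<^sub>C (- (z - star z))" by (simp add: q_def star_diff star_star star_scaleC)
    then show ?thesis by (simp only: scaleC_minus_left scaleC_minus_right minus_minus q_def)
  qed
  ultimately have "pos ((1/2) *\<^sub>R (p * p + q * q) + - u)"
    using neg by (intro pos_add pos_scaleR pos_square) (auto simp: u_def)
  moreover have "q * q = - ((z - star z) * (z - star z))"
  proof -
    have "q * q = (\<i> * \<i>) *\<^sub>C ((z - star z) * (z - star z))"
      unfolding q_def by (simp only: mult_scaleC_left mult_scaleC_right scaleC_scaleC)
    then show ?thesis by (simp add: scaleC_minus_left scaleC_one)
  qed
  then have "p * p + q * q = 2 *\<^sub>R (z * star z + u)"
    unfolding p_def u_def scaleR_2 by (simp add: ring_distribs)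
  ultimately have posw: "pos (z * star z)" by simp
  have saw: "star (z * star z) = z * star z" by (simp add: star_simps)
  have "norm u \<le> \<delta>" if \<delta>: "\<delta> > 0" for \<delta>
  proof (rule norm_le_of_fc_tails[OF sau, of "- \<delta>" \<delta>])
    define f where "f = (\<lambda>s. min (s - - \<delta>) 0)"
    have f: "cont0 f" using \<delta> by (auto simp: cont0_def f_def intro!: continuous_intros)
    have "fc f (z * star z) = 0"
      by (rule fc_eq_0_of_pos[OF posw \<delta> f]) (simp add: f_def)
    then have "fc f u * star z = 0"
      using fc_intertwine[OF sau saw f, of "star z"] by (simp add: u_def mult.assoc)
    then have "fc f u * u = 0" by (simp add: u_def mult.assoc[symmetric])
    then have "fc f u * fc f u = 0" by (rule fc_mult_eq_0(2)[OF sau f])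
    from this[unfolded f_def] show "fc (\<lambda>s. min (s - - \<delta>) 0) u = 0"
      by (rule square_eq_0[OF star_fc[OF sau f], unfolded f_def])
    obtain t where t: "t \<ge> 0" "\<forall>x. norm (t *\<^sub>R x - (- u) * x) \<le> t * norm x"
      using neg unfolding pos_def u_def by blast
    show "fc (\<lambda>s. max (s - \<delta>) 0) u = 0"
    proof (rule fc_eq_0_of_bound[OF sau t(1) \<delta>, where \<tau> = t and \<sigma> = 1])
      show "norm (t *\<^sub>R x + 1 *\<^sub>R (u * x)) \<le> t * norm x" for x
        using spec[OF t(2), of x] by simp
      show "cont0 (\<lambda>s. max (s - \<delta>) 0)" using \<delta> by (auto simp: cont0_def intro!: continuous_intros)
      show "max (s - \<delta>) 0 = 0" if "\<bar>t + 1 * s\<bar> < t + \<delta>" for s using that by simp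
    qed
  qed (use \<delta> in simp_all)
  then have "norm u \<le> 0 + \<delta>" if "\<delta> > 0" for \<delta>
    unfolding add_0_left using that .
  then have "norm u \<le> 0" by (rule field_le_epsilon)
  then show ?thesis using cstar_identity[of z] by (simp add: u_def)
qed

text \<open>Let \<open>m\<close> be the negative part as a function and
  \<open>a = star x * x\<close>. Then \<open>x m(a)\<close> has square
  \<open>m(a) a m(a) = - m(a)^3\<close>, so it is 0 by the preceding lemma. Hence
  \<open>m(a)^3 = 0\<close>, thus \<open>m(a) = 0\<close>, and \<open>a\<close> equals its positive
  part.\<close>

lemma pos_star_mult: "pos (star x * (x::'a::cstar_algebra))"
proof -
  define a where "a = star x * x"
  have sa: "star a = a" by (simp add: a_def star_simps)
  define m where "m = (\<lambda>s::real. max 0 (- s))"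
  have m: "cont0 m" by (auto simp: cont0_def m_def intro!: continuous_intros)
  have ms: "cont0 (\<lambda>s. m s * s)" by (rule cont0_intros(5)[OF m cont0_intros(1)])
  have m2: "cont0 (\<lambda>s. m s * m s)" by (rule cont0_intros(5)[OF m m])
  have m3: "cont0 (\<lambda>s. m s * m s * m s)" by (rule cont0_intros(5)[OF m2 m])
  have san: "star (fc m a) = fc m a" by (rule star_fc[OF sa m])
  have "star (x * fc m a) * (x * fc m a) = fc m a * a * fc m a"
    by (simp add: star_mult san) (simp add: a_def mult.assoc)
  also have "\<dots> = fc (\<lambda>s. m s * s * m s) a"
    by (simp only: fc_mult[OF sa ms m] fc_mult[OF sa m cont0_intros(1)] fc_id[OF sa])
  also have "(\<lambda>s. m s * s * m s) = (\<lambda>s. (-1) * (m s * m s * m s))"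
    by (auto simp: m_def max_def)
  also have "fc \<dots> a = - fc (\<lambda>s. m s * m s * m s) a"
    by (simp only: fc_scaleR[OF sa m3]) simp
  finally have eq: "star (x * fc m a) * (x * fc m a) = - fc (\<lambda>s. m s * m s * m s) a" .
  have "pos (fc (\<lambda>s. m s * m s * m s) a)"
    by (rule pos_fc[OF sa m3]) (simp add: m_def)
  then have "x * fc m a = 0" by (intro eq_0_of_neg_star_mult) (simp add: eq)
  with eq have "fc m a * fc m a * fc m a = 0" by (simp add: fc_mult[OF sa m2 m] fc_mult[OF sa m m])
  then have "fc m a * fc m a * (fc m a * fc m a) = 0" by (simp add: mult.assoc[symmetric])
  then have "fc m a * fc m a = 0" by (rule square_eq_0[rotated]) (simp add: star_mult san)
  then have 0: "fc m a = 0" by (rule square_eq_0[OF san])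
  have p: "cont0 (\<lambda>s. max 0 s)" by (auto simp: cont0_def intro!: continuous_intros)
  have "(\<lambda>s. s) = (\<lambda>s. max 0 s + (-1) * m s)" by (auto simp: m_def)
  then have "fc (\<lambda>s. s) a = fc (\<lambda>s. max 0 s + (-1) * m s) a" by (rule arg_cong)
  also have "\<dots> = fc (\<lambda>s. max 0 s) a"
    by (simp only: fc_add[OF sa p cont0_intros(4)[OF m]] fc_scaleR[OF sa m] 0) simp
  finally have "fc (\<lambda>s. max 0 s) a = a" unfolding fc_id[OF sa] ..
  with pos_fc[OF sa p] show ?thesis by (simp add: a_def)
qed

section \<open>Factorization\<close>

lemma fc_diff:
  assumes sa: "star k = k" and f: "cont0 f" and g: "cont0 g"
  shows "fc (\<lambda>t. f t - g t) k = fc f k - fc g k"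
  using fc_add[OF sa f cont0_intros(4)[OF g, of "-1"]] fc_scaleR[OF sa g, of "-1"] by simp

lemma norm_le_norm_sum_star_mult:
  fixes x :: "'i \<Rightarrow> 'a::cstar_algebra"
  assumes "finite I" "i \<in> I"
  shows "(norm (x i))\<^sup>2 \<le> norm (\<Sum>j\<in>I. star (x j) * x j)"
proof -
  have "norm (star (x i) * x i) \<le> norm (star (x i) * x i + (\<Sum>j\<in>I - {i}. star (x j) * x j))"
    by (intro norm_mono_pos pos_sum pos_star_mult)
  then show ?thesis using assms by (simp add: sum.remove cstar_identity)
qed

text \<open>By \<open>norm_mono_pos\<close> a single square is dominated by every partial sum
  containing it, and the bound passes to the limit.\<close>

lemma norm_column_mult:
  fixes z :: "nat \<Rightarrow> 'a::cstar_algebra"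
  assumes "(\<lambda>n. star (z n) * z n) sums a"
  shows "(norm (z n * y))\<^sup>2 \<le> norm (star y * a * y)"
proof (rule tendsto_lowerbound)
  have "(\<lambda>n. star y * (star (z n) * z n) * y) sums (star y * a * y)"
    by (intro sums_mult sums_mult2 assms)
  then show "(\<lambda>N. norm (\<Sum>n<N. star y * (star (z n) * z n) * y)) \<longlonglongrightarrow> norm (star y * a * y)"
    by (intro tendsto_norm) (simp add: sums_def)
  show "\<forall>\<^sub>F N in sequentially. (norm (z n * y))\<^sup>2 \<le> norm (\<Sum>n<N. star y * (star (z n) * z n) * y)"
    using eventually_gt_at_top[of n]
  proof eventually_elim
    case (elim N)
    then show ?case
      using norm_le_norm_sum_star_mult[of "{..<N}" n "\<lambda>n. z n * y"] by (simp add: star_mult mult.assoc)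
  qed
qed simp

text \<open>As each \<open>star (z n) * z n\<close> is dominated by \<open>a\<close>, the operator
  \<open>z n (c + g(a))\<close> is controlled by the function \<open>s (c + g(s))^2\<close> of
  \<open>a\<close>, called \<open>h\<close> below.\<close>

lemma norm_column_fc:
  fixes z :: "nat \<Rightarrow> 'a::cstar_algebra"
  assumes a: "(\<lambda>n. star (z n) * z n) sums a" and sa: "star a = a" and g: "cont0 g" and S: "S \<ge> 0"
    and le: "\<And>s. \<bar>s\<bar> \<le> norm a + 1 \<Longrightarrow> \<bar>s\<bar> * (c + g s)\<^sup>2 \<le> S\<^sup>2"
  shows "norm (z n * (c *\<^sub>R x + fc g a * x)) \<le> S * norm x"
proof -
  define G where "G = fc g a"
  define y where "y = c *\<^sub>R x + G * x"
  have saG: "star G = G" unfolding G_def by (rule star_fc[OF sa g])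
  have sg: "cont0 (\<lambda>s. s * g s)" and gsg: "cont0 (\<lambda>s. g s * (s * g s))"
    by (intro cont0_intros(5) cont0_intros(1) g)+
  have h1: "cont0 (\<lambda>s. c\<^sup>2 * s)" and h2: "cont0 (\<lambda>s. 2 * c * (s * g s))"
    by (rule cont0_intros(4)[OF cont0_intros(1)], rule cont0_intros(4)[OF sg])
  have h12: "cont0 (\<lambda>s. c\<^sup>2 * s + 2 * c * (s * g s))" by (rule cont0_intros(2)[OF h1 h2])
  define h where "h = (\<lambda>s. c\<^sup>2 * s + 2 * c * (s * g s) + g s * (s * g s))"
  have h: "cont0 h" unfolding h_def by (rule cont0_intros(2)[OF h12 gsg])
  have aG: "G * a = a * G"
    using fc_mult[OF sa g cont0_intros(1)] fc_mult[OF sa cont0_intros(1) g]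
    by (simp add: G_def fc_id[OF sa] mult.commute)
  have "fc h a = c\<^sup>2 *\<^sub>R a + (2 * c) *\<^sub>R (a * G) + G * (a * G)"
    unfolding h_def fc_add[OF sa h12 gsg] fc_add[OF sa h1 h2] fc_scaleR[OF sa cont0_intros(1)] fc_scaleR[OF sa sg]
      fc_mult[OF sa g sg] fc_mult[OF sa cont0_intros(1) g] fc_id[OF sa] G_def ..
  then have h_x: "fc h a * x = c\<^sup>2 *\<^sub>R (a * x) + (2 * c) *\<^sub>R (a * G * x) + G * (a * G) * x"
    by (simp only: ring_distribs mult_scaleR_left)
  have y1: "star y * w = star x * (c *\<^sub>R w + G * w)" for w
    by (simp add: y_def star_add star_mult star_scaleR saG ring_distribs mult.assoc)
  have y2: "a * y = c *\<^sub>R (a * x) + a * G * x"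
    by (simp only: y_def ring_distribs mult_scaleR_right mult.assoc)
  have y3: "G * (a * y) = c *\<^sub>R (a * G * x) + G * (a * G) * x"
    unfolding y2 aG[symmetric] by (simp only: ring_distribs mult_scaleR_right mult.assoc)
  have y4: "(2 * c) *\<^sub>R w = c *\<^sub>R w + c *\<^sub>R w" for w :: 'a
    by (simp add: scaleR_left_distrib[symmetric])
  have "star y * a * y = star x * (c *\<^sub>R (a * y) + G * (a * y))"
    unfolding mult.assoc by (rule y1)
  also have "c *\<^sub>R (a * y) + G * (a * y) = fc h a * x"
    unfolding y3 h_x y4 unfolding y2 by (simp add: scaleR_add_right power2_eq_square)
  finally have "star y * a * y = star x * (fc h a * x)" .
  then have "(norm (z n * y))\<^sup>2 \<le> norm (star x * (fc h a * x))"
    using norm_column_mult[OF a, of n y] by simp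
  also have "\<dots> \<le> norm x * norm (fc h a * x)"
    using norm_mult_ineq[of "star x"] by simp
  also have "\<dots> \<le> norm x * (S\<^sup>2 * norm x)"
  proof (rule mult_left_mono)
    have "norm (0 *\<^sub>R x + fc h a * x) \<le> S\<^sup>2 * norm x"
    proof (rule norm_fc_act[OF sa h])
      show "\<bar>0 + h s\<bar> \<le> S\<^sup>2" if "\<bar>s\<bar> \<le> norm a + 1" for s
      proof -
        have "h s = s * (c + g s)\<^sup>2" by (simp add: h_def power2_eq_square algebra_simps)
        then show ?thesis using le[OF that] by (simp add: abs_mult)
      qed
    qed
    then show "norm (fc h a * x) \<le> S\<^sup>2 * norm x" by simp
  qed simp
  also have "\<dots> = (S * norm x)\<^sup>2" by (simp add: power2_eq_square)
  finally show ?thesis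
    unfolding y_def G_def by (rule power2_le_imp_le) (simp add: S)
qed

text \<open>A simultaneous polar decomposition: \<open>v\<^sub>n = z\<^sub>n \<bar>a\<bar>\<^sup>-\<^sup>1\<^sup>/\<^sup>4\<close> and \<open>r = \<bar>a\<bar>\<^sup>1\<^sup>/\<^sup>4\<close>,
  where \<open>a = \<Sum>\<^sub>n z\<^sub>n\<^sup>* z\<^sub>n\<close>.\<close>

lemma common_right_factor:
  fixes z :: "nat \<Rightarrow> 'a::cstar_algebra"
  assumes a: "(\<lambda>n. star (z n) * z n) sums a"
  obtains r v C where "star r = r" "\<And>n. z n = v n * r" "\<And>n. norm (v n) \<le> C"
    "\<And>n c. c * z n = z n \<Longrightarrow> c * v n = v n"
    "\<And>n b. (\<And>m. z m * b = 0) \<Longrightarrow> v n * b = 0"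
    "\<And>b. (\<And>m. z m * b = 0) \<Longrightarrow> r * b = 0"
    "\<And>W. closed W \<Longrightarrow> subspace W \<Longrightarrow> (\<And>x y. x \<in> W \<Longrightarrow> x * y \<in> W) \<Longrightarrow>
      (\<And>n. star (z n) * z n \<in> W) \<Longrightarrow> r \<in> W"
proof -
  have sa: "star a = a"
  proof -
    have "(\<lambda>n. star (star (z n) * z n)) sums star a"
      by (rule bounded_linear.sums[OF bounded_linear_star a])
    then have "(\<lambda>n. star (z n) * z n) sums star a" by (simp add: star_mult star_star)
    then show ?thesis by (rule sums_unique2[OF _ a])
  qed
  \<comment> \<open>The exponent 1/4 leaves a margin: \<open>z n\<close> behaves like
    \<open>s^(1/2)\<close>, and the quotient \<open>s^(1/2) s^(-1/4)\<close> still tends to 0 at 0,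
    so that the regularized quotients converge in norm. The exponent 1/2 of the polar decomposition
    gives no such uniform control near 0.\<close>
  define \<tau> where "\<tau> s = sqrt (sqrt \<bar>s\<bar>)" for s
  have \<tau>0: "\<tau> s \<ge> 0" and \<tau>4: "\<bar>s\<bar> = (\<tau> s)\<^sup>2 * (\<tau> s)\<^sup>2" for s
    by (simp_all add: \<tau>_def)
  have \<tau>: "cont0 \<tau>" by (auto simp: cont0_def \<tau>_def[abs_def] intro!: continuous_intros)
  define \<epsilon> where "\<epsilon> m = 1 / real (Suc m)" for m
  have \<epsilon>: "\<epsilon> m > 0" for m by (simp add: \<epsilon>_def)
  \<comment> \<open>A regularization of \<open>1 / \<tau>\<close> that is continuous and vanishes at
    0.\<close>
  define f where "f m s = \<tau> s / ((\<tau> s)\<^sup>2 + (\<epsilon> m)\<^sup>2)" for m s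
  have den: "(\<tau> s)\<^sup>2 + (\<epsilon> m)\<^sup>2 > 0" for m s using \<epsilon>[of m] by (simp add: add_nonneg_pos)
  have f: "cont0 (f m)" for m
  proof -
    have c: "continuous_on UNIV \<tau>" using \<tau> by (simp add: cont0_def)
    have nz: "(\<tau> s)\<^sup>2 + (\<epsilon> m)\<^sup>2 \<noteq> 0" for s using less_imp_neq[OF den[of s m]] by (rule not_sym)
    have "continuous_on UNIV (f m)"
      unfolding f_def using nz by (intro continuous_intros c) blast
    then show ?thesis using \<tau> by (simp add: cont0_def f_def)
  qed
  \<comment> \<open>\<open>approx1\<close> makes the approximants \<open>V m n\<close> of
    \<open>v n\<close> a Cauchy sequence in \<open>m\<close>, while \<open>approx2\<close> makes
    \<open>V m n * r\<close> converge to \<open>z n\<close>. The weight \<open>\<tau>^2\<close> is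
    the square root of \<open>s\<close>, as in \<open>norm_column_fc\<close>.\<close>
  have approx1: "\<bar>(\<tau> s)\<^sup>2 * f m s - \<tau> s\<bar> \<le> \<epsilon> m" for m s
  proof -
    have "(\<tau> s)\<^sup>2 * f m s - \<tau> s = ((\<tau> s)\<^sup>2 * \<tau> s - \<tau> s * ((\<tau> s)\<^sup>2 + (\<epsilon> m)\<^sup>2)) / ((\<tau> s)\<^sup>2 + (\<epsilon> m)\<^sup>2)"
      using less_imp_neq[OF den[of s m]] by (simp add: f_def diff_divide_distrib del: add_eq_0_iff_both_eq_0)
    also have "(\<tau> s)\<^sup>2 * \<tau> s - \<tau> s * ((\<tau> s)\<^sup>2 + (\<epsilon> m)\<^sup>2) = - (\<epsilon> m * (\<epsilon> m * \<tau> s))"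
      by (simp add: algebra_simps power2_eq_square)
    finally have "(\<tau> s)\<^sup>2 * f m s - \<tau> s = - (\<epsilon> m * (\<epsilon> m * \<tau> s)) / ((\<tau> s)\<^sup>2 + (\<epsilon> m)\<^sup>2)" .
    moreover have "\<epsilon> m * (\<epsilon> m * \<tau> s) \<le> \<epsilon> m * ((\<tau> s)\<^sup>2 + (\<epsilon> m)\<^sup>2)"
    proof (rule mult_left_mono)
      have "0 \<le> (\<tau> s - \<epsilon> m)\<^sup>2" by simp
      then have "2 * (\<epsilon> m * \<tau> s) \<le> (\<tau> s)\<^sup>2 + (\<epsilon> m)\<^sup>2" by (simp add: power2_diff algebra_simps)
      moreover have "0 \<le> \<epsilon> m * \<tau> s" using \<epsilon>[of m] \<tau>0[of s] by simp
      ultimately show "\<epsilon> m * \<tau> s \<le> (\<tau> s)\<^sup>2 + (\<epsilon> m)\<^sup>2" by linarith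
    qed (use \<epsilon>[of m] in simp)
    ultimately show ?thesis
      using den[of s m] \<epsilon>[of m] \<tau>0[of s] by (simp add: abs_mult pos_divide_le_eq)
  qed
  have approx2: "\<bar>(\<tau> s)\<^sup>2 * (1 - f m s * \<tau> s)\<bar> \<le> (\<epsilon> m)\<^sup>2" for m s
  proof -
    have "1 - f m s * \<tau> s = ((\<tau> s)\<^sup>2 + (\<epsilon> m)\<^sup>2 - (\<tau> s)\<^sup>2) / ((\<tau> s)\<^sup>2 + (\<epsilon> m)\<^sup>2)"
      using less_imp_neq[OF den[of s m]] by (simp only: diff_divide_distrib) (simp add: f_def power2_eq_square)
    then have "(\<tau> s)\<^sup>2 * (1 - f m s * \<tau> s) = (\<epsilon> m)\<^sup>2 * (\<tau> s)\<^sup>2 / ((\<tau> s)\<^sup>2 + (\<epsilon> m)\<^sup>2)"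
      by simp
    moreover have "(\<epsilon> m)\<^sup>2 * (\<tau> s)\<^sup>2 \<le> (\<epsilon> m)\<^sup>2 * ((\<tau> s)\<^sup>2 + (\<epsilon> m)\<^sup>2)"
      by (rule mult_left_mono) simp_all
    ultimately show ?thesis using den[of s m] by (simp add: pos_divide_le_eq)
  qed
  define V where "V m n = z n * fc (f m) a" for m n
  define r where "r = fc \<tau> a"
  have bound: "norm (z n * fc g a) \<le> S" if "cont0 g" "S \<ge> 0" "\<And>s. \<bar>s\<bar> \<le> norm a + 1 \<Longrightarrow> \<bar>(\<tau> s)\<^sup>2 * g s\<bar> \<le> S" for g S n
  proof (rule norm_le_if_left_mult)
    fix x
    have "norm (z n * (0 *\<^sub>R x + fc g a * x)) \<le> S * norm x"
    proof (rule norm_column_fc[OF a sa that(1,2)])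
      fix s assume s: "\<bar>s\<bar> \<le> norm a + 1"
      have "\<bar>s\<bar> * (0 + g s)\<^sup>2 = ((\<tau> s)\<^sup>2 * g s)\<^sup>2" by (subst \<tau>4) (simp add: power2_eq_square)
      also have "\<dots> \<le> S\<^sup>2" using that(2) that(3)[OF s] by (metis abs_le_square_iff abs_of_nonneg)
      finally show "\<bar>s\<bar> * (0 + g s)\<^sup>2 \<le> S\<^sup>2" .
    qed
    then show "norm (z n * fc g a * x) \<le> S * norm x" by (simp add: mult.assoc)
  qed (rule that(2))
  have diff: "norm (V m n - V l n) \<le> \<epsilon> m + \<epsilon> l" for m l n
  proof -
    have "norm (z n * fc (\<lambda>s. f m s - f l s) a) \<le> \<epsilon> m + \<epsilon> l"
    proof (rule bound)
      show "\<bar>(\<tau> s)\<^sup>2 * (f m s - f l s)\<bar> \<le> \<epsilon> m + \<epsilon> l" for s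
        using approx1[of s m] approx1[of s l] unfolding right_diff_distrib by linarith
    qed (use \<epsilon>[of m] \<epsilon>[of l] in \<open>auto intro: cont0_intros(3)[OF f f]\<close>)
    then show ?thesis by (simp add: V_def fc_diff[OF sa f f] right_diff_distrib)
  qed
  have \<epsilon>lim: "\<epsilon> \<longlonglongrightarrow> 0"
    unfolding \<epsilon>_def[abs_def] using LIMSEQ_inverse_real_of_nat by (simp add: inverse_eq_divide)
  have "\<exists>v. (\<lambda>m. V m n) \<longlonglongrightarrow> v" for n
  proof -
    have "Cauchy (\<lambda>m. V m n)"
    proof (rule CauchyI)
      fix e :: real assume "e > 0"
      then obtain M where M: "\<And>m. m \<ge> M \<Longrightarrow> \<epsilon> m < e / 2"
        using order_tendstoD(2)[OF \<epsilon>lim, of "e / 2"] by (auto simp: eventually_sequentially)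
      show "\<exists>M. \<forall>m\<ge>M. \<forall>l\<ge>M. norm (V m n - V l n) < e"
      proof (intro exI[of _ M] allI impI)
        fix m l assume "m \<ge> M" "l \<ge> M"
        then show "norm (V m n - V l n) < e" using M[of m] M[of l] diff[of m n l] by linarith
      qed
    qed
    then show ?thesis by (simp add: Cauchy_convergent_iff convergent_def)
  qed
  then obtain v where v: "\<And>n. (\<lambda>m. V m n) \<longlonglongrightarrow> v n" by metis
  obtain S where S: "S \<ge> 0" "\<And>s. \<bar>s\<bar> \<le> norm a + 1 \<Longrightarrow> \<bar>\<tau> s\<bar> \<le> S" using cont0_bounded[OF \<tau>] by blast
  have sar: "star r = r" unfolding r_def by (rule star_fc[OF sa \<tau>])
  have ab: "a * b = 0" if "\<And>m. z m * b = 0" for b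
  proof -
    have "(\<lambda>n. star (z n) * z n * b) sums (a * b)" by (rule sums_mult2[OF a])
    then have "(\<lambda>n. 0) sums (a * b)" by (simp add: mult.assoc that)
    then show ?thesis using sums_zero sums_unique2 by blast
  qed
  show thesis
  proof (rule that[of r v "S + 1"])
    show "star r = r" by (rule sar)
    show "norm (v n) \<le> S + 1" for n
    proof (rule tendsto_upperbound[OF tendsto_norm[OF v]])
      have "norm (V m n) \<le> S + 1" for m
        unfolding V_def
      proof (rule bound[OF f])
        show "\<bar>(\<tau> s)\<^sup>2 * f m s\<bar> \<le> S + 1" if "\<bar>s\<bar> \<le> norm a + 1" for s
        proof -
          have "\<epsilon> m \<le> 1" by (simp add: \<epsilon>_def)
          then show ?thesis using approx1[of s m] S(2)[OF that] by linarith
        qed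
      qed (use S in simp)
      then show "\<forall>\<^sub>F m in sequentially. norm (V m n) \<le> S + 1" by simp
    qed simp
    show "z n = v n * r" for n
    proof -
      have vr: "V m n * r = z n * fc (\<lambda>s. f m s * \<tau> s) a" for m
        by (simp add: V_def r_def fc_mult[OF sa f \<tau>] mult.assoc)
      have "norm (V m n * r - z n) \<le> (\<epsilon> m)\<^sup>2" for m
      proof (rule norm_le_if_left_mult)
        fix x
        have "norm (z n * ((- 1) *\<^sub>R x + fc (\<lambda>s. f m s * \<tau> s) a * x)) \<le> (\<epsilon> m)\<^sup>2 * norm x"
        proof (rule norm_column_fc[OF a sa cont0_intros(5)[OF f \<tau>]])
          fix s
          have "\<bar>s\<bar> * (- 1 + f m s * \<tau> s)\<^sup>2 = ((\<tau> s)\<^sup>2 * (1 - f m s * \<tau> s))\<^sup>2"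
            by (subst \<tau>4) (simp add: power2_eq_square algebra_simps)
          also have "\<dots> \<le> ((\<epsilon> m)\<^sup>2)\<^sup>2"
            using approx2[of s m] by (metis abs_le_square_iff abs_of_nonneg zero_le_power2)
          finally show "\<bar>s\<bar> * (- 1 + f m s * \<tau> s)\<^sup>2 \<le> ((\<epsilon> m)\<^sup>2)\<^sup>2" .
        qed simp
        then show "norm ((V m n * r - z n) * x) \<le> (\<epsilon> m)\<^sup>2 * norm x"
          by (simp add: vr algebra_simps)
      qed simp
      moreover have "(\<lambda>m. (\<epsilon> m)\<^sup>2) \<longlonglongrightarrow> 0"
        using tendsto_power[OF \<epsilon>lim, of 2] by simp
      ultimately have "(\<lambda>m. V m n * r - z n) \<longlonglongrightarrow> 0"
        by (rule Lim_null_comparison[OF always_eventually[OF allI]])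
      then have "(\<lambda>m. V m n * r) \<longlonglongrightarrow> z n" by (simp add: LIM_zero_iff)
      moreover have "(\<lambda>m. V m n * r) \<longlonglongrightarrow> v n * r" by (intro tendsto_intros v)
      ultimately show ?thesis using LIMSEQ_unique by blast
    qed
    show "c * v n = v n" if "c * z n = z n" for n c
    proof -
      have "(\<lambda>m. c * V m n) \<longlonglongrightarrow> c * v n" by (intro tendsto_intros v)
      moreover have "c * V m n = V m n" for m by (simp add: V_def mult.assoc[symmetric] that)
      ultimately have "(\<lambda>m. V m n) \<longlonglongrightarrow> c * v n" by simp
      then show ?thesis using v LIMSEQ_unique by blast
    qed
    show "v n * b = 0" if "\<And>m. z m * b = 0" for n b
    proof -
      have "(\<lambda>m. V m n * b) \<longlonglongrightarrow> v n * b" by (intro tendsto_intros v)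
      moreover have "V m n * b = 0" for m
        using fc_mult_eq_0(1)[OF sa f ab[OF that]] by (simp add: V_def mult.assoc)
      ultimately show ?thesis by (simp add: LIMSEQ_const_iff)
    qed
    show "r * b = 0" if "\<And>m. z m * b = 0" for b
      unfolding r_def by (rule fc_mult_eq_0(1)[OF sa \<tau> ab[OF that]])
    show "r \<in> W" if W: "closed W" "subspace W" "\<And>x y. x \<in> W \<Longrightarrow> x * y \<in> W" "\<And>n. star (z n) * z n \<in> W" for W
    proof -
      have "a \<in> W"
      proof (rule closed_sequentially[OF W(1)])
        show "(\<lambda>N. \<Sum>n<N. star (z n) * z n) \<longlonglongrightarrow> a" using a by (simp add: sums_def)
        show "(\<Sum>n<N. star (z n) * z n) \<in> W" for N by (intro subspace_sum W)
      qed
      then show ?thesis unfolding r_def by (intro fc_in_closed[OF sa \<tau> W(1,2)] W(3))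
    qed
  qed
qed

section \<open>Uniform boundedness on closed subspaces\<close>

text \<open>The cube root is defined and odd on the whole line, so both factors are
  \<open>cont0\<close> functions and \<open>k\<close> is not split into positive and negative
  parts.\<close>

lemma cube_root_factor:
  obtains f g where "cont0 f" "cont0 g"
    "\<And>k::'a::cstar_algebra. star k = k \<Longrightarrow> fc f k * fc g k = k"
    "\<And>k::'a::cstar_algebra. star k = k \<Longrightarrow> fc g k * fc f k = k"
    "\<And>k::'a::cstar_algebra. star k = k \<Longrightarrow> norm k = 1 \<Longrightarrow> norm (fc f k) \<le> 2 \<and> norm (fc g k) \<le> 4"
proof -
  define f where "f s = root 3 s" for s
  define g where "g s = f s * f s" for s
  have f: "cont0 f" by (auto simp: cont0_def f_def[abs_def] intro!: continuous_intros)
  have g: "cont0 g" unfolding g_def by (rule cont0_intros(5)[OF f f])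
  have fg: "f s * g s = s" "g s * f s = s" for s
    using odd_real_root_pow[of 3 s] by (simp_all add: f_def g_def power3_eq_cube)
  \<comment> \<open>For \<open>norm k = 1\<close> the functional calculus is estimated on
    \<open>[-2, 2]\<close>, where the cube root is at most the cube root of 8.\<close>
  have fle: "\<bar>f s\<bar> \<le> 2" if "\<bar>s\<bar> \<le> 2" for s
  proof -
    have "\<bar>f s\<bar> = root 3 \<bar>s\<bar>" by (simp add: f_def real_root_abs)
    also have "\<dots> \<le> root 3 (2 ^ 3)" using that by (intro real_root_le_mono) auto
    finally show ?thesis by (simp only: real_root_power_cancel[of 3 2])
  qed
  show thesis
  proof (rule that[OF f g])
    fix k :: 'a assume sa: "star k = k"
    show "fc f k * fc g k = k" "fc g k * fc f k = k"
      unfolding fc_mult[OF sa f g, symmetric] fc_mult[OF sa g f, symmetric] fg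
      by (rule fc_id[OF sa])+
    assume nk: "norm k = 1"
    have "norm (fc f k) \<le> 2" by (rule norm_fc_le[OF sa f]) (use fle nk in simp)
    moreover have "norm (fc g k) \<le> 4"
    proof (rule norm_fc_le[OF sa g])
      fix s assume "\<bar>s\<bar> \<le> norm k + 1"
      then have "\<bar>f s\<bar> * \<bar>f s\<bar> \<le> 2 * 2" using fle[of s] nk by (intro mult_mono) auto
      then show "\<bar>g s\<bar> \<le> 4" by (simp add: g_def abs_mult)
    qed
    ultimately show "norm (fc f k) \<le> 2 \<and> norm (fc g k) \<le> 4" ..
  qed
qed

text \<open>The explicit formulas belong to the conclusion because relations such as
  \<open>b * a = 0\<close> or membership in a hereditary subalgebra pass to \<open>h\<close> and
  \<open>k\<close> through them.\<close>

lemma selfadjoint_decomposition: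
  obtains h k where "star h = h" "star k = k" "a = h + \<i> *\<^sub>C k"
    "h = (1/2) *\<^sub>R (a + star a)" "k = (1/2) *\<^sub>R ((- \<i>) *\<^sub>C (a - star a))"
    "norm h \<le> norm a" "norm k \<le> norm a"
proof -
  define h k where "h = (1/2) *\<^sub>R (a + star a)" and "k = (1/2) *\<^sub>R ((- \<i>) *\<^sub>C (a - star a))"
  have "star h = h" by (simp add: h_def star_simps add.commute)
  moreover have "star k = k"
  proof -
    have "star k = (1/2) *\<^sub>R (\<i> *\<^sub>C (- (a - star a)))"
      by (simp add: k_def star_scaleR star_scaleC star_diff star_star)
    then show ?thesis by (simp only: k_def scaleC_minus_right scaleC_minus_left)
  qed
  moreover have "a = h + \<i> *\<^sub>C k"
  proof -
    have "\<i> *\<^sub>C k = (1/2) *\<^sub>R (a - star a)"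
      unfolding k_def scaleR_scaleC scaleC_scaleC by simp
    then have "h + \<i> *\<^sub>C k = (1/2) *\<^sub>R (a + a)" by (simp add: h_def flip: scaleR_add_right)
    then show ?thesis by (simp flip: scaleR_2)
  qed
  moreover have "norm h \<le> norm a"
    using norm_triangle_ineq[of a "star a"] by (simp add: h_def)
  moreover have "norm k \<le> norm a"
    using norm_triangle_ineq4[of a "star a"] by (simp add: k_def norm_scaleC)
  ultimately show thesis by (rule that[OF _ _ _ h_def k_def])
qed

lemma linear_rescale:
  assumes lin: "linear G" and S: "subspace S" "x \<in> S" and d: "\<delta> > 0"
    and x: "norm (G x) > (\<bar>M\<bar> + 1) / \<delta> * norm x"
  shows "\<exists>u\<in>S. norm u \<le> \<delta> \<and> norm (G u) > M"
proof -
  have x0: "x \<noteq> 0" using x linear_0[OF lin] by auto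
  define u where "u = (\<delta> / norm x) *\<^sub>R x"
  have "norm u = \<delta>" using x0 d by (simp add: u_def)
  moreover have "norm (G u) = \<delta> / norm x * norm (G x)"
    using d by (simp add: u_def linear_cmul[OF lin])
  moreover have "\<delta> / norm x * norm (G x) > \<delta> / norm x * ((\<bar>M\<bar> + 1) / \<delta> * norm x)"
    by (rule mult_strict_left_mono[OF x]) (use x0 d in simp)
  moreover have "\<delta> / norm x * ((\<bar>M\<bar> + 1) / \<delta> * norm x) = \<bar>M\<bar> + 1" using x0 d by simp
  moreover have "u \<in> S" using S by (simp add: u_def subspace_scale)
  ultimately show ?thesis by (intro bexI[of _ u]) linarith
qed

text \<open>A gliding hump: each step adds a small vector at which some \<open>T i\<close> exceeds
  everything accumulated so far, and then shrinks the radius so that later steps change this value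
  by at most 1. At the limit point the values are unbounded.\<close>

lemma uniform_boundedness_subspace:
  fixes T :: "'i \<Rightarrow> 'a::banach \<Rightarrow> 'b::real_normed_vector"
  assumes S: "closed S" "subspace S"
    and lin: "\<And>i. i \<in> I \<Longrightarrow> linear (T i)"
    and bdd: "\<And>i. i \<in> I \<Longrightarrow> \<exists>K. \<forall>x\<in>S. norm (T i x) \<le> K * norm x"
    and pw: "\<And>x. x \<in> S \<Longrightarrow> \<exists>B. \<forall>i\<in>I. norm (T i x) \<le> B"
  shows "\<exists>K. \<forall>i\<in>I. \<forall>x\<in>S. norm (T i x) \<le> K * norm x"
proof (rule ccontr)
  assume neg: "\<not> ?thesis"
  have big: "\<exists>i\<in>I. \<exists>u\<in>S. norm u \<le> d \<and> norm (T i u) > M" if d: "d > 0" for d M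
  proof -
    obtain i x where i: "i \<in> I" "x \<in> S" "norm (T i x) > (\<bar>M\<bar> + 1) / d * norm x"
      using neg by (meson not_le)
    show ?thesis using linear_rescale[OF lin[OF i(1)] S(2) i(2) d i(3)] i(1) by blast
  qed
  obtain B where B: "\<And>x i. x \<in> S \<Longrightarrow> i \<in> I \<Longrightarrow> norm (T i x) \<le> B x" using pw by metis
  obtain K where K0: "\<And>x i. i \<in> I \<Longrightarrow> x \<in> S \<Longrightarrow> norm (T i x) \<le> K i * norm x" using bdd by metis
  \<comment> \<open>A state consists of the partial sum, the radius for the next increment, and the
    index of the operator that produced the last hump; the initial state has no such index, and
    \<open>undefined\<close> stands in for it.\<close>
  define step where "step n p q \<longleftrightarrow> (case p of (s, d, i0) \<Rightarrow> case q of (s', d', i) \<Rightarrow>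
     i \<in> I \<and> s' - s \<in> S \<and> norm (s' - s) \<le> d \<and> norm (T i (s' - s)) > real n + 1 + B s \<and>
     0 < d' \<and> d' \<le> d / 2 \<and> d' * \<bar>K i\<bar> \<le> 1 / 2)" for n :: nat and p q :: "'a \<times> real \<times> 'i"
  have "\<exists>p. \<forall>n. (fst (p n) \<in> S \<and> 0 < fst (snd (p n))) \<and> step n (p n) (p (Suc n))"
  proof (rule dependent_nat_choice)
    show "\<exists>p :: 'a \<times> real \<times> 'i. fst p \<in> S \<and> 0 < fst (snd p)"
      by (rule exI[of _ "(0, 1, undefined)"]) (use S in \<open>simp add: subspace_0\<close>)
    fix p :: "'a \<times> real \<times> 'i" and n assume p: "fst p \<in> S \<and> 0 < fst (snd p)"
    obtain s d i0 where sd: "p = (s, d, i0)" by (cases p)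
    with p have "s \<in> S" "d > 0" by auto
    from big[OF this(2), of "real n + 1 + B s"] obtain i u where iu: "i \<in> I" "u \<in> S" "norm u \<le> d"
      "norm (T i u) > real n + 1 + B s" by blast
    \<comment> \<open>The first bound halves the radii, so the remaining increments add up to at
      most \<open>2 * d'\<close>; the second one gives \<open>K i * 2 * d' \<le> 1\<close> for the
      bound \<open>K i\<close> of the current operator.\<close>
    define d' where "d' = min (d / 2) (1 / (2 * (\<bar>K i\<bar> + 1)))"
    have "d' > 0" "d' \<le> d / 2" using \<open>d > 0\<close> by (auto simp: d'_def intro: divide_pos_pos)
    moreover have "d' * \<bar>K i\<bar> \<le> 1 / 2"
    proof -
      have "d' * \<bar>K i\<bar> \<le> 1 / (2 * (\<bar>K i\<bar> + 1)) * \<bar>K i\<bar>" by (rule mult_right_mono) (auto simp: d'_def)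
      also have "\<dots> \<le> 1 / 2" by (simp add: field_simps)
      finally show ?thesis .
    qed
    ultimately show "\<exists>q. (fst q \<in> S \<and> 0 < fst (snd q)) \<and> step n p q"
      using iu \<open>s \<in> S\<close> S(2) by (intro exI[of _ "(s + u, d', i)"]) (auto simp: step_def sd subspace_add)
  qed
  then obtain p where p: "\<And>n. fst (p n) \<in> S" "\<And>n. 0 < fst (snd (p n))" "\<And>n. step n (p n) (p (Suc n))" by blast
  define s d i where "s n = fst (p n)" and "d n = fst (snd (p n))" and "i n = snd (snd (p (Suc n)))" for n
  have st: "i n \<in> I" "s (Suc n) - s n \<in> S" "norm (s (Suc n) - s n) \<le> d n"
    "norm (T (i n) (s (Suc n) - s n)) > real n + 1 + B (s n)"
    "d (Suc n) \<le> d n / 2" "d (Suc n) * \<bar>K (i n)\<bar> \<le> 1 / 2" for n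
    using p(3)[of n] by (auto simp: step_def s_def d_def i_def split: prod.splits)
  have d_pos: "d n > 0" for n using p(2) by (simp add: d_def)
  have tail: "norm (s (n + m) - s n) \<le> 2 * d n * (1 - 1 / 2 ^ m) \<and> d (n + m) \<le> d n / 2 ^ m" for n m
  proof (induction m)
    case (Suc m)
    have "norm (s (n + Suc m) - s n) \<le> norm (s (Suc (n + m)) - s (n + m)) + norm (s (n + m) - s n)"
      using norm_triangle_ineq[of "s (Suc (n + m)) - s (n + m)" "s (n + m) - s n"] by simp
    also have "\<dots> \<le> d n / 2 ^ m + 2 * d n * (1 - 1 / 2 ^ m)"
      using Suc st(3)[of "n + m"] by linarith
    also have "\<dots> = 2 * d n * (1 - 1 / 2 ^ Suc m)" by (simp add: field_simps)
    finally show ?case using st(5)[of "n + m"] Suc by simp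
  qed simp
  have tail': "norm (s (n + m) - s n) \<le> 2 * d n" for n m
  proof -
    have "2 * d n * (1 - 1 / 2 ^ m) \<le> 2 * d n * 1" using d_pos[of n] by (intro mult_left_mono) auto
    then show ?thesis using tail[of n m] by simp
  qed
  have "Cauchy s"
  proof (rule CauchyI)
    fix e :: real assume e: "e > 0"
    obtain n where n: "(1/2) ^ n < e / (4 * d 0)"
      using real_arch_pow_inv[of "e / (4 * d 0)" "1/2"] e d_pos[of 0] by auto
    have "4 * d n \<le> 4 * (d 0 * (1/2) ^ n)" using tail[of 0 n] by (simp add: power_one_over)
    also have "\<dots> < e" using n d_pos[of 0] by (simp add: field_simps)
    finally have dn: "4 * d n < e" .
    show "\<exists>M. \<forall>m\<ge>M. \<forall>l\<ge>M. norm (s m - s l) < e"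
    proof (intro exI[of _ n] allI impI)
      fix m l assume "m \<ge> n" "l \<ge> n"
      then have "norm (s m - s n) \<le> 2 * d n" "norm (s l - s n) \<le> 2 * d n"
        using tail'[of n "m - n"] tail'[of n "l - n"] by simp_all
      then show "norm (s m - s l) < e" using dn norm_triangle_ineq4[of "s m - s n" "s l - s n"] by simp
    qed
  qed
  then obtain x where x: "s \<longlonglongrightarrow> x" by (auto simp: Cauchy_convergent_iff convergent_def)
  have xS: "x \<in> S" by (rule closed_sequentially[OF S(1) _ x]) (use p(1) in \<open>simp add: s_def\<close>)
  obtain n :: nat where n: "real n > B x" using reals_Archimedean2 by blast
  have xn: "norm (x - s (Suc n)) \<le> 2 * d (Suc n)"
  proof (rule tendsto_upperbound)
    show "(\<lambda>m. norm (s (m + Suc n) - s (Suc n))) \<longlonglongrightarrow> norm (x - s (Suc n))"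
      by (intro tendsto_intros LIMSEQ_ignore_initial_segment x)
    show "\<forall>\<^sub>F m in sequentially. norm (s (m + Suc n) - s (Suc n)) \<le> 2 * d (Suc n)"
      using tail'[of "Suc n"] by (simp add: add.commute)
  qed simp
  have sS: "s m \<in> S" for m using p(1) by (simp add: s_def)
  have rest: "norm (T (i n) (x - s (Suc n))) \<le> 1"
  proof -
    have "norm (T (i n) (x - s (Suc n))) \<le> K (i n) * norm (x - s (Suc n))"
      by (rule K0[OF st(1)]) (use xS sS S(2) in \<open>simp add: subspace_diff\<close>)
    also have "\<dots> \<le> \<bar>K (i n)\<bar> * (2 * d (Suc n))"
      by (intro mult_mono xn) auto
    also have "\<dots> = 2 * (d (Suc n) * \<bar>K (i n)\<bar>)" by simp
    also have "\<dots> \<le> 1" using st(6)[of n] by simp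
    finally show ?thesis .
  qed
  have "T (i n) (s (Suc n) - s n) = T (i n) x - T (i n) (x - s (Suc n)) - T (i n) (s n)"
    using lin[OF st(1)[of n]] by (simp add: linear_diff)
  then have "norm (T (i n) (s (Suc n) - s n)) \<le> norm (T (i n) x) + norm (T (i n) (x - s (Suc n))) + norm (T (i n) (s n))"
    by (metis add_right_mono norm_triangle_ineq4 order.trans)
  also have "\<dots> \<le> B x + 1 + B (s n)"
    using B[OF xS st(1)[of n]] B[OF sS[of n] st(1)[of n]] rest by linarith
  finally show False using st(4)[of n] n by linarith
qed

text \<open>The unit ball of \<open>W\<close> is taken as a family of operators in
  \<open>\<xi>\<close> on the complete space \<open>X\<close>; it is pointwise bounded since
  \<open>\<Phi>\<close> is bounded in \<open>\<rho>\<close>. The resulting joint bound survives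
  limits in \<open>\<rho>\<close>, which is why \<open>W\<close> is closed.\<close>

lemma bounded_slices:
  fixes \<Phi> :: "'a::banach \<Rightarrow> 'c::real_normed_vector \<Rightarrow> 'm::real_normed_vector"
  assumes X: "closed X" "subspace X"
    and lin: "\<And>\<rho>. linear (\<lambda>\<xi>. \<Phi> \<xi> \<rho>)" and bl: "\<And>\<xi>. bounded_linear (\<Phi> \<xi>)"
  defines "W \<equiv> {\<rho>. \<exists>K. \<forall>\<xi>\<in>X. norm (\<Phi> \<xi> \<rho>) \<le> K * norm \<xi>}"
  shows "subspace W" and "closed W" and "\<exists>K\<ge>0. \<forall>\<rho>\<in>W. \<forall>\<xi>\<in>X. norm (\<Phi> \<xi> \<rho>) \<le> K * norm \<xi> * norm \<rho>"
proof -
  interpret bl: bounded_linear "\<Phi> \<xi>" for \<xi> by (rule bl)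
  show sub: "subspace W"
  proof (rule subspaceI)
    show "0 \<in> W" by (auto simp: W_def bl.zero intro: exI[of _ 0])
    fix x y and r :: real assume "x \<in> W" "y \<in> W"
    then obtain K L where K: "\<And>\<xi>. \<xi> \<in> X \<Longrightarrow> norm (\<Phi> \<xi> x) \<le> K * norm \<xi>"
      and L: "\<And>\<xi>. \<xi> \<in> X \<Longrightarrow> norm (\<Phi> \<xi> y) \<le> L * norm \<xi>"
      by (auto simp: W_def)
    have "norm (\<Phi> \<xi> (x + y)) \<le> (K + L) * norm \<xi>" if "\<xi> \<in> X" for \<xi>
      using norm_triangle_mono[OF K[OF that] L[OF that]] by (simp add: bl.add algebra_simps)
    then show "x + y \<in> W" by (auto simp: W_def)
    have "norm (\<Phi> \<xi> (r *\<^sub>R x)) \<le> (\<bar>r\<bar> * K) * norm \<xi>" if "\<xi> \<in> X" for \<xi>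
      using mult_left_mono[OF K[OF that], of "\<bar>r\<bar>"] by (simp add: bl.scaleR mult.assoc)
    then show "r *\<^sub>R x \<in> W" by (auto simp: W_def)
  qed
  define I where "I = {\<rho> \<in> W. norm \<rho> \<le> 1}"
  have "\<exists>K. \<forall>\<rho>\<in>I. \<forall>\<xi>\<in>X. norm (\<Phi> \<xi> \<rho>) \<le> K * norm \<xi>"
  proof (rule uniform_boundedness_subspace[OF X, where T = "\<lambda>\<rho> \<xi>. \<Phi> \<xi> \<rho>"])
    show "\<exists>K. \<forall>\<xi>\<in>X. norm (\<Phi> \<xi> \<rho>) \<le> K * norm \<xi>" if "\<rho> \<in> I" for \<rho> using that by (simp add: I_def W_def)
    show "\<exists>B. \<forall>\<rho>\<in>I. norm (\<Phi> \<xi> \<rho>) \<le> B" for \<xi>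
    proof -
      obtain K where K: "K \<ge> 0" "\<And>x. norm (\<Phi> \<xi> x) \<le> norm x * K" using bl.nonneg_bounded by blast
      have "norm (\<Phi> \<xi> \<rho>) \<le> K" if "\<rho> \<in> I" for \<rho>
        using K(2)[of \<rho>] mult_right_mono[of "norm \<rho>" 1 K] K(1) that by (simp add: I_def)
      then show ?thesis by blast
    qed
  qed (rule lin)
  then obtain K0 where K0: "\<And>\<rho> \<xi>. \<rho> \<in> I \<Longrightarrow> \<xi> \<in> X \<Longrightarrow> norm (\<Phi> \<xi> \<rho>) \<le> K0 * norm \<xi>" by blast
  have K: "norm (\<Phi> \<xi> \<rho>) \<le> \<bar>K0\<bar> * norm \<xi> * norm \<rho>" if "\<rho> \<in> W" "\<xi> \<in> X" for \<rho> \<xi>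
  proof (cases "\<rho> = 0")
    case False
    have "(1 / norm \<rho>) *\<^sub>R \<rho> \<in> I" using that(1) sub False by (simp add: I_def subspace_scale)
    from K0[OF this that(2)] have "norm (\<Phi> \<xi> \<rho>) / norm \<rho> \<le> K0 * norm \<xi>" by (simp add: bl.scaleR)
    also have "\<dots> \<le> \<bar>K0\<bar> * norm \<xi>" by (rule mult_right_mono) auto
    finally show ?thesis using False by (simp add: pos_divide_le_eq)
  qed (simp add: bl.zero)
  then show "\<exists>K\<ge>0. \<forall>\<rho>\<in>W. \<forall>\<xi>\<in>X. norm (\<Phi> \<xi> \<rho>) \<le> K * norm \<xi> * norm \<rho>"
    by (intro exI[of _ "\<bar>K0\<bar>"]) auto
  show "closed W"
  proof (rule closed_sequential_limits[THEN iffD2], intro allI impI)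
    fix x l assume xl: "(\<forall>n. x n \<in> W) \<and> x \<longlonglongrightarrow> l"
    have "norm (\<Phi> \<xi> l) \<le> (\<bar>K0\<bar> * norm l) * norm \<xi>" if "\<xi> \<in> X" for \<xi>
    proof (rule tendsto_le[OF sequentially_bot])
      show "(\<lambda>n. norm (\<Phi> \<xi> (x n))) \<longlonglongrightarrow> norm (\<Phi> \<xi> l)"
        by (rule tendsto_norm[OF bl.tendsto[OF conjunct2[OF xl]]])
      show "(\<lambda>n. \<bar>K0\<bar> * norm (x n) * norm \<xi>) \<longlonglongrightarrow> \<bar>K0\<bar> * norm l * norm \<xi>"
        by (rule tendsto_mult[OF tendsto_mult[OF tendsto_const tendsto_norm[OF conjunct2[OF xl]]] tendsto_const])
      show "\<forall>\<^sub>F n in sequentially. norm (\<Phi> \<xi> (x n)) \<le> \<bar>K0\<bar> * norm (x n) * norm \<xi>"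
      proof (rule always_eventually, rule allI)
        fix n
        have "x n \<in> W" using xl by simp
        from K[OF this that] show "norm (\<Phi> \<xi> (x n)) \<le> \<bar>K0\<bar> * norm (x n) * norm \<xi>"
          by (simp add: mult_ac)
      qed
    qed
    then show "l \<in> W" unfolding W_def by blast
  qed
qed

section \<open>Jordan derivations and their continuity subspace\<close>

lemma linear_unbounded_small:
  assumes "linear G" "\<not> (\<exists>K. \<forall>y. norm (G y) \<le> K * norm y)" "\<delta> > 0"
  shows "\<exists>y. norm y \<le> \<delta> \<and> norm (G y) > M"
proof -
  obtain x where "norm (G x) > (\<bar>M\<bar> + 1) / \<delta> * norm x" using assms(2) by (meson not_le)
  then show ?thesis using linear_rescale[OF assms(1) subspace_UNIV UNIV_I assms(3)] by blast
qed

definition bdd_seq :: "(nat \<Rightarrow> 'b::real_normed_vector) \<Rightarrow> bool"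
  where "bdd_seq X \<longleftrightarrow> (\<exists>K. \<forall>n. norm (X n) \<le> K)"

lemma bdd_seq_add: "bdd_seq X \<Longrightarrow> bdd_seq Y \<Longrightarrow> bdd_seq (\<lambda>n. X n + Y n)"
  unfolding bdd_seq_def by (metis norm_triangle_mono)

lemma bdd_seq_diff: "bdd_seq X \<Longrightarrow> bdd_seq Y \<Longrightarrow> bdd_seq (\<lambda>n. X n - Y n)"
  unfolding bdd_seq_def by (metis norm_triangle_le_diff add_mono)

lemma bdd_seq_linear: "bounded_linear f \<Longrightarrow> bdd_seq X \<Longrightarrow> bdd_seq (\<lambda>n. f (X n))"
proof -
  assume f: "bounded_linear f" and X: "bdd_seq X"
  obtain K where K: "K \<ge> 0" "\<And>x. norm (f x) \<le> norm x * K"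
    using bounded_linear.nonneg_bounded[OF f] by blast
  obtain L where L: "\<And>n. norm (X n) \<le> L" using X by (auto simp: bdd_seq_def)
  have "norm (f (X n)) \<le> L * K" for n
    using K(2)[of "X n"] mult_right_mono[OF L[of n] K(1)] by linarith
  then show ?thesis by (auto simp: bdd_seq_def)
qed

text \<open>Only real linearity is required, so that twisting by the conjugate linear involution
  stays within the locale.\<close>

locale jordan_setting =
  fixes lact :: "'a::cstar_algebra \<Rightarrow> 'm::banach \<Rightarrow> 'm" (infixr "\<rhd>" 71)
    and ract :: "'m \<Rightarrow> 'a \<Rightarrow> 'm" (infixl "\<lhd>" 70)
    and F D :: "'a \<Rightarrow> 'm"
  assumes bb_lact: "bounded_bilinear (\<rhd>)" and bb_ract: "bounded_bilinear (\<lhd>)"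
    and lact_mult: "(a * b) \<rhd> m = a \<rhd> b \<rhd> m"
    and ract_mult: "m \<lhd> (a * b) = m \<lhd> a \<lhd> b"
    and lact_ract: "(a \<rhd> m) \<lhd> b = a \<rhd> (m \<lhd> b)"
    and linear_F: "linear F"
    and F_jordan: "F (a * b + b * a) = b \<rhd> D a + D a \<lhd> b + (a \<rhd> D b + D b \<lhd> a)"
begin

sublocale l: bounded_bilinear "(\<rhd>)" by (rule bb_lact)
sublocale r: bounded_bilinear "(\<lhd>)" by (rule bb_ract)

lemmas act_zero [simp] = l.zero_left l.zero_right r.zero_left r.zero_right

definition jact :: "'a \<Rightarrow> 'm \<Rightarrow> 'm"
  where "jact a m = a \<rhd> m + m \<lhd> a"

lemma F_jact: "F (a * b + b * a) = jact b (D a) + jact a (D b)"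
  by (simp add: F_jordan jact_def)

lemma bounded_linear_jact: "bounded_linear (\<lambda>a. jact a m)" "bounded_linear (jact a)"
  unfolding jact_def
  by (rule bounded_linear_add l.bounded_linear_left r.bounded_linear_right
      l.bounded_linear_right r.bounded_linear_left)+

lemma jact_bound:
  obtains C where "C > 0" "\<And>a m. norm (jact a m) \<le> C * norm a * norm m"
proof -
  obtain K where K: "K > 0" "\<And>a m. norm (a \<rhd> m) \<le> norm a * norm m * K" using l.pos_bounded by blast
  obtain L where L: "L > 0" "\<And>m a. norm (m \<lhd> a) \<le> norm m * norm a * L" using r.pos_bounded by blast
  have "norm (jact a m) \<le> (K + L) * norm a * norm m" for a m
    using norm_triangle_mono[OF K(2)[of a m] L(2)[of m a]] by (simp add: jact_def algebra_simps)
  then show thesis using that[of "K + L"] K(1) L(1) by simp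
qed

lemma linear_D_slice: "linear (\<lambda>\<xi>. jact \<rho> (D \<xi>))"
proof -
  have eq: "jact \<rho> (D \<xi>) = F (\<xi> * \<rho> + \<rho> * \<xi>) - jact \<xi> (D \<rho>)" for \<xi>
    by (simp add: F_jact)
  have "linear (\<lambda>\<xi>. F (\<xi> * \<rho> + \<rho> * \<xi>) - jact \<xi> (D \<rho>))"
  proof (rule linear_compose_sub)
    have "linear (\<lambda>\<xi>. \<xi> * \<rho> + \<rho> * \<xi>)" by (rule linearI) (simp_all add: algebra_simps)
    from linear_compose[OF this linear_F] show "linear (\<lambda>\<xi>. F (\<xi> * \<rho> + \<rho> * \<xi>))" by (simp add: o_def)
    show "linear (\<lambda>\<xi>. jact \<xi> (D \<rho>))" by (rule bounded_linear.linear[OF bounded_linear_jact(1)])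
  qed
  then show ?thesis by (simp only: eq)
qed

definition J0 :: "'a set"
  where "J0 = {\<rho>. \<exists>K. \<forall>\<xi>. norm (jact \<rho> (D \<xi>)) \<le> K * norm \<xi>}"

lemma J0_slices:
  "subspace J0" "closed J0"
  "\<exists>K\<ge>0. \<forall>\<rho>\<in>J0. \<forall>\<xi>. norm (jact \<rho> (D \<xi>)) \<le> K * norm \<xi> * norm \<rho>"
  using bounded_slices[of UNIV "\<lambda>\<xi> \<rho>. jact \<rho> (D \<xi>)", OF _ _ linear_D_slice bounded_linear_jact(1)]
  by (simp_all add: J0_def)

text \<open>The two expressions differ by \<open>jact y (D c)\<close>, which is bounded in
  \<open>y\<close>.\<close>

lemma J0_iff: "c \<in> J0 \<longleftrightarrow> (\<exists>K. \<forall>y. norm (F (y * c + c * y)) \<le> K * norm y)"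
proof -
  obtain L where L: "\<And>y. norm (jact y (D c)) \<le> norm y * L"
    using bounded_linear.nonneg_bounded[OF bounded_linear_jact(1)] by metis
  show ?thesis
  proof
    assume "c \<in> J0"
    then obtain K where K: "\<And>y. norm (jact c (D y)) \<le> K * norm y" by (auto simp: J0_def)
    have "norm (F (y * c + c * y)) \<le> (K + L) * norm y" for y
      using norm_triangle_mono[OF K[of y] L[of y]] by (simp add: F_jact algebra_simps)
    then show "\<exists>K. \<forall>y. norm (F (y * c + c * y)) \<le> K * norm y" by blast
  next
    assume "\<exists>K. \<forall>y. norm (F (y * c + c * y)) \<le> K * norm y"
    then obtain K where K: "\<And>y. norm (F (y * c + c * y)) \<le> K * norm y" by blast
    have "norm (jact c (D y)) \<le> (K + L) * norm y" for y
      using norm_triangle_le_diff[OF add_mono[OF K[of y] L[of y]]] by (simp add: F_jact algebra_simps)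
    then show "c \<in> J0" by (auto simp: J0_def)
  qed
qed

text \<open>\<open>F\<close> is only real linear here, so the factor i is moved from
  \<open>c\<close> to the variable \<open>y\<close>, where it preserves the norm.\<close>

lemma J0_imaginary:
  assumes "c \<in> J0" shows "\<i> *\<^sub>C c \<in> J0"
proof -
  obtain K where K: "\<And>y. norm (F (y * c + c * y)) \<le> K * norm y" using assms by (auto simp: J0_iff)
  have "norm (F (y * (\<i> *\<^sub>C c) + (\<i> *\<^sub>C c) * y)) \<le> K * norm y" for y
    using K[of "\<i> *\<^sub>C y"] by (simp add: mult_scaleC_left mult_scaleC_right norm_scaleC)
  then show ?thesis by (auto simp: J0_iff)
qed

lemma F_bound_J0:
  obtains K where "K \<ge> 0" "\<And>a b. a \<in> J0 \<Longrightarrow> b \<in> J0 \<Longrightarrow> norm (F (a * b + b * a)) \<le> K * norm a * norm b"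
proof -
  obtain K where K: "K \<ge> 0" "\<And>\<rho> \<xi>. \<rho> \<in> J0 \<Longrightarrow> norm (jact \<rho> (D \<xi>)) \<le> K * norm \<xi> * norm \<rho>"
    using J0_slices(3) by blast
  have "norm (F (a * b + b * a)) \<le> (2 * K) * norm a * norm b" if "a \<in> J0" "b \<in> J0" for a b
    using norm_triangle_mono[OF K(2)[OF that(2), of a] K(2)[OF that(1), of b]]
    by (simp add: F_jact algebra_simps)
  then show thesis using that[of "2 * K"] K(1) by simp
qed

section \<open>Locality of \<open>F\<close> and the off-diagonal estimates\<close>

text \<open>If \<open>b\<close> annihilates \<open>s\<close> and \<open>t\<close> on both sides,
  then every term of \<open>F (s * t + t * s)\<close> has \<open>s\<close> or \<open>t\<close> as an
  outer factor and is killed by \<open>b\<close> on that side. A general \<open>q\<close> is reduced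
  to such products by its self-adjoint parts \<open>h\<close> and the factorization
  \<open>h = h^(1/3) h^(2/3)\<close>; \<open>star b = b\<close> lets \<open>b\<close> annihilate
  \<open>star q\<close> too.\<close>

lemma corner_F_eq_0:
  assumes sa: "star b = b" and q: "b * q = 0" "q * b = 0"
  shows "b \<rhd> F q \<lhd> b = 0"
proof -
  obtain f g where fg: "cont0 f" "cont0 g"
    "\<And>k::'a. star k = k \<Longrightarrow> fc f k * fc g k = k" "\<And>k::'a. star k = k \<Longrightarrow> fc g k * fc f k = k"
    by (rule cube_root_factor) blast
  have prod: "b \<rhd> F (s * t + t * s) \<lhd> b = 0" if "b * s = 0" "s * b = 0" "b * t = 0" "t * b = 0" for s t
  proof -
    have "b \<rhd> (u \<rhd> m) = 0" "m \<lhd> u \<lhd> b = 0" if "b * u = 0" "u * b = 0" for u m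
      using that lact_mult[of b u m] ract_mult[of m u b] by simp_all
    with that show ?thesis
      unfolding F_jordan by (simp add: l.add_right r.add_left lact_ract)
  qed
  have sa_case: "b \<rhd> F h \<lhd> b = 0 \<and> b \<rhd> F (\<i> *\<^sub>C h) \<lhd> b = 0" if h: "star h = h" "b * h = 0" "h * b = 0" for h
  proof -
    define s t where "s = fc f h" and "t = fc g h"
    have st: "s * t = h" "t * s = h" using fg(3,4)[OF h(1)] by (simp_all add: s_def t_def)
    have 0: "b * s = 0" "s * b = 0" "b * t = 0" "t * b = 0"
      unfolding s_def t_def using fc_mult_eq_0[OF h(1) fg(1)] fc_mult_eq_0[OF h(1) fg(2)] h by auto
    have "b \<rhd> F (2 *\<^sub>R h) \<lhd> b = 0"
      using prod[OF 0] by (simp add: st scaleR_2)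
    moreover have "b \<rhd> F (2 *\<^sub>R (\<i> *\<^sub>C h)) \<lhd> b = 0"
      using prod[of "\<i> *\<^sub>C s" t] 0 by (simp add: st scaleR_2 mult_scaleC_left mult_scaleC_right)
    ultimately show ?thesis by (simp add: linear_cmul[OF linear_F] l.scaleR_right r.scaleR_left)
  qed
  obtain h k where hk: "star h = h" "star k = k" "q = h + \<i> *\<^sub>C k"
    "h = (1/2) *\<^sub>R (q + star q)" "k = (1/2) *\<^sub>R ((- \<i>) *\<^sub>C (q - star q))"
    by (rule selfadjoint_decomposition) blast
  have q': "b * star q = 0" "star q * b = 0" using q sa by (metis star_mult star_zero)+
  have "b * h = 0" "h * b = 0" "b * k = 0" "k * b = 0"
    unfolding hk(4,5) using q q' by (simp_all add: ring_distribs mult_scaleC_left mult_scaleC_right)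
  then show ?thesis using sa_case hk(1,2)
    by (subst hk(3)) (simp add: linear_add[OF linear_F] l.add_right r.add_left)
qed

text \<open>The admissible right factors form a closed right ideal \<open>W\<close>, so by
  \<open>rW\<close> it is enough to show that \<open>\<omega> = star (z n)\<close> is in
  \<open>W\<close>. Of the two products, \<open>\<xi> * \<omega>\<close> lies in the corner of
  \<open>d\<close>, where \<open>F\<close> is bounded, and \<open>\<omega> * \<xi>\<close> is
  orthogonal to \<open>b'\<close>, so that its contribution to the compression by \<open>b'\<close>
  vanishes.\<close>

lemma half_bound:
  assumes b: "star b = b" "star b' = b'" "b' * b = b" "b * b' = b" "d * b = b" "b * d = b"
    and HF: "\<And>y. norm (F (d * y * d)) \<le> K * norm y"
    and z: "\<And>n. b * z n = z n" "\<And>n. z n * b' = 0"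
    and rW: "\<And>W. closed W \<Longrightarrow> subspace W \<Longrightarrow> (\<And>x y. x \<in> W \<Longrightarrow> x * y \<in> W) \<Longrightarrow>
      (\<And>n. star (z n) * z n \<in> W) \<Longrightarrow> r \<in> W"
  shows "\<exists>K. \<forall>\<xi>. b * \<xi> + \<xi> * b = \<xi> \<longrightarrow> b' * \<xi> * b' = 0 \<longrightarrow> norm (b' \<rhd> D \<xi> \<lhd> r) \<le> K * norm \<xi>"
proof -
  define \<Xi> where "\<Xi> = {\<xi>. b * \<xi> + \<xi> * b = \<xi> \<and> b' * \<xi> * b' = 0}"
  have \<Xi>: "closed \<Xi>" "subspace \<Xi>"
  proof -
    show "closed \<Xi>"
      unfolding \<Xi>_def by (intro closed_Collect_conj closed_Collect_eq continuous_intros)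
    show "subspace \<Xi>"
      unfolding \<Xi>_def by (rule subspaceI) (simp_all add: ring_distribs scaleR_add_right[symmetric], simp add: algebra_simps)
  qed
  define \<Phi> where "\<Phi> \<xi> \<rho> = b' \<rhd> jact \<rho> (D \<xi>)" for \<xi> \<rho>
  have "linear (\<lambda>\<xi>. \<Phi> \<xi> \<rho>)" for \<rho>
    unfolding \<Phi>_def using linear_compose[OF linear_D_slice bounded_linear.linear[OF l.bounded_linear_right[of b']]]
    by (simp add: o_def)
  moreover have "bounded_linear (\<Phi> \<xi>)" for \<xi>
    unfolding \<Phi>_def using bounded_linear_compose[OF l.bounded_linear_right[of b'] bounded_linear_jact(1)] by simp
  ultimately have slices: "subspace {\<rho>. \<exists>K. \<forall>\<xi>\<in>\<Xi>. norm (\<Phi> \<xi> \<rho>) \<le> K * norm \<xi>}"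
    "closed {\<rho>. \<exists>K. \<forall>\<xi>\<in>\<Xi>. norm (\<Phi> \<xi> \<rho>) \<le> K * norm \<xi>}"
    by (rule bounded_slices[OF \<Xi>])+
  define W where "W = {\<rho>. b' * \<rho> = 0} \<inter> {\<rho>. \<exists>K. \<forall>\<xi>\<in>\<Xi>. norm (\<Phi> \<xi> \<rho>) \<le> K * norm \<xi>}"
  \<comment> \<open>Once \<open>b'\<close> kills \<open>\<rho>\<close> on the left, only the right
    action of \<open>\<rho>\<close> remains. This turns a condition on Jordan products into one that
    is stable under right multiplication.\<close>
  have \<Phi>_eq: "\<Phi> \<xi> \<rho> = b' \<rhd> D \<xi> \<lhd> \<rho>" if "b' * \<rho> = 0" for \<xi> \<rho>
    using that lact_mult[of b' \<rho> "D \<xi>"] by (simp add: \<Phi>_def jact_def l.add_right lact_ract)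
  have "closed W"
    unfolding W_def by (intro closed_Int slices closed_Collect_eq continuous_intros)
  moreover have "subspace {\<rho>. b' * \<rho> = 0}"
    by (rule subspaceI) (simp_all add: ring_distribs)
  then have "subspace W"
    unfolding W_def by (rule subspace_inter[OF _ slices(1)])
  moreover have ideal: "x * y \<in> W" if xW: "x \<in> W" for x y
  proof -
    obtain K where K: "\<And>\<xi>. \<xi> \<in> \<Xi> \<Longrightarrow> norm (\<Phi> \<xi> x) \<le> K * norm \<xi>" and b'x: "b' * x = 0"
      using xW by (auto simp: W_def)
    obtain L where L: "L \<ge> 0" "\<And>m. norm (m \<lhd> y) \<le> norm m * L"
      using bounded_linear.nonneg_bounded[OF r.bounded_linear_left] by metis
    have b'xy: "b' * (x * y) = 0" using b'x by (simp add: mult.assoc[symmetric])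
    have "norm (\<Phi> \<xi> (x * y)) \<le> (K * L) * norm \<xi>" if "\<xi> \<in> \<Xi>" for \<xi>
    proof -
      have "norm (\<Phi> \<xi> (x * y)) = norm (\<Phi> \<xi> x \<lhd> y)"
        by (simp add: \<Phi>_eq[OF b'x] \<Phi>_eq[OF b'xy] ract_mult)
      also have "\<dots> \<le> norm (\<Phi> \<xi> x) * L" by (rule L(2))
      also have "\<dots> \<le> K * norm \<xi> * L" by (rule mult_right_mono[OF K[OF that] L(1)])
      finally show ?thesis by (simp add: mult_ac)
    qed
    then show ?thesis using b'xy by (auto simp: W_def)
  qed
  moreover have "star (z n) * z n \<in> W" for n
  proof (rule ideal)
    define \<omega> where "\<omega> = star (z n)"
    have \<omega>: "\<omega> * b = \<omega>" "b' * \<omega> = 0"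
      using z[of n] b(1,2) by (metis \<omega>_def star_mult, metis \<omega>_def star_mult star_zero)
    have \<omega>b': "\<omega> * b' = \<omega>" using \<omega>(1) b(4) by (metis mult.assoc)
    obtain N where N: "N \<ge> 0" "\<And>m. norm (b' \<rhd> m \<lhd> b') \<le> norm m * N"
    proof -
      have "bounded_linear (\<lambda>m. b' \<rhd> m \<lhd> b')"
        using bounded_linear_compose[OF r.bounded_linear_left[of b'] l.bounded_linear_right[of b']] by simp
      then show thesis using that bounded_linear.nonneg_bounded by metis
    qed
    obtain C where C: "C > 0" "\<And>a m. norm (jact a m) \<le> C * norm a * norm m" by (rule jact_bound) blast
    have "norm (\<Phi> \<xi> \<omega>) \<le> (\<bar>K\<bar> * norm \<omega> * N + C * norm (D \<omega>) * N) * norm \<xi>" if "\<xi> \<in> \<Xi>" for \<xi>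
    proof -
      have \<xi>: "b * \<xi> + \<xi> * b = \<xi>" "b' * \<xi> * b' = 0" using that by (simp_all add: \<Xi>_def)
      have b\<xi>b: "b * \<xi> * b = 0"
      proof -
        have "b * \<xi> * b = b * (b' * \<xi> * b') * b" using b(3,4) by (metis mult.assoc)
        then show ?thesis using \<xi> by simp
      qed
      have b\<omega>: "b * \<omega> = 0" using \<omega>(2) b(4) by (metis mult.assoc mult_zero_right)
      have \<xi>\<omega>: "\<xi> * \<omega> = d * (\<xi> * \<omega>) * d"
      proof -
        have "\<xi> * \<omega> = b * \<xi> * \<omega> * b"
          using \<xi>(1) b\<omega> \<omega>(1) by (metis add.right_neutral distrib_right mult.assoc mult_zero_right)
        moreover have "d * (b * \<xi> * \<omega> * b) * d = b * \<xi> * \<omega> * b"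
          using b(5,6) by (simp add: mult.assoc[symmetric]) (simp add: mult.assoc)
        ultimately show ?thesis by metis
      qed
      have \<omega>\<xi>: "\<omega> * \<xi> = \<omega> * b * \<xi>" using \<omega>(1) by simp
      have "b' * (\<omega> * \<xi>) = 0" using \<omega>(2) by (simp add: mult.assoc[symmetric])
      moreover have "\<omega> * \<xi> * b' = 0"
      proof -
        have "\<omega> * \<xi> * b' = \<omega> * (b' * \<xi> * b')" using \<omega>b' by (metis mult.assoc)
        then show ?thesis using \<xi> by simp
      qed
      ultimately have q: "b' \<rhd> F (\<omega> * \<xi>) \<lhd> b' = 0" by (rule corner_F_eq_0[OF b(2)])
      have "b' \<rhd> F (\<xi> * \<omega>) \<lhd> b' = b' \<rhd> F (\<xi> * \<omega> + \<omega> * \<xi>) \<lhd> b'"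
        using q by (simp add: linear_add[OF linear_F] l.add_right r.add_left)
      also have "\<dots> = b' \<rhd> jact \<omega> (D \<xi>) \<lhd> b' + b' \<rhd> jact \<xi> (D \<omega>) \<lhd> b'"
        by (simp add: F_jact l.add_right r.add_left)
      also have "b' \<rhd> jact \<omega> (D \<xi>) \<lhd> b' = \<Phi> \<xi> \<omega> \<lhd> b'" by (simp add: \<Phi>_def)
      also have "\<Phi> \<xi> \<omega> \<lhd> b' = \<Phi> \<xi> \<omega>"
        unfolding \<Phi>_eq[OF \<omega>(2)] ract_mult[symmetric] \<omega>b' ..
      finally have "\<Phi> \<xi> \<omega> = b' \<rhd> F (\<xi> * \<omega>) \<lhd> b' - b' \<rhd> jact \<xi> (D \<omega>) \<lhd> b'" by simp
      then have "norm (\<Phi> \<xi> \<omega>) \<le> norm (b' \<rhd> F (\<xi> * \<omega>) \<lhd> b') + norm (b' \<rhd> jact \<xi> (D \<omega>) \<lhd> b')"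
        using norm_triangle_ineq4 by simp
      also have "\<dots> \<le> norm (F (\<xi> * \<omega>)) * N + norm (jact \<xi> (D \<omega>)) * N"
        by (intro add_mono N)
      also have "\<dots> \<le> \<bar>K\<bar> * (norm \<xi> * norm \<omega>) * N + C * norm \<xi> * norm (D \<omega>) * N"
      proof (intro add_mono mult_right_mono N C)
        have "norm (F (\<xi> * \<omega>)) \<le> K * norm (\<xi> * \<omega>)" using HF[of "\<xi> * \<omega>"] \<xi>\<omega> by simp
        also have "\<dots> \<le> \<bar>K\<bar> * (norm \<xi> * norm \<omega>)" by (intro mult_mono norm_mult_ineq) auto
        finally show "norm (F (\<xi> * \<omega>)) \<le> \<bar>K\<bar> * (norm \<xi> * norm \<omega>)" .
      qed
      finally show ?thesis by (simp add: algebra_simps)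
    qed
    then show "star (z n) \<in> W" unfolding \<omega>_def[symmetric] using \<omega>(2) by (auto simp: W_def)
  qed
  ultimately have "r \<in> W" by (rule rW)
  then obtain K where "b' * r = 0" "\<And>\<xi>. \<xi> \<in> \<Xi> \<Longrightarrow> norm (\<Phi> \<xi> r) \<le> K * norm \<xi>"
    by (auto simp: W_def)
  then show ?thesis by (intro exI[of _ K]) (simp add: \<Phi>_eq \<Xi>_def)
qed

text \<open>Composing with the involution interchanges the two actions, so that
  \<open>half_bound\<close> also applies to the right action.\<close>

lemma star_twist: "jordan_setting (\<lambda>a m. m \<lhd> star a) (\<lambda>m a. star a \<rhd> m) (\<lambda>a. F (star a)) (\<lambda>a. D (star a))"
proof
  show "\<exists>K. \<forall>a b. norm (b \<lhd> star a) \<le> norm a * norm b * K"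
    using r.bounded by (metis mult.commute norm_star)
  show "\<exists>K. \<forall>a b. norm (star b \<rhd> a) \<le> norm a * norm b * K"
    using l.bounded by (metis mult.commute norm_star)
  show "F (star (a + b)) = F (star a) + F (star b)" for a b
    by (simp add: star_add linear_add[OF linear_F])
  show "F (star (r *\<^sub>R b)) = r *\<^sub>R F (star b)" for r b
    by (simp add: star_scaleR linear_cmul[OF linear_F])
  show "F (star (a * b + b * a)) = D (star a) \<lhd> star b + star b \<rhd> D (star a) + (D (star b) \<lhd> star a + star a \<rhd> D (star b))" for a b
    using F_jordan[of "star a" "star b"] by (simp add: star_add star_mult add_ac)
qed (simp_all add: star_simps l.add_left l.add_right l.scaleR_left l.scaleR_right r.add_left r.add_right
    r.scaleR_left r.scaleR_right lact_mult ract_mult lact_ract)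

text \<open>Off-diagonal parts are controlled by the corner \<open>d A d\<close>: on \<open>c A (1 - d) + (1 - d) A c\<close>
  a null sequence factors through a fixed \<open>r\<close> which annihilates \<open>b'\<close>.\<close>

lemma bounded_corner_imp_J0:
  assumes sa: "star c = c" "star b = b" "star b' = b'" "star d = d"
    and cb: "b * c = c" and bb': "b' * b = b" and b'd: "d * b' = b'"
    and HF: "\<And>y. norm (F (d * y * d)) \<le> K * norm y"
  shows "c \<in> J0"
proof -
  have r1: "c * b = c" "b * b' = b" "b' * d = b'"
    using cb bb' b'd sa by (metis star_mult)+
  have r2: "d * b = b" "b * d = b" using bb' b'd r1 by (metis mult.assoc)+
  have r3: "d * c = c" "c * d = c" "b' * c = c" "c * b' = c" using r2 cb r1 bb' by (metis mult.assoc)+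
  \<comment> \<open>\<open>z y\<close> is \<open>c y (1 - d)\<close> and \<open>z' y\<close> is
    \<open>(1 - d) y c\<close>. Together they make up the difference between
    \<open>y * c + c * y\<close> and its compression by \<open>d\<close>.\<close>
  define z where "z y = c * y - c * y * d" for y
  define z' where "z' y = y * c - d * y * c" for y
  define G where "G y = F (z y + z' y)" for y
  have linG: "linear G"
  proof -
    have "linear (\<lambda>y. z y + z' y)"
      by (rule linearI) (simp_all add: z_def z'_def algebra_simps)
    from linear_compose[OF this linear_F] show ?thesis by (simp add: G_def[abs_def] o_def)
  qed
  have "\<exists>L. \<forall>y. norm (G y) \<le> L * norm y"
  proof (rule ccontr)
    assume unb: "\<not> ?thesis"
    have "\<exists>y. \<forall>n. norm (y n) \<le> (1/4) ^ n \<and> norm (G (y n)) > real n"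
      using linear_unbounded_small[OF linG unb] by (intro choice allI) simp
    then obtain y where y: "\<And>n. norm (y n) \<le> (1/4) ^ n" "\<And>n. norm (G (y n)) > real n" by blast
    \<comment> \<open>Interleaving \<open>z\<close> with the adjoints of \<open>z'\<close> gives
      both the same right factor \<open>r\<close>. The rate \<open>(1/4) ^ n\<close> is chosen
      because the index is halved here, which leaves decay of order
      \<open>(1/2) ^ n\<close>.\<close>
    define w where "w n = (if even n then z (y (n div 2)) else star (z' (y (n div 2))))" for n
    define M where "M = norm c + norm c * norm d"
    have M: "M \<ge> 0" by (simp add: M_def)
    have zle: "norm (z x) \<le> M * norm x" "norm (z' x) \<le> M * norm x" for x
    proof -
      have h: "norm (c * x * d) \<le> norm c * norm x * norm d"
        by (metis mult_right_mono norm_ge_zero norm_mult_ineq order.trans)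
      then show "norm (z x) \<le> M * norm x"
        using norm_triangle_le_diff[OF add_mono[OF norm_mult_ineq[of c x] h]] by (simp add: z_def M_def algebra_simps)
      have h': "norm (d * x * c) \<le> norm d * norm x * norm c"
        by (metis mult_right_mono norm_ge_zero norm_mult_ineq order.trans)
      then show "norm (z' x) \<le> M * norm x"
        using norm_triangle_le_diff[OF add_mono[OF norm_mult_ineq[of x c] h']] by (simp add: z'_def M_def algebra_simps)
    qed
    have wle: "norm (w n) \<le> 2 * M * (1/2) ^ n" for n
    proof -
      have "norm (w n) \<le> M * norm (y (n div 2))" by (simp add: w_def zle)
      also have "\<dots> \<le> M * (1/4) ^ (n div 2)" by (rule mult_left_mono[OF y(1) M])
      also have "M * (1/4) ^ (n div 2) \<le> M * (2 * (1/2) ^ n)"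
      proof (rule mult_left_mono[OF _ M])
        have "(1/4::real) ^ (n div 2) = (1/2) ^ (2 * (n div 2))" by (simp add: power_mult power2_eq_square)
        also have "\<dots> \<le> 2 * (1/2) ^ n"
          by (cases "even n") (auto elim!: evenE oddE)
        finally show "(1/4::real) ^ (n div 2) \<le> 2 * (1/2) ^ n" .
      qed
      finally show ?thesis by simp
    qed
    have "summable (\<lambda>n. star (w n) * w n)"
    proof (rule summable_comparison_test')
      show "summable (\<lambda>n. (2 * M)\<^sup>2 * (1/4) ^ n)" by (intro summable_mult summable_geometric) simp
      show "norm (star (w n) * w n) \<le> (2 * M)\<^sup>2 * (1/4) ^ n" for n
        using power_mono[OF wle[of n], of 2]
        by (simp add: cstar_identity power_mult_distrib power_mult[symmetric] mult.commute[of n 2])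
          (simp add: power_mult power2_eq_square power_one_over)
    qed
    then obtain a where a: "(\<lambda>n. star (w n) * w n) sums a" by (auto simp: summable_def)
    obtain r v C where rv: "star r = r" "\<And>n. w n = v n * r" "\<And>n. norm (v n) \<le> C"
      "\<And>n c. c * w n = w n \<Longrightarrow> c * v n = v n"
      "\<And>n b. (\<And>m. w m * b = 0) \<Longrightarrow> v n * b = 0"
      "\<And>b. (\<And>m. w m * b = 0) \<Longrightarrow> r * b = 0"
      "\<And>W. closed W \<Longrightarrow> subspace W \<Longrightarrow> (\<And>x y. x \<in> W \<Longrightarrow> x * y \<in> W) \<Longrightarrow>
        (\<And>n. star (w n) * w n \<in> W) \<Longrightarrow> r \<in> W"
      using common_right_factor[OF a] by blast
    have bw: "b * w n = w n" for n
    proof -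
      have "b * z x = z x" for x by (simp add: z_def right_diff_distrib mult.assoc[symmetric] cb)
      moreover have "z' x * b = z' x" for x by (simp add: z'_def left_diff_distrib mult.assoc r1)
      then have "b * star (z' x) = star (z' x)" for x using sa by (metis star_mult)
      ultimately show ?thesis by (simp add: w_def)
    qed
    have wb': "w n * b' = 0" for n
    proof -
      have "z x * b' = 0" for x by (simp add: z_def left_diff_distrib mult.assoc b'd)
      moreover have "b' * z' x = 0" for x by (simp add: z'_def right_diff_distrib mult.assoc[symmetric] r1)
      then have "star (z' x) * b' = 0" for x using sa by (metis star_mult star_zero)
      ultimately show ?thesis by (simp add: w_def)
    qed
    have bv: "b * v n = v n" for n by (rule rv(4)[OF bw])
    have vb': "v n * b' = 0" for n by (rule rv(5)[OF wb'])
    have rb': "r * b' = 0" by (rule rv(6)[OF wb'])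
    have b'r: "b' * r = 0" using rb' rv(1) sa by (metis star_mult star_zero)
    \<comment> \<open>Since \<open>r\<close> annihilates \<open>v n\<close> from the left and
      \<open>star (v n)\<close> from the right, the Jordan product of this bounded sequence with the
      fixed element \<open>r\<close> gives back the off-diagonal elements
      \<open>x n\<close>.\<close>
    define \<xi> where "\<xi> n = v (2 * n) + star (v (2 * n + 1))" for n
    have svb: "star (v n) * b = star (v n)" "b' * star (v n) = 0" for n
      using bv[of n] vb'[of n] sa by (metis star_mult, metis star_mult star_zero)
    have vb: "v n * b = 0" "b * star (v n) = 0" for n
    proof -
      show "v n * b = 0" using vb'[of n] bb' by (metis mult.assoc mult_zero_left)
      then show "b * star (v n) = 0" using sa by (metis star_mult star_zero)
    qed
    have \<xi>: "b * \<xi> n + \<xi> n * b = \<xi> n" "b' * \<xi> n * b' = 0" for n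
      by (simp_all add: \<xi>_def ring_distribs bv svb vb mult.assoc vb')
    have s\<xi>: "b * star (\<xi> n) + star (\<xi> n) * b = star (\<xi> n)" "b' * star (\<xi> n) * b' = 0" for n
      by (simp_all add: \<xi>_def star_add star_star ring_distribs bv svb vb mult.assoc vb')
    have \<xi>le: "norm (\<xi> n) \<le> 2 * C" for n
      using norm_triangle_mono[OF rv(3)[of "2 * n"], of "star (v (2 * n + 1))" C] rv(3)[of "2 * n + 1"]
      by (simp add: \<xi>_def)
    define x where "x n = z (y n) + z' (y n)" for n
    have rv0: "r * v n = 0" "star (v n) * r = 0" for n
    proof -
      have "r * v n = r * b' * b * v n" using bv[of n] bb' by (metis mult.assoc)
      then show "r * v n = 0" by (simp add: rb')
      then show "star (v n) * r = 0" using rv(1) by (metis star_mult star_zero)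
    qed
    have zv: "z (y n) = v (2 * n) * r" "z' (y n) = r * star (v (2 * n + 1))" for n
    proof -
      show "z (y n) = v (2 * n) * r" using rv(2)[of "2 * n"] by (simp add: w_def)
      have "star (z' (y n)) = v (2 * n + 1) * r" using rv(2)[of "2 * n + 1"] by (simp add: w_def)
      then show "z' (y n) = r * star (v (2 * n + 1))" using rv(1) by (metis star_mult star_star)
    qed
    have x\<xi>: "\<xi> n * r + r * \<xi> n = x n" for n
      by (simp add: \<xi>_def x_def zv ring_distribs rv0)
    have xb: "x n * b + b * x n = x n" for n
    proof -
      have "r * b = 0" using rb' bb' by (metis mult.assoc mult_zero_left)
      moreover have "b * r = 0" using calculation rv(1) sa by (metis star_mult star_zero)
      ultimately show ?thesis
        by (simp add: x_def zv ring_distribs mult.assoc svb)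
          (simp add: mult.assoc[symmetric] bv)
    qed
    define e1 where "e1 n = jact (\<xi> n) (D r)" for n
    define e2 where "e2 n = jact (x n) (D b)" for n
    have F1: "F (x n) = jact r (D (\<xi> n)) + e1 n" for n
      using F_jact[of "\<xi> n" r] by (simp add: x\<xi> e1_def)
    have F2: "F (x n) = jact b (D (x n)) + e2 n" for n
      using F_jact[of "x n" b] by (simp add: xb e2_def)
    \<comment> \<open>\<open>Q m\<close> is \<open>(1 - b') m (1 - b')\<close>. It kills
      \<open>jact b m\<close> because \<open>b'\<close> is a two-sided unit for \<open>b\<close>, so
      this block of \<open>F (x n)\<close> is controlled by the product with \<open>b\<close>; the
      other blocks are controlled by the product with \<open>r\<close>.\<close>
    define Q where "Q m = m - b' \<rhd> m - m \<lhd> b' + b' \<rhd> m \<lhd> b'" for m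
    have Qb: "Q (jact b m) = 0" for m
      using lact_mult[of b' b m] ract_mult[of m b b']
      by (simp add: Q_def jact_def l.add_right r.add_left lact_ract bb' r1)
    have p1: "b' \<rhd> jact r m = b' \<rhd> m \<lhd> r" for m
      using lact_mult[of b' r m] by (simp add: jact_def l.add_right lact_ract b'r)
    have p2: "jact r m \<lhd> b' = r \<rhd> m \<lhd> b'" for m
      using ract_mult[of m r b'] by (simp add: jact_def r.add_left lact_ract rb')
    have p3: "b' \<rhd> m \<lhd> r \<lhd> b' = 0" for m
      using ract_mult[of "b' \<rhd> m" r b'] by (simp add: rb')
    have F_eq: "F (x n) = b' \<rhd> D (\<xi> n) \<lhd> r + r \<rhd> D (\<xi> n) \<lhd> b'
      + (b' \<rhd> e1 n + e1 n \<lhd> b' - b' \<rhd> e1 n \<lhd> b') + Q (e2 n)" for n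
    proof -
      have "F (x n) = b' \<rhd> F (x n) + F (x n) \<lhd> b' - b' \<rhd> F (x n) \<lhd> b' + Q (F (x n))"
        by (simp add: Q_def)
      also have "Q (F (x n)) = Q (e2 n)"
      proof -
        have "Q (m + m') = Q m + Q m'" for m m'
          by (simp add: Q_def l.add_right r.add_left)
        then show ?thesis by (simp add: F2 Qb)
      qed
      also have "b' \<rhd> F (x n) + F (x n) \<lhd> b' - b' \<rhd> F (x n) \<lhd> b'
        = b' \<rhd> D (\<xi> n) \<lhd> r + r \<rhd> D (\<xi> n) \<lhd> b' + (b' \<rhd> e1 n + e1 n \<lhd> b' - b' \<rhd> e1 n \<lhd> b')"
        by (simp add: F1 l.add_right r.add_left p1 p2 p3)
      finally show ?thesis .
    qed
    have b1: "bdd_seq (\<lambda>n. b' \<rhd> D (\<xi> n) \<lhd> r)"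
    proof -
      have "\<exists>L. \<forall>\<xi>. b * \<xi> + \<xi> * b = \<xi> \<longrightarrow> b' * \<xi> * b' = 0 \<longrightarrow> norm (b' \<rhd> D \<xi> \<lhd> r) \<le> L * norm \<xi>"
        by (rule half_bound[OF sa(2,3) bb' r1(2) r2 HF, where z = w]) (fact bw, fact wb', fact rv(7))
      then obtain L where "\<And>\<xi>. b * \<xi> + \<xi> * b = \<xi> \<Longrightarrow> b' * \<xi> * b' = 0 \<Longrightarrow> norm (b' \<rhd> D \<xi> \<lhd> r) \<le> L * norm \<xi>"
        by blast
      then have "norm (b' \<rhd> D (\<xi> n) \<lhd> r) \<le> L * norm (\<xi> n)" for n using \<xi> by blast
      also have "L * norm (\<xi> n) \<le> \<bar>L\<bar> * (2 * C)" for n by (intro mult_mono \<xi>le) auto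
      finally show ?thesis by (auto simp: bdd_seq_def)
    qed
    \<comment> \<open>The mirror image of \<open>b1\<close>: after the twist the estimate is applied
      to \<open>star (\<xi> n)\<close>, and the order of \<open>r\<close> and \<open>b'\<close> is
      reversed.\<close>
    have b2: "bdd_seq (\<lambda>n. r \<rhd> D (\<xi> n) \<lhd> b')"
    proof -
      interpret tw: jordan_setting "\<lambda>a m. m \<lhd> star a" "\<lambda>m a. star a \<rhd> m" "\<lambda>a. F (star a)" "\<lambda>a. D (star a)"
        by (rule star_twist)
      have HF': "norm (F (star (d * y * d))) \<le> K * norm y" for y
        using HF[of "star y"] by (simp add: star_mult sa mult.assoc)
      have "\<exists>L. \<forall>\<xi>. b * \<xi> + \<xi> * b = \<xi> \<longrightarrow> b' * \<xi> * b' = 0 \<longrightarrow>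
        norm (star r \<rhd> (D (star \<xi>) \<lhd> star b')) \<le> L * norm \<xi>"
        by (rule tw.half_bound[OF sa(2,3) bb' r1(2) r2, where z = w]) (fact HF', fact bw, fact wb', fact rv(7))
      then obtain L where "\<And>\<xi>. b * \<xi> + \<xi> * b = \<xi> \<Longrightarrow> b' * \<xi> * b' = 0 \<Longrightarrow>
        norm (star r \<rhd> (D (star \<xi>) \<lhd> star b')) \<le> L * norm \<xi>"
        by blast
      from this[OF s\<xi>] have "norm (r \<rhd> D (\<xi> n) \<lhd> b') \<le> L * norm (\<xi> n)" for n
        by (simp add: star_star sa rv(1) lact_ract)
      also have "L * norm (\<xi> n) \<le> \<bar>L\<bar> * (2 * C)" for n by (intro mult_mono \<xi>le) auto
      finally show ?thesis by (auto simp: bdd_seq_def)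
    qed
    have e1: "bdd_seq e1"
      unfolding e1_def[abs_def]
      by (rule bdd_seq_linear[OF bounded_linear_jact(1)]) (use \<xi>le in \<open>auto simp: bdd_seq_def\<close>)
    have e2: "bdd_seq e2"
    proof -
      have "norm (x n) \<le> M * 1 + M * 1" for n
      proof -
        have "norm (y n) \<le> 1" using y(1)[of n] power_le_one[of "1/4::real" n] by linarith
        then have "norm (z (y n)) \<le> M * 1" "norm (z' (y n)) \<le> M * 1"
          using zle[of "y n"] mult_left_mono[OF _ M] order.trans by blast+
        then show ?thesis unfolding x_def by (rule norm_triangle_mono)
      qed
      then have "bdd_seq x" by (auto simp: bdd_seq_def)
      then show ?thesis unfolding e2_def[abs_def] by (rule bdd_seq_linear[OF bounded_linear_jact(1)])
    qed
    have lin_l: "bounded_linear ((\<rhd>) b')" and lin_r: "bounded_linear (\<lambda>m. m \<lhd> b')"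
      by (rule l.bounded_linear_right, rule r.bounded_linear_left)
    have lr: "bdd_seq (\<lambda>n. b' \<rhd> X n)" "bdd_seq (\<lambda>n. X n \<lhd> b')" "bdd_seq (\<lambda>n. b' \<rhd> X n \<lhd> b')" if "bdd_seq X" for X
      using bdd_seq_linear[OF lin_l] bdd_seq_linear[OF lin_r] that by blast+
    have "bdd_seq (\<lambda>n. F (x n))"
      unfolding F_eq Q_def by (intro bdd_seq_add bdd_seq_diff b1 b2 lr e1 e2)
    then obtain B where B: "\<And>n. norm (F (x n)) \<le> B" by (auto simp: bdd_seq_def)
    obtain n :: nat where "real n > B" using reals_Archimedean2 by blast
    moreover have "F (x n) = G (y n)" by (simp add: G_def x_def)
    ultimately show False using y(2)[of n] B[of n] by simp
  qed
  then obtain L where L: "\<And>y. norm (G y) \<le> L * norm y" by blast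
  obtain N where N: "N \<ge> 0" "\<And>y. norm (y * c + c * y) \<le> norm y * N"
    using bounded_linear.nonneg_bounded[OF bounded_linear_add[OF bounded_linear_mult_left bounded_linear_mult_right]] by metis
  have "norm (F (y * c + c * y)) \<le> (\<bar>K\<bar> * N + L) * norm y" for y
  proof -
    have "y * c + c * y = d * (y * c + c * y) * d + (z y + z' y)"
    proof -
      have "d * (y * c + c * y) * d = d * y * c + c * y * d"
        by (simp add: ring_distribs mult.assoc r3) (simp add: mult.assoc[symmetric] r3)
      then show ?thesis by (simp add: z_def z'_def)
    qed
    then have "F (y * c + c * y) = F (d * (y * c + c * y) * d) + G y"
      unfolding G_def using linear_add[OF linear_F] by metis
    moreover have "norm (F (d * (y * c + c * y) * d)) \<le> \<bar>K\<bar> * (norm y * N)"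
    proof -
      have "norm (F (d * (y * c + c * y) * d)) \<le> K * norm (y * c + c * y)" by (rule HF)
      also have "\<dots> \<le> \<bar>K\<bar> * (norm y * N)" by (intro mult_mono N) auto
      finally show ?thesis .
    qed
    ultimately show ?thesis using norm_triangle_mono[OF _ L[of y]] by (fastforce simp: algebra_simps)
  qed
  then show ?thesis by (auto simp: J0_iff)
qed

section \<open>Gliding hump over orthogonal corners\<close>

text \<open>Otherwise choose \<open>w k\<close> in the corner of \<open>d k\<close>, summable but
  with large \<open>F (w k)\<close>, and let \<open>x\<close> be the sum. By orthogonality
  \<open>e k * x = x * e k = w k\<close>, so \<open>2 F (w k)\<close> is
  \<open>jact (e k) (D x) + jact x (D (e k))\<close>, and the single vector \<open>D x\<close> would
  have norm larger than every \<open>k\<close>.\<close>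

lemma some_corner_bounded:
  fixes e d :: "nat \<Rightarrow> 'a"
  assumes orth: "\<And>j k. j \<noteq> k \<Longrightarrow> e j * e k = 0"
    and ed: "\<And>k. e k * d k = d k" "\<And>k. d k * e k = d k"
  shows "\<exists>k K. \<forall>y. norm (F (d k * y * d k)) \<le> K * norm y"
proof (rule ccontr)
  assume neg: "\<not> ?thesis"
  obtain C where C: "C > 0" "\<And>a m. norm (jact a m) \<le> C * norm a * norm m" by (rule jact_bound) blast
  \<comment> \<open>The first summand absorbs \<open>jact x (D (e k))\<close>, as
    \<open>norm x \<le> 2\<close>; the second leaves \<open>real k\<close> to be compared with
    \<open>norm (D x)\<close>.\<close>
  define M where "M k = 2 * (C * norm (D (e k))) + C * norm (e k) * real k" for k
  have "\<exists>y. norm y \<le> (1/2) ^ k / ((norm (d k))\<^sup>2 + 1) \<and> norm (F (d k * y * d k)) > M k" for k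
  proof (rule linear_unbounded_small)
    have "linear (\<lambda>y. d k * y * d k)" by (rule linearI) (simp_all add: ring_distribs)
    from linear_compose[OF this linear_F] show "linear (\<lambda>y. F (d k * y * d k))" by (simp add: o_def)
    show "\<not> (\<exists>K. \<forall>y. norm (F (d k * y * d k)) \<le> K * norm y)" using neg by blast
  qed (simp add: add_nonneg_pos)
  then obtain y where y: "\<And>k. norm (y k) \<le> (1/2) ^ k / ((norm (d k))\<^sup>2 + 1)" "\<And>k. norm (F (d k * y k * d k)) > M k"
    by metis
  define w where "w k = d k * y k * d k" for k
  have wle: "norm (w k) \<le> (1/2) ^ k" for k
  proof -
    have pos: "(norm (d k))\<^sup>2 + 1 > 0" by (simp add: add_nonneg_pos)
    have "norm (w k) \<le> norm (d k * y k) * norm (d k)" unfolding w_def by (rule norm_mult_ineq)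
    also have "\<dots> \<le> norm (d k) * norm (y k) * norm (d k)" by (intro mult_right_mono norm_mult_ineq) simp
    also have "\<dots> = (norm (d k))\<^sup>2 * norm (y k)" by (simp add: power2_eq_square)
    also have "\<dots> \<le> ((norm (d k))\<^sup>2 + 1) * ((1/2) ^ k / ((norm (d k))\<^sup>2 + 1))"
      by (intro mult_mono y(1)) auto
    also have "\<dots> = (1/2) ^ k" using pos by simp
    finally show ?thesis .
  qed
  have "summable w"
    by (rule summable_comparison_test'[of "\<lambda>k. (1/2) ^ k"]) (use wle in \<open>auto intro: summable_geometric\<close>)
  then obtain x where x: "w sums x" by (auto simp: summable_def)
  have ew: "e k * w n = (if n = k then w k else 0)" "w n * e k = (if n = k then w k else 0)" for k n
  proof -
    have "e k * d n = 0" "d n * e k = 0" if "n \<noteq> k"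
      using orth[of k n] orth[of n k] that ed[of n] by (metis mult.assoc mult_zero_left, metis mult.assoc mult_zero_right)
    then show "e k * w n = (if n = k then w k else 0)" "w n * e k = (if n = k then w k else 0)"
      using ed by (auto simp: w_def mult.assoc[symmetric]) (auto simp: mult.assoc)
  qed
  have ex: "e k * x = w k" "x * e k = w k" for k
  proof -
    have "(\<lambda>n. e k * w n) sums (e k * x)" "(\<lambda>n. w n * e k) sums (x * e k)"
      by (rule sums_mult[OF x], rule sums_mult2[OF x])
    then show "e k * x = w k" "x * e k = w k"
      unfolding ew using sums_single[of k "\<lambda>_. w k"] sums_unique2 by blast+
  qed
  have nx: "norm x \<le> 2"
  proof -
    have s: "(\<lambda>k. (1/2::real) ^ k) sums 2" using geometric_sums[of "1/2::real"] by simp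
    have "norm x = norm (\<Sum>k. w k)" by (simp only: sums_unique[OF x, symmetric])
    also have "\<dots> \<le> (\<Sum>k. (1/2) ^ k)"
      by (rule norm_suminf_le[OF wle sums_summable[OF s]])
    finally show ?thesis using sums_unique[OF s] by simp
  qed
  have "real k < norm (D x)" for k
  proof -
    have "F (2 *\<^sub>R w k) = jact (e k) (D x) + jact x (D (e k))"
      using F_jact[of x "e k"] by (simp add: ex scaleR_2)
    then have "norm (2 *\<^sub>R F (w k)) \<le> norm (jact (e k) (D x)) + norm (jact x (D (e k)))"
      using norm_triangle_ineq[of "jact (e k) (D x)" "jact x (D (e k))"]
      by (simp only: linear_cmul[OF linear_F])
    then have "2 * norm (F (w k)) \<le> norm (jact (e k) (D x)) + norm (jact x (D (e k)))" by simp
    also have "\<dots> \<le> C * norm (e k) * norm (D x) + C * 2 * norm (D (e k))"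
      by (rule add_mono[OF C(2) order.trans[OF C(2)]]) (intro mult_right_mono mult_left_mono nx; use C(1) in simp)
    finally have "2 * norm (F (w k)) \<le> C * norm (e k) * norm (D x) + 2 * (C * norm (D (e k)))" by simp
    moreover have "norm (F (w k)) > M k" using y(2) by (simp add: w_def)
    moreover have "0 \<le> M k" using C(1) by (simp add: M_def)
    ultimately have "C * norm (e k) * real k < C * norm (e k) * norm (D x)" by (simp add: M_def)
    then show ?thesis by (rule mult_left_less_imp_less) (use C(1) in simp)
  qed
  then show False using reals_Archimedean2[of "norm (D x)"] by (meson less_asym)
qed

end

section \<open>Singular points of the functional calculus\<close>

text \<open>For self-adjoint \<open>e\<close> this is a hereditary C*-subalgebra, on which
  \<open>e\<close> acts as a unit. Being given by equations, it is closed and transitive at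
  once.\<close>

definition her :: "'a::cstar_algebra \<Rightarrow> 'a set"
  where "her e = {a. e * a = a \<and> a * e = a}"

lemma her_closed: "closed (her e)"
  unfolding her_def by (intro closed_Collect_conj closed_Collect_eq continuous_intros)

lemma her_subspace: "subspace (her e)"
  unfolding her_def by (rule subspaceI) (simp_all add: ring_distribs)

lemma her_trans: "a \<in> her q \<Longrightarrow> q \<in> her e \<Longrightarrow> a \<in> her e"
  unfolding her_def by (metis (mono_tags, lifting) mem_Collect_eq mult.assoc)

lemma her_mult: "a \<in> her e \<Longrightarrow> b \<in> her e \<Longrightarrow> a * x * b \<in> her e"
  unfolding her_def by (simp add: mult.assoc[symmetric]) (simp add: mult.assoc)

lemma fc_in_her:
  assumes k: "star k = k" "k \<in> her e" and f: "cont0 f"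
  shows "fc f k \<in> her e"
proof (rule fc_in_closed[OF k(1) f her_closed her_subspace k(2)])
  show "k * x \<in> her e" if "x \<in> her e" for x
    using that k(2) by (simp add: her_def mult.assoc[symmetric]) (simp add: mult.assoc)
qed

definition trapezoid :: "real \<Rightarrow> real \<Rightarrow> real \<Rightarrow> real \<Rightarrow> real"
  where "trapezoid \<nu> \<alpha> \<beta> s = max 0 (min 1 ((\<beta> - \<bar>s - \<nu>\<bar>) / (\<beta> - \<alpha>)))"

lemma trapezoid_eq:
  assumes "\<alpha> < \<beta>"
  shows "\<bar>s - \<nu>\<bar> \<le> \<alpha> \<Longrightarrow> trapezoid \<nu> \<alpha> \<beta> s = 1" "\<bar>s - \<nu>\<bar> \<ge> \<beta> \<Longrightarrow> trapezoid \<nu> \<alpha> \<beta> s = 0"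
  using assms by (auto simp: trapezoid_def max_def min_def field_simps)

lemma cont0_trapezoid:
  assumes "\<alpha> < \<beta>" "\<beta> \<le> \<bar>\<nu>\<bar>"
  shows "cont0 (trapezoid \<nu> \<alpha> \<beta>)"
proof -
  have "continuous_on UNIV (trapezoid \<nu> \<alpha> \<beta>)"
    unfolding trapezoid_def using assms(1) by (intro continuous_intros) auto
  then show ?thesis using trapezoid_eq(2)[OF assms(1), of 0 \<nu>] assms(2) by (simp add: cont0_def)
qed

context jordan_setting
begin

definition regular_point :: "'a \<Rightarrow> real \<Rightarrow> bool"
  where "regular_point k \<mu> \<longleftrightarrow>
    (\<exists>\<epsilon>>0. \<forall>f. cont0 f \<longrightarrow> (\<forall>s. \<bar>s - \<mu>\<bar> \<ge> \<epsilon> \<longrightarrow> f s = 0) \<longrightarrow> fc f k \<in> J0)"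

text \<open>A partition of unity on the compact set where \<open>f\<close> has modulus at least
  \<open>\<eta>\<close>. As \<open>f\<close> vanishes at 0 and at \<open>\<nu>\<close>, this set
  consists of regular points; the pieces are in \<open>J0\<close>, their sum is within
  \<open>\<eta>\<close> of \<open>f\<close>, and \<open>J0\<close> is closed.\<close>

lemma fc_in_J0_of_regular:
  assumes k: "star k = k" and reg: "\<And>\<mu>. \<mu> \<noteq> 0 \<Longrightarrow> \<mu> \<noteq> \<nu> \<Longrightarrow> regular_point k \<mu>"
    and f: "cont0 f" "f \<nu> = 0"
  shows "fc f k \<in> J0"
proof -
  have "\<exists>y\<in>J0. dist y (fc f k) < e" if e: "e > 0" for e
  proof -
    define \<eta> where "\<eta> = e / 2"
    have \<eta>: "\<eta> > 0" using e by (simp add: \<eta>_def)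
    define R where "R = norm k + 1"
    define C where "C = {-R..R} \<inter> {s. \<bar>f s\<bar> \<ge> \<eta>}"
    have cf: "continuous_on UNIV f" using f(1) by (simp add: cont0_def)
    have "closed {s. \<bar>f s\<bar> \<ge> \<eta>}" by (intro closed_Collect_le continuous_intros cf)
    then have C: "compact C" unfolding C_def by (intro compact_Int_closed) auto
    have "\<forall>\<mu>\<in>C. \<exists>\<epsilon>>0. \<forall>f. cont0 f \<longrightarrow> (\<forall>s. \<bar>s - \<mu>\<bar> \<ge> \<epsilon> \<longrightarrow> f s = 0) \<longrightarrow> fc f k \<in> J0"
    proof
      fix \<mu> assume "\<mu> \<in> C"
      then have "\<mu> \<noteq> 0" "\<mu> \<noteq> \<nu>" using f \<eta> by (auto simp: C_def cont0_def)
      then show "\<exists>\<epsilon>>0. \<forall>f. cont0 f \<longrightarrow> (\<forall>s. \<bar>s - \<mu>\<bar> \<ge> \<epsilon> \<longrightarrow> f s = 0) \<longrightarrow> fc f k \<in> J0"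
        using reg by (simp add: regular_point_def)
    qed
    then obtain \<epsilon> where \<epsilon>: "\<And>\<mu>. \<mu> \<in> C \<Longrightarrow> \<epsilon> \<mu> > 0"
      "\<And>\<mu> f. \<mu> \<in> C \<Longrightarrow> cont0 f \<Longrightarrow> (\<And>s. \<bar>s - \<mu>\<bar> \<ge> \<epsilon> \<mu> \<Longrightarrow> f s = 0) \<Longrightarrow> fc f k \<in> J0"
      by metis
    obtain E where E: "E \<subseteq> C" "finite E" "C \<subseteq> (\<Union>\<mu>\<in>E. ball \<mu> (\<epsilon> \<mu>))"
      by (rule compactE_image[OF C, of C "\<lambda>\<mu>. ball \<mu> (\<epsilon> \<mu>)"]) (use \<epsilon>(1) in force)+
    define \<phi> where "\<phi> \<mu> s = max 0 (\<epsilon> \<mu> - \<bar>s - \<mu>\<bar>)" for \<mu> s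
    define \<sigma> where "\<sigma> s = (\<Sum>\<mu>\<in>E. \<phi> \<mu> s)" for s
    have \<phi>0: "\<phi> \<mu> s \<ge> 0" for \<mu> s by (simp add: \<phi>_def)
    have \<sigma>0: "\<sigma> s \<ge> 0" for s unfolding \<sigma>_def by (intro sum_nonneg \<phi>0)
    have c\<phi>: "continuous_on UNIV (\<phi> \<mu>)" for \<mu> unfolding \<phi>_def by (intro continuous_intros)
    have c\<sigma>: "continuous_on UNIV \<sigma>" unfolding \<sigma>_def by (intro continuous_intros c\<phi>)
    have \<sigma>pos: "\<sigma> s > 0" if s: "s \<in> C" for s
    proof -
      obtain \<mu> where \<mu>: "\<mu> \<in> E" "s \<in> ball \<mu> (\<epsilon> \<mu>)" using E(3) s by blast
      then have "\<phi> \<mu> s > 0" by (simp add: \<phi>_def dist_real_def abs_minus_commute)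
      moreover have "\<phi> \<mu> s \<le> \<sigma> s" unfolding \<sigma>_def by (rule member_le_sum[OF \<mu>(1) _ E(2)]) (rule \<phi>0)
      ultimately show ?thesis by linarith
    qed
    obtain \<sigma>\<^sub>0 where \<sigma>\<^sub>0: "\<sigma>\<^sub>0 > 0" "\<And>s. s \<in> C \<Longrightarrow> \<sigma> s \<ge> \<sigma>\<^sub>0"
    proof (cases "C = {}")
      case True
      then show thesis using that[of 1] by simp
    next
      case False
      obtain s\<^sub>0 where "s\<^sub>0 \<in> C" "\<And>s. s \<in> C \<Longrightarrow> \<sigma> s\<^sub>0 \<le> \<sigma> s"
        using continuous_attains_inf[OF C False continuous_on_subset[OF c\<sigma>]] by blast
      then show thesis using that[of "\<sigma> s\<^sub>0"] \<sigma>pos by blast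
    qed
    obtain S where S: "S \<ge> 0" "\<And>s. \<bar>s\<bar> \<le> R \<Longrightarrow> \<bar>f s\<bar> \<le> S" using cont0_bounded[OF f(1)] by blast
    \<comment> \<open>Adding \<open>\<tau>\<close> keeps the denominator positive where the bumps
      vanish. The error is \<open>f * \<tau> / (\<sigma> + \<tau>)\<close>: on \<open>C\<close> it
      is at most \<open>\<eta>\<close> by the choice
      \<open>(S + 1) * \<tau> = \<eta> * \<sigma>\<^sub>0\<close>, and elsewhere because
      \<open>f\<close> itself is at most \<open>\<eta>\<close> in modulus.\<close>
    define \<tau> where "\<tau> = \<eta> * \<sigma>\<^sub>0 / (S + 1)"
    have \<tau>: "\<tau> > 0" using \<eta> \<sigma>\<^sub>0 S by (simp add: \<tau>_def)
    define h where "h \<mu> s = f s * \<phi> \<mu> s / (\<sigma> s + \<tau>)" for \<mu> s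
    have nz: "\<sigma> s + \<tau> \<noteq> 0" for s using \<sigma>0[of s] \<tau> by linarith
    have h: "cont0 (h \<mu>)" for \<mu>
    proof -
      have "continuous_on UNIV (h \<mu>)"
        unfolding h_def using nz by (intro continuous_intros cf c\<phi> c\<sigma>) blast
      then show ?thesis using f(1) by (simp add: cont0_def h_def)
    qed
    have hJ: "fc (h \<mu>) k \<in> J0" if "\<mu> \<in> E" for \<mu>
    proof (rule \<epsilon>(2)[OF _ h])
      show "\<mu> \<in> C" using that E by blast
      show "h \<mu> s = 0" if "\<epsilon> \<mu> \<le> \<bar>s - \<mu>\<bar>" for s using that by (simp add: h_def \<phi>_def)
    qed
    define g where "g s = (\<Sum>\<mu>\<in>E. h \<mu> s)" for s
    have "cont0 (\<lambda>s. \<Sum>\<mu>\<in>E'. h \<mu> s) \<and> fc (\<lambda>s. \<Sum>\<mu>\<in>E'. h \<mu> s) k \<in> J0" if "finite E'" "E' \<subseteq> E" for E'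
      using that
    proof (induction E' rule: finite_induct)
      case empty
      have "cont0 (\<lambda>s. 0)" by (simp add: cont0_def)
      then show ?case using fc_eq_0[OF k, of "\<lambda>s. 0"] by (simp add: subspace_0[OF J0_slices(1)])
    next
      case (insert \<mu> E')
      then have IH: "cont0 (\<lambda>s. \<Sum>\<mu>\<in>E'. h \<mu> s)" "fc (\<lambda>s. \<Sum>\<mu>\<in>E'. h \<mu> s) k \<in> J0" and \<mu>: "\<mu> \<in> E" by auto
      have eq: "(\<lambda>s. \<Sum>\<mu>\<in>insert \<mu> E'. h \<mu> s) = (\<lambda>s. h \<mu> s + (\<Sum>\<mu>\<in>E'. h \<mu> s))"
        using insert.hyps by simp
      show ?case
        unfolding eq fc_add[OF k h IH(1)]
        by (intro conjI cont0_intros(2)[OF h IH(1)] subspace_add[OF J0_slices(1)] hJ[OF \<mu>] IH(2))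
    qed
    then have g: "cont0 g" "fc g k \<in> J0" unfolding g_def[abs_def] using E(2) by blast+
    have "norm (fc (\<lambda>s. f s - g s) k) \<le> \<eta>"
    proof (rule norm_fc_le[OF k cont0_intros(3)[OF f(1) g(1)]])
      fix s assume s: "\<bar>s\<bar> \<le> norm k + 1"
      have "g s = f s * \<sigma> s / (\<sigma> s + \<tau>)"
        by (simp add: g_def h_def \<sigma>_def sum_distrib_left sum_divide_distrib)
      then have eq: "f s - g s = f s * \<tau> / (\<sigma> s + \<tau>)" using nz[of s] by (simp add: field_simps)
      have den: "\<sigma> s + \<tau> > 0" using \<sigma>0[of s] \<tau> by linarith
      have "\<bar>f s\<bar> * \<tau> \<le> \<eta> * (\<sigma> s + \<tau>)"
      proof (cases "s \<in> C")
        case True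
        have "\<bar>f s\<bar> * \<tau> \<le> (S + 1) * \<tau>" using S(2)[of s] s \<tau> by (intro mult_right_mono) (auto simp: R_def)
        also have "\<dots> = \<eta> * \<sigma>\<^sub>0" using S(1) by (simp add: \<tau>_def)
        also have "\<dots> \<le> \<eta> * (\<sigma> s + \<tau>)" using \<sigma>\<^sub>0(2)[OF True] \<tau> \<eta> by (intro mult_left_mono) auto
        finally show ?thesis .
      next
        case False
        then have "\<bar>f s\<bar> \<le> \<eta>" using s by (auto simp: C_def R_def)
        then have "\<bar>f s\<bar> * \<tau> \<le> \<eta> * \<tau>" using \<tau> by (intro mult_right_mono) auto
        also have "\<dots> \<le> \<eta> * (\<sigma> s + \<tau>)" using \<sigma>0[of s] \<eta> by (intro mult_left_mono) auto
        finally show ?thesis .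
      qed
      then show "\<bar>f s - g s\<bar> \<le> \<eta>" unfolding eq using den \<tau> by (simp add: abs_mult pos_divide_le_eq)
    qed
    then have "norm (fc f k - fc g k) < e" using e by (simp add: fc_diff[OF k f(1) g(1)] \<eta>_def)
    then show ?thesis using g(2) by (intro bexI[of _ "fc g k"]) (simp_all add: dist_norm norm_minus_commute)
  qed
  then show ?thesis using closed_approachable[OF J0_slices(2)] by blast
qed

lemma singular_point_exists:
  assumes "star k = k" "k \<notin> J0"
  obtains \<nu> where "\<nu> \<noteq> 0" "\<not> regular_point k \<nu>"
  using fc_in_J0_of_regular[OF assms(1), of 0 "\<lambda>s. s"] assms by (auto simp: fc_id cont0_intros)

text \<open>Near a singular point there is a function whose value is outside \<open>J0\<close>, and
  trapezoids of growing radius are local units for it and for one another. The first four values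
  play the roles of \<open>c\<close>, \<open>b\<close>, \<open>b'\<close>, \<open>d\<close> in
  \<open>bounded_corner_imp_J0\<close>.\<close>

lemma singular_chain:
  assumes k: "star k = k" and \<nu>: "\<not> regular_point k \<nu>" and \<delta>: "0 < \<delta>" "\<delta> \<le> \<bar>\<nu>\<bar>"
  obtains f1 f2 f3 f4 g where "cont0 f1" "cont0 f2" "cont0 f3" "cont0 f4" "cont0 g"
    "fc f1 k \<notin> J0" "fc f2 k * fc f1 k = fc f1 k" "fc f3 k * fc f2 k = fc f2 k"
    "fc f4 k * fc f3 k = fc f3 k" "fc g k * fc f4 k = fc f4 k" "fc g k * fc f1 k = fc f1 k"
    "\<And>s. \<bar>s - \<nu>\<bar> \<ge> \<delta> \<Longrightarrow> g s = 0"
proof -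
  have "\<delta> / 8 > 0" using \<delta> by simp
  then obtain f1 where f1: "cont0 f1" "\<And>s. \<bar>s - \<nu>\<bar> \<ge> \<delta> / 8 \<Longrightarrow> f1 s = 0" "fc f1 k \<notin> J0"
    using \<nu> unfolding regular_point_def by meson
  \<comment> \<open>\<open>T j\<close> is 1 up to radius \<open>j * \<delta> / 8\<close> and 0 from
    \<open>(j + 1) * \<delta> / 8\<close> on, so each is a unit for the one before. The condition
    \<open>\<delta> \<le> \<bar>\<nu>\<bar>\<close> makes them vanish at 0.\<close>
  define T where "T j = trapezoid \<nu> (real j * \<delta> / 8) (real (Suc j) * \<delta> / 8)" for j
  have lt: "real j * \<delta> / 8 < real (Suc j) * \<delta> / 8" for j using \<delta> by simp
  have T: "cont0 (T j)" if "j \<le> 4" for j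
  proof -
    have "real (Suc j) * \<delta> \<le> 8 * \<delta>" using that \<delta> by (intro mult_right_mono) auto
    then have "real (Suc j) * \<delta> / 8 \<le> \<bar>\<nu>\<bar>" using \<delta> by linarith
    then show ?thesis unfolding T_def by (intro cont0_trapezoid lt)
  qed
  have T1: "T j s = 1" if "\<bar>s - \<nu>\<bar> \<le> real j * \<delta> / 8" for j s
    unfolding T_def by (rule trapezoid_eq(1)[OF lt that])
  have T0: "T j s = 0" if "\<bar>s - \<nu>\<bar> \<ge> real (Suc j) * \<delta> / 8" for j s
    unfolding T_def by (rule trapezoid_eq(2)[OF lt that])
  have mult: "fc (T j) k * fc f k = fc f k" if "j \<le> 4" "cont0 f" "\<And>s. \<bar>s - \<nu>\<bar> \<ge> real j * \<delta> / 8 \<Longrightarrow> f s = 0" for j f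
  proof -
    have "(\<lambda>s. T j s * f s) = f"
    proof
      fix s show "T j s * f s = f s"
        using T1[of s j] that(3)[of s] by (cases "\<bar>s - \<nu>\<bar> \<le> real j * \<delta> / 8") auto
    qed
    then show ?thesis using fc_mult[OF k T[OF that(1)] that(2)] by simp
  qed
  have f1': "f1 s = 0" if "\<bar>s - \<nu>\<bar> \<ge> real (Suc j) * \<delta> / 8" for s j
  proof (rule f1(2))
    have "1 * \<delta> \<le> real (Suc j) * \<delta>" using \<delta> by (intro mult_right_mono) auto
    then show "\<delta> / 8 \<le> \<bar>s - \<nu>\<bar>" using that by simp
  qed
  show thesis
  proof (rule that[of f1 "T 1" "T 2" "T 3" "T 4"])
    show "fc (T 1) k * fc f1 k = fc f1 k" using mult[of 1 f1] f1 by simp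
    show "fc (T 2) k * fc (T 1) k = fc (T 1) k" by (rule mult) (use T T0[of 1] in simp_all)
    show "fc (T 3) k * fc (T 2) k = fc (T 2) k" by (rule mult) (use T T0[of 2] in simp_all)
    show "fc (T 4) k * fc (T 3) k = fc (T 3) k" by (rule mult) (use T T0[of 3] in simp_all)
    show "fc (T 4) k * fc f1 k = fc f1 k" by (rule mult) (use f1 f1'[of 3] in simp_all)
    show "T 4 s = 0" if "\<bar>s - \<nu>\<bar> \<ge> \<delta>" for s using T0[of 4 s] that \<delta> by simp
  qed (use f1 T in simp_all)
qed

section \<open>Hereditary subalgebras outside \<open>J0\<close> and their splitting\<close>

definition bad :: "'a \<Rightarrow> bool"
  where "bad e \<longleftrightarrow> star e = e \<and> (\<exists>k. star k = k \<and> k \<in> her e \<and> k \<notin> J0)"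

lemma bad_local:
  assumes k: "star k = k" and \<nu>: "\<not> regular_point k \<nu>" and \<delta>: "0 < \<delta>" "\<delta> \<le> \<bar>\<nu>\<bar>"
  obtains g where "cont0 g" "bad (fc g k)" "\<And>s. \<bar>s - \<nu>\<bar> \<ge> \<delta> \<Longrightarrow> g s = 0"
proof -
  obtain f1 g where f: "cont0 f1" "cont0 g" "fc f1 k \<notin> J0" "fc g k * fc f1 k = fc f1 k"
    "\<And>s. \<bar>s - \<nu>\<bar> \<ge> \<delta> \<Longrightarrow> g s = 0"
    using singular_chain[OF assms] by metis
  have sa: "star (fc f1 k) = fc f1 k" "star (fc g k) = fc g k" using star_fc[OF k] f(1,2) by blast+
  then have "fc f1 k * fc g k = fc f1 k" using f(4) by (metis star_mult)
  then have "bad (fc g k)" using f(3,4) sa by (auto simp: bad_def her_def)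
  then show thesis using that f(2,5) by blast
qed

text \<open>The contrapositive of \<open>bounded_corner_imp_J0\<close>, applied to a chain around a
  singular point of an element outside \<open>J0\<close>.\<close>

lemma bad_corner:
  assumes "bad e"
  obtains d where "star d = d" "d \<in> her e" "\<not> (\<exists>K. \<forall>y. norm (F (d * y * d)) \<le> K * norm y)"
proof -
  obtain k where k: "star k = k" "k \<in> her e" "k \<notin> J0" using assms by (auto simp: bad_def)
  obtain \<nu> where \<nu>: "\<nu> \<noteq> 0" "\<not> regular_point k \<nu>" using singular_point_exists[OF k(1,3)] by blast
  obtain f1 f2 f3 f4 where f: "cont0 f1" "cont0 f2" "cont0 f3" "cont0 f4"
    "fc f1 k \<notin> J0" "fc f2 k * fc f1 k = fc f1 k" "fc f3 k * fc f2 k = fc f2 k"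
    "fc f4 k * fc f3 k = fc f3 k"
    using singular_chain[OF k(1) \<nu>(2), of "\<bar>\<nu>\<bar>"] \<nu>(1) by (metis order_refl zero_less_abs_iff)
  have "\<not> (\<exists>K. \<forall>y. norm (F (fc f4 k * y * fc f4 k)) \<le> K * norm y)"
    using bounded_corner_imp_J0[OF star_fc[OF k(1) f(1)] star_fc[OF k(1) f(2)] star_fc[OF k(1) f(3)]
        star_fc[OF k(1) f(4)] f(6,7,8)] f(5) by blast
  then show thesis using that[OF star_fc[OF k(1) f(4)] fc_in_her[OF k(1,2) f(4)]] by blast
qed

definition split :: "'a \<Rightarrow> bool"
  where "split e \<longleftrightarrow> (\<exists>p q. p \<in> her e \<and> q \<in> her e \<and> p * q = 0 \<and> bad p \<and> bad q)"

text \<open>Otherwise splitting can be repeated forever and yields infinitely many pairwise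
  orthogonal bad elements. Each of them has an unbounded corner, against
  \<open>some_corner_bounded\<close>.\<close>

lemma unsplit_bad_exists:
  assumes "bad e"
  shows "\<exists>e'. bad e' \<and> \<not> split e'"
proof (rule ccontr)
  assume "\<not> ?thesis"
  then have all: "\<And>e'. bad e' \<Longrightarrow> split e'" by blast
  \<comment> \<open>The first component is kept and the second one is split again, so all later
    components lie in the hereditary subalgebra of the second and are orthogonal to the
    first.\<close>
  have "\<exists>x :: nat \<Rightarrow> 'a \<times> 'a. \<forall>n. (bad (fst (x n)) \<and> bad (snd (x n)) \<and> fst (x n) * snd (x n) = 0) \<and>
    (fst (x (Suc n)) \<in> her (snd (x n)) \<and> snd (x (Suc n)) \<in> her (snd (x n)))"
  proof (rule dependent_nat_choice)
    obtain p q where "p * q = 0" "bad p" "bad q"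
      using all[OF assms] unfolding split_def by blast
    then show "\<exists>x. bad (fst x) \<and> bad (snd x) \<and> fst x * snd x = 0"
      by (intro exI[of _ "(p, q)"]) simp
    show "\<exists>y. (bad (fst y) \<and> bad (snd y) \<and> fst y * snd y = 0) \<and> fst y \<in> her (snd x) \<and> snd y \<in> her (snd x)"
      if x: "bad (fst x) \<and> bad (snd x) \<and> fst x * snd x = 0" for x and n :: nat
    proof -
      obtain p q where "p \<in> her (snd x)" "q \<in> her (snd x)" "p * q = 0" "bad p" "bad q"
        using all[of "snd x"] x unfolding split_def by blast
      then show ?thesis by (intro exI[of _ "(p, q)"]) simp
    qed
  qed
  then obtain x :: "nat \<Rightarrow> 'a \<times> 'a" where x: "\<And>n. bad (fst (x n))" "\<And>n. fst (x n) * snd (x n) = 0"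
    "\<And>n. fst (x (Suc n)) \<in> her (snd (x n))" "\<And>n. snd (x (Suc n)) \<in> her (snd (x n))" by blast
  define p q where "p n = fst (x n)" and "q n = snd (x n)" for n
  have p: "bad (p n)" "p n * q n = 0" "p (Suc n) \<in> her (q n)" "q (Suc n) \<in> her (q n)" for n
    using x by (simp_all add: p_def q_def)
  have later: "p (Suc (n + m)) \<in> her (q n) \<and> q (Suc (n + m)) \<in> her (q n)" for n m
  proof (induction m)
    case (Suc m)
    then have "q (Suc (n + m)) \<in> her (q n)" ..
    from her_trans[OF p(3) this] her_trans[OF p(4) this] show ?case unfolding add_Suc_right ..
  qed (use p(3,4)[of n] in simp)
  have orth1: "p n * p m = 0" if nm: "n < m" for n m
  proof -
    obtain l where "m = Suc (n + l)" using less_imp_Suc_add[OF nm] by blast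
    then have "q n * p m = p m" using later[of n l] by (simp add: her_def)
    then have "p n * p m = p n * q n * p m" by (simp add: mult.assoc)
    then show ?thesis using p(2) by simp
  qed
  have sap: "star (p n) = p n" for n using p(1) by (simp add: bad_def)
  have orth: "p n * p m = 0" if "n \<noteq> m" for n m
  proof (cases "n < m")
    case False
    then have "star (p m * p n) = 0" using orth1[of m n] that by simp
    then show ?thesis by (simp add: star_mult sap)
  qed (rule orth1)
  have "\<forall>n. \<exists>d. d \<in> her (p n) \<and> \<not> (\<exists>K. \<forall>y. norm (F (d * y * d)) \<le> K * norm y)"
  proof
    fix n
    obtain d where "d \<in> her (p n)" "\<not> (\<exists>K. \<forall>y. norm (F (d * y * d)) \<le> K * norm y)"
      using bad_corner[OF p(1)[of n]] by blast
    then show "\<exists>d. d \<in> her (p n) \<and> \<not> (\<exists>K. \<forall>y. norm (F (d * y * d)) \<le> K * norm y)" by blast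
  qed
  then obtain d where d: "\<And>n. d n \<in> her (p n)" "\<And>n. \<not> (\<exists>K. \<forall>y. norm (F (d n * y * d n)) \<le> K * norm y)"
    by metis
  have "p n * d n = d n" "d n * p n = d n" for n using d(1)[of n] by (simp_all add: her_def)
  from some_corner_bounded[of p d, OF orth this] d(2) show False by blast
qed

text \<open>Bumps around two different nonzero singular points would split \<open>e\<close>. With at
  most one such point left, \<open>fc_in_J0_of_regular\<close> applies; if there is none, 0 serves
  as \<open>\<nu>\<close>.\<close>

lemma unsplit_point:
  assumes e: "bad e" "\<not> split e" and k: "star k = k" "k \<in> her e"
  obtains \<nu> where "\<And>f. cont0 f \<Longrightarrow> f \<nu> = 0 \<Longrightarrow> fc f k \<in> J0"
proof (cases "\<exists>\<nu>. \<nu> \<noteq> 0 \<and> \<not> regular_point k \<nu>")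
  case True
  then obtain \<nu> where \<nu>: "\<nu> \<noteq> 0" "\<not> regular_point k \<nu>" by blast
  have "regular_point k \<mu>" if \<mu>: "\<mu> \<noteq> 0" "\<mu> \<noteq> \<nu>" for \<mu>
  proof (rule ccontr)
    assume \<mu>': "\<not> regular_point k \<mu>"
    \<comment> \<open>Half the distance makes the two bumps disjoint; the other bounds make them
      vanish at 0.\<close>
    define \<delta> where "\<delta> = min (min \<bar>\<nu>\<bar> \<bar>\<mu>\<bar>) (\<bar>\<nu> - \<mu>\<bar> / 2)"
    have \<delta>: "\<delta> > 0" "\<delta> \<le> \<bar>\<nu>\<bar>" "\<delta> \<le> \<bar>\<mu>\<bar>"
      using \<nu>(1) \<mu> by (simp_all add: \<delta>_def)
    have \<delta>': "\<delta> \<le> \<bar>\<nu> - \<mu>\<bar> / 2" unfolding \<delta>_def by (rule min.cobounded2)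
    obtain g where g: "cont0 g" "bad (fc g k)" "\<And>s. \<bar>s - \<nu>\<bar> \<ge> \<delta> \<Longrightarrow> g s = 0"
      using bad_local[OF k(1) \<nu>(2) \<delta>(1,2)] by blast
    obtain h where h: "cont0 h" "bad (fc h k)" "\<And>s. \<bar>s - \<mu>\<bar> \<ge> \<delta> \<Longrightarrow> h s = 0"
      using bad_local[OF k(1) \<mu>' \<delta>(1,3)] by blast
    have gh: "g s * h s = 0" for s
    proof (cases "\<bar>s - \<nu>\<bar> \<ge> \<delta>")
      case False
      then have "2 * \<delta> \<le> \<bar>\<nu> - \<mu>\<bar>" "\<bar>s - \<nu>\<bar> \<le> \<delta>" using \<delta>' by simp_all
      moreover have "\<bar>\<nu> - \<mu>\<bar> \<le> \<bar>s - \<mu>\<bar> + \<bar>s - \<nu>\<bar>"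
        using abs_triangle_ineq4[of "s - \<mu>" "s - \<nu>"] by simp
      ultimately have "2 * \<delta> \<le> \<bar>s - \<mu>\<bar> + \<delta>" by (meson add_left_mono order.trans)
      then have "\<bar>s - \<mu>\<bar> \<ge> \<delta>" by simp
      then show ?thesis using h(3) by simp
    qed (use g(3) in simp)
    have "fc g k * fc h k = 0"
      using fc_eq_0[OF k(1) cont0_intros(5)[OF g(1) h(1)] gh] by (simp add: fc_mult[OF k(1) g(1) h(1)])
    then have "split e" using g(2) h(2) fc_in_her[OF k g(1)] fc_in_her[OF k h(1)] by (auto simp: split_def)
    then show False using e(2) by simp
  qed
  then show thesis using that[of \<nu>] fc_in_J0_of_regular[OF k(1)] by blast
next
  case False
  then show thesis using that[of 0] fc_in_J0_of_regular[OF k(1), of 0] by blast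
qed

end

text \<open>The map \<open>\<Phi>\<close> is bounded on the closed subspace \<open>H \<inter> J\<close>, which has codimension at most one
  in \<open>H\<close>.\<close>

lemma bounded_on_of_codim_1:
  fixes \<Phi> :: "'a::real_normed_vector \<Rightarrow> 'b::real_normed_vector"
  assumes lin: "linear \<Phi>" and H: "subspace H" and J: "closed J" "subspace J"
    and bdd: "\<And>k. k \<in> H \<Longrightarrow> k \<in> J \<Longrightarrow> norm (\<Phi> k) \<le> L * norm k"
    and codim: "\<And>p q. p \<in> H \<Longrightarrow> q \<in> H \<Longrightarrow> q \<notin> J \<Longrightarrow> \<exists>t. p - t *\<^sub>R q \<in> J"
  shows "\<exists>K. \<forall>k\<in>H. norm (\<Phi> k) \<le> K * norm k"
proof (cases "H \<subseteq> J")
  case True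
  then show ?thesis using bdd by blast
next
  case False
  then obtain q where q: "q \<in> H" "q \<notin> J" by blast
  obtain \<delta> where \<delta>: "\<delta> > 0" "\<And>v. v \<in> J \<Longrightarrow> dist v q \<ge> \<delta>"
    using closed_approachable[OF J(1), of q] q(2) by (metis not_less)
  \<comment> \<open>\<open>\<delta>\<close> is a lower bound for the distance from \<open>q\<close>
    to \<open>J\<close>, so the coefficient of \<open>q\<close> modulo \<open>J\<close> is a bounded
    function of \<open>p\<close>.\<close>
  have qt: "\<bar>t\<bar> * \<delta> \<le> norm p" if "p - t *\<^sub>R q \<in> J" for p t
  proof (cases "t = 0")
    case False
    have "(- (1 / t)) *\<^sub>R (p - t *\<^sub>R q) \<in> J" using that J(2) by (rule subspace_scale[rotated])
    moreover have "(- (1 / t)) *\<^sub>R (p - t *\<^sub>R q) = q - (1 / t) *\<^sub>R p"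
      using False by (simp add: scaleR_diff_right)
    ultimately have "\<delta> \<le> norm ((1 / t) *\<^sub>R p)" using \<delta>(2) by (fastforce simp: dist_norm)
    then show ?thesis using False by (simp add: pos_le_divide_eq mult.commute)
  qed simp
  have "norm (\<Phi> p) \<le> (\<bar>L\<bar> * (1 + norm q / \<delta>) + norm (\<Phi> q) / \<delta>) * norm p" if p: "p \<in> H" for p
  proof -
    obtain t where t: "p - t *\<^sub>R q \<in> J" using codim[OF p q] by blast
    have tle: "\<bar>t\<bar> \<le> norm p / \<delta>" using qt[OF t] \<delta>(1) by (simp add: pos_le_divide_eq)
    have "p - t *\<^sub>R q \<in> H" using p q H by (simp add: subspace_diff subspace_scale)
    from bdd[OF this t] have "norm (\<Phi> (p - t *\<^sub>R q)) \<le> \<bar>L\<bar> * norm (p - t *\<^sub>R q)"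
      by (meson abs_ge_self mult_right_mono norm_ge_zero order.trans)
    also have "\<dots> \<le> \<bar>L\<bar> * (norm p + norm p / \<delta> * norm q)"
      using norm_triangle_ineq4[of p "t *\<^sub>R q"] mult_right_mono[OF tle, of "norm q"]
      by (intro mult_left_mono) auto
    finally have 1: "norm (\<Phi> (p - t *\<^sub>R q)) \<le> \<bar>L\<bar> * (norm p + norm p / \<delta> * norm q)" .
    have "\<Phi> p = \<Phi> (p - t *\<^sub>R q) + t *\<^sub>R \<Phi> q"
      by (simp add: linear_diff[OF lin] linear_cmul[OF lin])
    then have "norm (\<Phi> p) \<le> norm (\<Phi> (p - t *\<^sub>R q)) + \<bar>t\<bar> * norm (\<Phi> q)"
      using norm_triangle_ineq[of "\<Phi> (p - t *\<^sub>R q)" "t *\<^sub>R \<Phi> q"] by simp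
    also have "\<dots> \<le> \<bar>L\<bar> * (norm p + norm p / \<delta> * norm q) + norm p / \<delta> * norm (\<Phi> q)"
      using 1 mult_right_mono[OF tle, of "norm (\<Phi> q)"] by simp
    finally show ?thesis by (simp add: algebra_simps)
  qed
  then show ?thesis by blast
qed

lemma selfadjoint_subspace: "subspace {k::'a::cstar_algebra. star k = k}"
  by (rule subspaceI) (simp_all add: star_simps)

section \<open>Boundedness on subalgebras that do not split, and conclusion\<close>

context jordan_setting
begin

text \<open>The condition concerns the functions of the multiples of one \<open>k\<close>, so the
  same constant serves inside a hereditary subalgebra and later on all of \<open>A\<close>.
  Multiples occur because \<open>k\<close> is normalized before it is factored. The bound for
  \<open>i k\<close> is separate, \<open>F\<close> being only real linear in this context.\<close>

lemma F_bound_selfadjoint: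
  obtains K where "K \<ge> 0"
    "\<And>k. star k = k \<Longrightarrow> (\<And>r f. cont0 f \<Longrightarrow> fc f (r *\<^sub>R k) \<in> J0) \<Longrightarrow> norm (F k) \<le> K * norm k \<and> norm (F (\<i> *\<^sub>C k)) \<le> K * norm k"
proof -
  obtain f g where fg: "cont0 f" "cont0 g"
    "\<And>k::'a. star k = k \<Longrightarrow> fc f k * fc g k = k" "\<And>k::'a. star k = k \<Longrightarrow> fc g k * fc f k = k"
    "\<And>k::'a. star k = k \<Longrightarrow> norm k = 1 \<Longrightarrow> norm (fc f k) \<le> 2 \<and> norm (fc g k) \<le> 4"
    by (rule cube_root_factor) blast
  obtain K where K: "K \<ge> 0" "\<And>a b. a \<in> J0 \<Longrightarrow> b \<in> J0 \<Longrightarrow> norm (F (a * b + b * a)) \<le> K * norm a * norm b"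
    by (rule F_bound_J0) blast
  have "norm (F k) \<le> (4 * K) * norm k \<and> norm (F (\<i> *\<^sub>C k)) \<le> (4 * K) * norm k"
    if k: "star k = k" and J: "\<And>r f. cont0 f \<Longrightarrow> fc f (r *\<^sub>R k) \<in> J0" for k
  proof (cases "k = 0")
    case True
    then show ?thesis by (simp add: linear_0[OF linear_F])
  next
    case False
    define u where "u = (1 / norm k) *\<^sub>R k"
    have u: "star u = u" "norm u = 1" using False k by (simp_all add: u_def star_scaleR)
    have ku: "k = norm k *\<^sub>R u" using False by (simp add: u_def)
    have iku: "\<i> *\<^sub>C k = norm k *\<^sub>R (\<i> *\<^sub>C u)"
      by (subst ku) (simp add: scaleR_scaleC scaleC_scaleC mult.commute)
    define s t where "s = fc f u" and "t = fc g u"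
    have st: "s \<in> J0" "t \<in> J0" "\<i> *\<^sub>C s \<in> J0" "s * t = u" "t * s = u" "norm s \<le> 2" "norm t \<le> 4"
      using J[OF fg(1), of "1 / norm k"] J[OF fg(2), of "1 / norm k"] fg(3-5)[OF u(1)] u(2) J0_imaginary
      by (auto simp: s_def t_def u_def)
    have le: "K * norm s * norm t \<le> K * 2 * 4"
      using K(1) st(6,7) by (intro mult_mono) auto
    have "norm (F (2 *\<^sub>R u)) \<le> 8 * K"
      using K(2)[OF st(1,2)] le by (simp add: st(4,5) scaleR_2)
    then have 1: "norm (F u) \<le> 4 * K" by (simp add: linear_cmul[OF linear_F])
    have "norm (F (2 *\<^sub>R (\<i> *\<^sub>C u))) \<le> 8 * K"
      using K(2)[OF st(3,2)] le by (simp add: st(4,5) scaleR_2 mult_scaleC_left mult_scaleC_right norm_scaleC)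
    then have 2: "norm (F (\<i> *\<^sub>C u)) \<le> 4 * K" by (simp add: linear_cmul[OF linear_F])
    have "F k = norm k *\<^sub>R F u" by (subst ku) (rule linear_cmul[OF linear_F])
    moreover have "F (\<i> *\<^sub>C k) = norm k *\<^sub>R F (\<i> *\<^sub>C u)" unfolding iku by (rule linear_cmul[OF linear_F])
    ultimately show ?thesis
      using mult_left_mono[OF 1, of "norm k"] mult_left_mono[OF 2, of "norm k"] by (simp add: mult.commute)
  qed
  then show thesis using that[of "4 * K"] K(1) by simp
qed

text \<open>Two elements \<open>p\<close>, \<open>q\<close> outside \<open>J0\<close>, scaled so that \<open>p\<^sup>2 - p\<close> and \<open>q\<^sup>2 - q\<close> are in \<open>J0\<close>,
  are proportional modulo \<open>J0\<close>, by the parallelogram identity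
  \<open>(p + q)\<^sup>2 + (p - q)\<^sup>2 = 2 p\<^sup>2 + 2 q\<^sup>2\<close>.\<close>

lemma unsplit_bounded:
  assumes e: "bad e" "\<not> split e"
  shows "\<exists>K. \<forall>a\<in>her e. norm (F a) \<le> K * norm a"
proof -
  define H where "H = her e \<inter> {k. star k = k}"
  have H: "subspace H" unfolding H_def by (rule subspace_inter[OF her_subspace selfadjoint_subspace])
  note J = J0_slices(1)
  have Hsq: "k * k \<in> H" if "k \<in> H" for k
    using that by (auto simp: H_def her_def star_mult mult.assoc) (simp add: mult.assoc[symmetric])
  have point: "\<exists>\<nu>. \<forall>f. cont0 f \<longrightarrow> f \<nu> = 0 \<longrightarrow> fc f k \<in> J0" if "k \<in> H" for k
    using unsplit_point[OF e] that unfolding H_def by blast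
  \<comment> \<open>\<open>s^2 - \<nu> s\<close> vanishes at 0 and at \<open>\<nu>\<close>. For
    \<open>\<nu> = 0\<close> the identity function already vanishes at \<open>\<nu>\<close>, so that
    \<open>k\<close> itself is in \<open>J0\<close>.\<close>
  have sq: "\<exists>\<nu>. k * k - \<nu> *\<^sub>R k \<in> J0 \<and> (\<nu> = 0 \<longrightarrow> k \<in> J0)" if k: "k \<in> H" for k
  proof -
    have sa: "star k = k" using k by (simp add: H_def)
    obtain \<nu> where \<nu>: "\<And>f. cont0 f \<Longrightarrow> f \<nu> = 0 \<Longrightarrow> fc f k \<in> J0" using point[OF k] by blast
    have c: "cont0 (\<lambda>s. s * s)" "cont0 (\<lambda>s. \<nu> * s)" by (rule cont0_intros cont0_intros(1))+
    have "fc (\<lambda>s. s * s - \<nu> * s) k \<in> J0" by (rule \<nu>[OF cont0_intros(3)[OF c]]) simp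
    then have "k * k - \<nu> *\<^sub>R k \<in> J0"
      by (simp only: fc_diff[OF sa c] fc_mult[OF sa cont0_intros(1) cont0_intros(1)] fc_scaleR[OF sa cont0_intros(1)] fc_id[OF sa])
    moreover have "k \<in> J0" if "\<nu> = 0" using \<nu>[OF cont0_intros(1)] that by (simp add: fc_id[OF sa])
    ultimately show ?thesis by blast
  qed
  have normalize: "\<exists>r. r \<noteq> 0 \<and> (r *\<^sub>R k) * (r *\<^sub>R k) - r *\<^sub>R k \<in> J0" if k: "k \<in> H" "k \<notin> J0" for k
  proof -
    obtain \<nu> where \<nu>: "k * k - \<nu> *\<^sub>R k \<in> J0" "\<nu> \<noteq> 0" using sq[OF k(1)] k(2) by blast
    have "(1 / \<nu>)\<^sup>2 *\<^sub>R (k * k - \<nu> *\<^sub>R k) \<in> J0" by (rule subspace_scale[OF J \<nu>(1)])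
    moreover have "(1 / \<nu>)\<^sup>2 *\<^sub>R (k * k - \<nu> *\<^sub>R k) = ((1 / \<nu>) *\<^sub>R k) * ((1 / \<nu>) *\<^sub>R k) - (1 / \<nu>) *\<^sub>R k"
      using \<nu>(2) by (simp add: scaleR_diff_right power2_eq_square)
    ultimately show ?thesis using \<nu>(2) by (intro exI[of _ "1 / \<nu>"]) simp
  qed
  have codim': "\<exists>t. p - t *\<^sub>R q \<in> J0" if p: "p \<in> H" "p \<notin> J0" "p * p - p \<in> J0" and q: "q \<in> H" "q \<notin> J0" "q * q - q \<in> J0" for p q
  proof -
    obtain \<alpha> where \<alpha>: "(p + q) * (p + q) - \<alpha> *\<^sub>R (p + q) \<in> J0"
      using sq[OF subspace_add[OF H p(1) q(1)]] by blast
    obtain \<beta> where \<beta>: "(p - q) * (p - q) - \<beta> *\<^sub>R (p - q) \<in> J0" "\<beta> = 0 \<longrightarrow> p - q \<in> J0"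
      using sq[OF subspace_diff[OF H p(1) q(1)]] by blast
    have "2 *\<^sub>R (p * p - p) + 2 *\<^sub>R (q * q - q)
      - (((p + q) * (p + q) - \<alpha> *\<^sub>R (p + q)) + ((p - q) * (p - q) - \<beta> *\<^sub>R (p - q))) \<in> J0"
      by (intro subspace_add[OF J] subspace_diff[OF J] subspace_scale[OF J] p(3) q(3) \<alpha> \<beta>(1))
    also have "2 *\<^sub>R (p * p - p) + 2 *\<^sub>R (q * q - q)
      - (((p + q) * (p + q) - \<alpha> *\<^sub>R (p + q)) + ((p - q) * (p - q) - \<beta> *\<^sub>R (p - q)))
      = (\<alpha> + \<beta> - 2) *\<^sub>R p + (\<alpha> - \<beta> - 2) *\<^sub>R q"
      by (simp add: algebra_simps scaleR_2)
    finally have comb: "(\<alpha> + \<beta> - 2) *\<^sub>R p + (\<alpha> - \<beta> - 2) *\<^sub>R q \<in> J0" .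
    show ?thesis
    proof (cases "\<alpha> + \<beta> - 2 = 0")
      case False
      have "(1 / (\<alpha> + \<beta> - 2)) *\<^sub>R ((\<alpha> + \<beta> - 2) *\<^sub>R p + (\<alpha> - \<beta> - 2) *\<^sub>R q) \<in> J0"
        by (rule subspace_scale[OF J comb])
      then have "p - (- ((\<alpha> - \<beta> - 2) / (\<alpha> + \<beta> - 2))) *\<^sub>R q \<in> J0"
        using False by (simp add: scaleR_add_right)
      then show ?thesis by blast
    next
      case True
      show ?thesis
      proof (cases "\<alpha> - \<beta> - 2 = 0")
        case True
        \<comment> \<open>Both coefficients of the combination vanish only for
          \<open>\<alpha> = 2\<close> and \<open>\<beta> = 0\<close>. The combination then says
          nothing, but the second clause of \<open>sq\<close> puts \<open>p - q\<close> into
          \<open>J0\<close>.\<close>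
        then have "\<beta> = 0" using \<open>\<alpha> + \<beta> - 2 = 0\<close> by linarith
        then show ?thesis using \<beta>(2) by (intro exI[of _ 1]) simp
      next
        case False
        have "(\<alpha> - \<beta> - 2) *\<^sub>R q \<in> J0" using comb unfolding True by simp
        from subspace_scale[OF J this, of "1 / (\<alpha> - \<beta> - 2)"] have "q \<in> J0" using False by simp
        then show ?thesis using q(2) by simp
      qed
    qed
  qed
  have codim: "\<exists>t. p - t *\<^sub>R q \<in> J0" if p: "p \<in> H" and q: "q \<in> H" "q \<notin> J0" for p q
  proof (cases "p \<in> J0")
    case True
    then show ?thesis by (intro exI[of _ 0]) simp
  next
    case False
    obtain r where r: "r \<noteq> 0" "(r *\<^sub>R p) * (r *\<^sub>R p) - r *\<^sub>R p \<in> J0" using normalize[OF p False] by blast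
    obtain r' where r': "r' \<noteq> 0" "(r' *\<^sub>R q) * (r' *\<^sub>R q) - r' *\<^sub>R q \<in> J0" using normalize[OF q] by blast
    have nJ: "c *\<^sub>R k \<notin> J0" if "c \<noteq> 0" "k \<notin> J0" for c k
      using subspace_scale[OF J, of "c *\<^sub>R k" "1 / c"] that by auto
    obtain t where "r *\<^sub>R p - t *\<^sub>R (r' *\<^sub>R q) \<in> J0"
      using codim'[OF subspace_scale[OF H p] nJ[OF r(1) False] r(2) subspace_scale[OF H q(1)] nJ[OF r'(1) q(2)] r'(2)]
      by blast
    from subspace_scale[OF J this, of "1 / r"] have "p - (t * r' / r) *\<^sub>R q \<in> J0"
      using r(1) by (simp add: scaleR_diff_right)
    then show ?thesis by blast
  qed
  obtain K where K: "K \<ge> 0" "\<And>k. star k = k \<Longrightarrow> (\<And>r f. cont0 f \<Longrightarrow> fc f (r *\<^sub>R k) \<in> J0) \<Longrightarrow>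
      norm (F k) \<le> K * norm k \<and> norm (F (\<i> *\<^sub>C k)) \<le> K * norm k"
    by (rule F_bound_selfadjoint) blast
  have fcJ: "fc f k \<in> J0" if k: "k \<in> H" "k \<in> J0" and f: "cont0 f" for f k
  proof -
    have sa: "star k = k" using k by (simp add: H_def)
    obtain \<nu> where \<nu>: "\<And>f. cont0 f \<Longrightarrow> f \<nu> = 0 \<Longrightarrow> fc f k \<in> J0" using point[OF k(1)] by blast
    show ?thesis
    proof (cases "\<nu> = 0")
      case True
      then show ?thesis using \<nu>[OF f] f by (simp add: cont0_def)
    next
      case False
      \<comment> \<open>With this slope \<open>f s - c * s\<close> vanishes at \<open>\<nu>\<close>,
        so \<open>f(k)\<close> differs from a multiple of \<open>k\<close> by an element of
        \<open>J0\<close>, and \<open>k\<close> is in \<open>J0\<close> too.\<close>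
      define c where "c = f \<nu> / \<nu>"
      have cc: "cont0 (\<lambda>s. c * s)" by (rule cont0_intros(4)[OF cont0_intros(1)])
      have "fc (\<lambda>s. f s - c * s) k \<in> J0"
        by (rule \<nu>[OF cont0_intros(3)[OF f cc]]) (use False in \<open>simp add: c_def\<close>)
      then have "fc f k - c *\<^sub>R k \<in> J0"
        by (simp only: fc_diff[OF sa f cc] fc_scaleR[OF sa cont0_intros(1)] fc_id[OF sa])
      from subspace_add[OF J this subspace_scale[OF J k(2), of c]] show ?thesis by simp
    qed
  qed
  have bd: "norm (F k) \<le> K * norm k \<and> norm (F (\<i> *\<^sub>C k)) \<le> K * norm k" if k: "k \<in> H" "k \<in> J0" for k
  proof (rule K(2))
    show "star k = k" using k by (simp add: H_def)
    show "fc f (r *\<^sub>R k) \<in> J0" if "cont0 f" for r f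
      by (rule fcJ[OF subspace_scale[OF H k(1)] subspace_scale[OF J k(2)] that])
  qed
  have linear_i: "linear (\<lambda>k. F (\<i> *\<^sub>C k))"
    by (rule linearI) (simp_all add: scaleC_add_right linear_add[OF linear_F] scaleR_scaleC scaleC_scaleC
        mult.commute[of \<i>] flip: linear_cmul[OF linear_F])
  obtain K1 where K1: "\<And>k. k \<in> H \<Longrightarrow> norm (F k) \<le> K1 * norm k"
    using bounded_on_of_codim_1[OF linear_F H J0_slices(2,1), of K] bd codim by blast
  obtain K2 where K2: "\<And>k. k \<in> H \<Longrightarrow> norm (F (\<i> *\<^sub>C k)) \<le> K2 * norm k"
    using bounded_on_of_codim_1[OF linear_i H J0_slices(2,1), of K] bd codim by blast
  have "norm (F a) \<le> (\<bar>K1\<bar> + \<bar>K2\<bar>) * norm a" if a: "a \<in> her e" for a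
  proof -
    obtain h k where hk: "star h = h" "star k = k" "a = h + \<i> *\<^sub>C k"
      "h = (1/2) *\<^sub>R (a + star a)" "k = (1/2) *\<^sub>R ((- \<i>) *\<^sub>C (a - star a))"
      "norm h \<le> norm a" "norm k \<le> norm a"
      by (rule selfadjoint_decomposition) blast
    have "star e = e" using e(1) by (simp add: bad_def)
    moreover have "e * a = a" "a * e = a" using a by (simp_all add: her_def)
    ultimately have sta: "e * star a = star a" "star a * e = star a" by (metis star_mult)+
    have "h \<in> her e" "k \<in> her e"
      unfolding hk(4,5) using a sta
      by (simp_all add: her_def ring_distribs mult_scaleC_left mult_scaleC_right)
    then have "h \<in> H" "k \<in> H" using hk(1,2) by (simp_all add: H_def)
    note HH = this
    have "norm (F h) \<le> \<bar>K1\<bar> * norm a"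
      by (rule order.trans[OF K1[OF HH(1)] mult_mono]) (use hk(6) in auto)
    moreover have "norm (F (\<i> *\<^sub>C k)) \<le> \<bar>K2\<bar> * norm a"
      by (rule order.trans[OF K2[OF HH(2)] mult_mono]) (use hk(7) in auto)
    ultimately have "norm (F h + F (\<i> *\<^sub>C k)) \<le> \<bar>K1\<bar> * norm a + \<bar>K2\<bar> * norm a" by (rule norm_triangle_mono)
    moreover have "F a = F h + F (\<i> *\<^sub>C k)" by (subst hk(3)) (rule linear_add[OF linear_F])
    ultimately show ?thesis by (simp add: algebra_simps)
  qed
  then show ?thesis by blast
qed

lemma no_bad: "\<not> bad e"
proof
  assume "bad e"
  then obtain e' where e': "bad e'" "\<not> split e'" using unsplit_bad_exists by blast
  obtain K where K: "\<And>a. a \<in> her e' \<Longrightarrow> norm (F a) \<le> K * norm a" using unsplit_bounded[OF e'] by blast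
  obtain d where d: "d \<in> her e'" "\<not> (\<exists>K. \<forall>y. norm (F (d * y * d)) \<le> K * norm y)"
    using bad_corner[OF e'(1)] by metis
  have "norm (F (d * y * d)) \<le> (\<bar>K\<bar> * (norm d * norm d)) * norm y" for y
  proof -
    have "norm (F (d * y * d)) \<le> K * norm (d * y * d)" by (rule K[OF her_mult[OF d(1) d(1)]])
    also have "\<dots> \<le> \<bar>K\<bar> * (norm d * norm y * norm d)"
      by (intro mult_mono order.trans[OF norm_mult_ineq mult_right_mono[OF norm_mult_ineq]]) auto
    finally show ?thesis by (simp add: mult_ac)
  qed
  with d(2) show False by blast
qed

lemma F_bounded: "\<exists>K. \<forall>a. norm (F a) \<le> K * norm a"
proof -
  have J: "k \<in> J0" if k: "star k = k" for k
  proof (rule ccontr)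
    assume "k \<notin> J0"
    then obtain \<nu> where \<nu>: "\<nu> \<noteq> 0" "\<not> regular_point k \<nu>" using singular_point_exists[OF k] by blast
    obtain g where "bad (fc g k)" using bad_local[OF k \<nu>(2), of "\<bar>\<nu>\<bar>"] \<nu>(1) by auto
    then show False using no_bad by blast
  qed
  obtain K where K: "K \<ge> 0" "\<And>k. star k = k \<Longrightarrow> (\<And>r f. cont0 f \<Longrightarrow> fc f (r *\<^sub>R k) \<in> J0) \<Longrightarrow>
      norm (F k) \<le> K * norm k \<and> norm (F (\<i> *\<^sub>C k)) \<le> K * norm k"
    by (rule F_bound_selfadjoint) blast
  have bd: "norm (F k) \<le> K * norm k \<and> norm (F (\<i> *\<^sub>C k)) \<le> K * norm k" if k: "star k = k" for k
    by (rule K(2)[OF k]) (intro J star_fc, simp_all add: star_scaleR k)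
  have "norm (F a) \<le> (K + K) * norm a" for a
  proof -
    obtain h k where hk: "star h = h" "star k = k" "a = h + \<i> *\<^sub>C k" "norm h \<le> norm a" "norm k \<le> norm a"
      by (rule selfadjoint_decomposition[of a]) blast
    have "norm (F h + F (\<i> *\<^sub>C k)) \<le> K * norm a + K * norm a"
      using bd[OF hk(1)] bd[OF hk(2)] mult_left_mono[OF hk(4) K(1)] mult_left_mono[OF hk(5) K(1)]
      by (intro norm_triangle_mono) auto
    moreover have "F a = F h + F (\<i> *\<^sub>C k)" by (subst hk(3)) (rule linear_add[OF linear_F])
    ultimately show ?thesis by (simp add: algebra_simps)
  qed
  then show ?thesis by blast
qed

end

section \<open>From complex bimodules to the real linear setting\<close>

theorem theorem3p1:
  fixes lact :: "'a::cstar_algebra \<Rightarrow> 'm::complex_banach \<Rightarrow> 'm"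
    and ract :: "'m \<Rightarrow> 'a \<Rightarrow> 'm"
    and F :: "'a \<Rightarrow> 'm"
  assumes "banach_bimodule lact ract"
    and "generalized_jordan_derivation_third_type lact ract F"
  shows "continuous_on UNIV F"
proof -
  interpret banach_bimodule lact ract by (rule assms(1))
  have lin: "Vector_Spaces.linear scaleC scaleC F"
    using assms(2) by (simp add: generalized_jordan_derivation_third_type_def)
  then have F_add: "F (a + b) = F a + F b" and F_scaleC: "F (c *\<^sub>C a) = c *\<^sub>C F a" for a b c
    by (simp_all add: Vector_Spaces.linear_iff)
  have F_scaleR: "F (r *\<^sub>R a) = r *\<^sub>R F a" for r a
    by (simp add: scaleR_scaleC F_scaleC)
  obtain G H where GH: "\<And>a b. F (jordan_mult a b) = jordan_act lact ract b (G a) + jordan_act lact ract a (H b)"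
    using assms(2) by (auto simp: generalized_jordan_derivation_third_type_def)
  have half: "(1 / 2 :: complex) *\<^sub>C x = (1 / 2 :: real) *\<^sub>R x" for x :: "'b::complex_vector"
    by (simp add: scaleR_scaleC)
  define D where "D a = (1 / 2 :: real) *\<^sub>R (G a + H a)" for a
  interpret l: bounded_bilinear lact by (rule bounded_bilinear_lact)
  interpret r: bounded_bilinear ract by (rule bounded_bilinear_ract)
  \<comment> \<open>Both Jordan products carry the factor 1/2, which cancels. The left side is
    symmetric in \<open>a\<close> and \<open>b\<close>, so averaging with the arguments exchanged
    replaces \<open>G\<close> and \<open>H\<close> by \<open>D\<close>.\<close>
  have GH': "F (a * b + b * a) = lact b (G a) + ract (G a) b + (lact a (H b) + ract (H b) a)" for a b
  proof -
    have "(1 / 2 :: real) *\<^sub>R F (a * b + b * a)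
      = (1 / 2 :: real) *\<^sub>R (lact b (G a) + ract (G a) b + (lact a (H b) + ract (H b) a))"
      using GH[of a b] unfolding jordan_mult_def jordan_act_def half F_scaleR
      by (simp add: scaleR_add_right)
    then show ?thesis by (simp only: scaleR_cancel_left) simp
  qed
  have "jordan_setting lact ract F D"
  proof
    show "F (a * b + b * a) = lact b (D a) + ract (D a) b + (lact a (D b) + ract (D b) a)" for a b
    proof -
      have "F (a * b + b * a) = (1 / 2 :: real) *\<^sub>R (F (a * b + b * a) + F (b * a + a * b))"
        by (simp add: add.commute[of "b * a" "a * b"] flip: scaleR_2)
      also have "\<dots> = lact b (D a) + ract (D a) b + (lact a (D b) + ract (D b) a)"
        unfolding GH' D_def
        by (simp add: l.add_right l.scaleR_right r.add_left r.scaleR_left scaleR_add_right ac_simps)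
      finally show ?thesis .
    qed
  qed (use F_add F_scaleR lact_mult ract_mult lact_ract l.bounded r.bounded in
      \<open>simp_all add: l.add_left l.add_right l.scaleR_left l.scaleR_right r.add_left r.add_right
        r.scaleR_left r.scaleR_right\<close>)
  then interpret jordan_setting lact ract F D .
  obtain K where K: "\<And>a. norm (F a) \<le> K * norm a" using F_bounded by blast
  have "bounded_linear F"
    by (rule bounded_linear_intro[of F K]) (simp_all add: F_add F_scaleR K mult.commute)
  then show ?thesis by (intro linear_continuous_on)
qed

end
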